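(* Let $(\mathcal A^+,\mathcal C,\varphi,\Omega,\Lambda)$ be a $\mathsf\Lambda$-monoidal categorification. Let $M,N$ be two simple objects in $\mathcal C$ such that $\varphi(M)$ and $\varphi(N)$ are good elements in $\mathcal A^+$. If $M$ or $N$ is reachable, then $$\Lambda(M,N)=\langle\varphi(M),\varphi(N)\rangle_{\rm trop}\qquad\text{and}\qquad 2\mathfrak d(M,N)=(\varphi(M)\mid\mid\varphi(N))_F.$$
   Context: Fix integers $m\ge n>0$; $[1,r]=\{1,\dots,r\}$, $[a]_+=\max\{a,0\}$. Vectors are columns; matrices are integral. Cluster algebras. A mutation matrix is an $m\times n$ matrix $\widetilde B=(b_{ij})$ whose top $n\times n$ block $B$ is skew-symmetrizable (there is a diagonal matrix $S$ with positive integer diagonal entries with $SB$ skew-symmetric). $\mu_k(\widetilde B)=(b'_{ij})$ ($k\in[1,n]$) with $b'_{ij}=-b_{ij}$ if $i=k$ or $j=k$, and $b'_{ij}=b_{ij}+[b_{ik}]_+[b_{kj}]_+-[-b_{ik}]_+[-b_{kj}]_+$ otherwise. A seed is $(\mathbf x,\widetilde B)$, $\mathbf x=(x_1,\dots,x_m)$ a free generating set over $\mathbb Q$ of the field $\mathbb F$ of rational functions in $m$ variables, $\widetilde B$ a mutation matrix; $\mu_k(\mathbf x,\widetilde B)=(\mathbf x',\mu_k(\widetilde B))$ with $x_i'=x_i$ for $i\ne k$, $x_kx_k'=\prod_jx_j^{[b_{jk}]_+}+\prod_jx_j^{[-b_{jk}]_+}$. $\mathbb T_n$ is the $n$-regular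 tree with edges labelled $1,\dots,n$, distinct labels at each vertex, root $t_0$. A cluster pattern assigns to each $t\in\mathbb T_n$ a seed $(\mathbf x_t,\widetilde B_t)$, seeds at the ends of an edge labelled $k$ being related by $\mu_k$; $\widetilde B_t=(b_{ij;t})$, $\hat y_{k;t}=\prod_jx_{j;t}^{b_{jk;t}}$. $\mathcal A^+=\mathbb Z[x_{1;t},\dots,x_{m;t}\mid t\in\mathbb T_n]$ is the cluster algebra with non-inverted frozen variables $x_{n+1;t},\dots,x_{m;t}$; $\mathcal U=\bigcap_t\mathbb Z[x_{1;t}^{\pm1},\dots,x_{m;t}^{\pm1}]\supseteq\mathcal A^+$. Cluster monomials of $\mathcal A^+$ are the $\mathbf x_t^{\mathbf a}=\prod_{j=1}^m x_{j;t}^{a_j}$, $\mathbf a\in\mathbb Z_{\ge0}^m$. Compatible pair of type $S=\mathrm{diag}(s_1,\dots,s_n)$, $s_i\in\mathbb Z_{>0}$: $(\widetilde B,\Lambda)$ with $\Lambda$ an $m\times m$ skew-symmetric integer matrix and $\widetilde B^T\Lambda=(S\mid\mathbf0)$. Monoidal categorification. $\mathcal C$ is a $\mathbf k$-linear monoidal abelian category ($\mathbf k$ a field) with all objects of finite length; its Grothendieck group $\mathcal K_0(\mathcal C)$ is a ring via $[M][N]=[M\otimes N]$. $(\mathcal A^+,\mathcal C,\varphi)$ is a monoidal categorification if $\varphi:\mathcal K_0(\mathcal C)\to\mathcal A^+$ is a ring isomorphism such that cluster monomials of $\mathcal A^+$ correspond to a subset of the isomorphism classes of simple objects. Write $\varphi(M)=\varphi([M])$.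 A simple $M$ is reachable if $\varphi(M)$ is a cluster monomial. $\mathcal M_t=(M_{1;t},\dots,M_{m;t})$, with $M_{i;t}$ simple and $\varphi(M_{i;t})=x_{i;t}$, is the monoidal cluster at $t$. A simple $M$ is real if $M\otimes M$ is simple; simples $M,N$ strongly commute if $M\otimes N\cong N\otimes M$ and this is simple. $M\nabla N$ denotes the head of $M\otimes N$. $\mathsf\Lambda$-structure on $\mathcal C$: a pair $(\Omega,\Lambda)$ where $\Omega$ is a class of nonzero objects containing all simples and closed under isomorphism, tensor products and nonzero subquotients, and $\Lambda:\Omega\times\Omega\to\mathbb Z$ satisfies: (a1) $\Lambda(M,N)$ depends only on isomorphism classes; (a2) with $\mathfrak d(M,N):=\frac12(\Lambda(M,N)+\Lambda(N,M))$, one has $\mathfrak d(M,N)=0$ if $M,N$ are real simples that strongly commute; (a3) for $M,N,L\in\Omega$ with $L$ simple, $\Lambda(M\otimes N,L)=\Lambda(M,L)+\Lambda(N,L)$ and $\Lambda(L,M\otimes N)=\Lambda(L,M)+\Lambda(L,N)$; (a4) for simple $M,N,L$ with $L$ real: if $L$ strongly commutes with $N$ then $\Lambda(M\nabla N,L)=\Lambda(M,L)+\Lambda(N,L)$, and if $L$ strongly commutes with $M$ then $\Lambda(L,M\nabla N)=\Lambda(L,M)+\Lambda(L,N)$; (a5) $\Lambda(M',N')\le\Lambda(M,N)$ for nonzero subquotients $M'$ of $M$ and $N'$ of $N$. $(\mathcal A^+,\mathcal C,\varphi,\Omega,\Lambda)$ is a $\mathsf\Lambda$-monoidal categorification if $(\mathcal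 A^+,\mathcal C,\varphi)$ is a monoidal categorification, $(\Omega,\Lambda)$ is a $\mathsf\Lambda$-structure on $\mathcal C$, and: (c1) for simples $M,N$ at least one of which is real, $M\nabla N$ is simple; (c2) for some $w\in\mathbb T_n$, $(\widetilde B_w,\Lambda_w)$ is a compatible pair, where $\Lambda_t:=(\Lambda(M_{i;t},M_{j;t}))_{i,j\in[1,m]}$. Fact: then for all $t$, $(\widetilde B_t,\Lambda_t)$ is a compatible pair (of a common type $S$), and along an edge $t\overset{k}{-}t'$ one has $\Lambda_{t'}=E^T\Lambda_tE$, where $E$ is $I_m$ with $k$th column replaced by $e_k=-1$, $e_i=[-\varepsilon b_{ik;t}]_+$ ($\varepsilon\in\{\pm1\}$ arbitrary). So $\mathcal A^+$ with $\{\Lambda_t\}$ is a $\mathsf\Lambda$-cluster algebra. Good elements. A tropical point is a family $\{\mathbf g^t\in\mathbb Z^m\}_{t\in\mathbb T_n}$ such that along an edge $t\overset{k}{-}t'$: $g_k^{t'}=-g_k^t$, $g_i^{t'}=g_i^t+[-b_{ik;t}]_+g_k^t+b_{ik;t}[g_k^t]_+$ ($i\neq k$). $u\in\mathcal A^+$ is good if for every $t$ one can write $u=\mathbf x_t^{\mathbf g_u^t}F_u^t(\hat y_{1;t},\dots,\hat y_{n;t})$ with $\mathbf g_u^t\in\mathbb Z^m$, $F_u^t\in\mathbb Z[y_1,\dots,y_n]$ of constant term $1$ (unique), $\{\mathbf g_u^t\}_t$ is a tropical point, and $u\in\mathbb Z_{\ge0}[x_{1;t}^{\pm1},\dots,x_{m;t}^{\pm1}]$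 for all $t$. Invariants. For good $u$ there is a unique semifield homomorphism $\beta_u:\mathbb Q_{\rm sf}(x_{1;t_0},\dots,x_{m;t_0})\to\mathbb Z^{\max}=(\mathbb Z,+,\max)$ (source: nonzero rational functions with subtraction-free expressions) with $(\beta_u(x_{1;t}),\dots,\beta_u(x_{m;t}))=(\Lambda_t\mathbf g_u^t)^T$ for all $t$. For good $u,u'$: $\langle u,u'\rangle_{\rm trop}:=\beta_{u'}(u)$, $(u\mid\mid u')_F:=\beta_{u'}(u)+\beta_u(u')$. *)

theory Defs
  imports
    "HOL-Algebra.Free_Abelian_Groups"
    "HOL-Algebra.QuotRing"
    "HOL-Algebra.Module"
    "Jordan_Normal_Form.Matrix"
begin

text \<open>
  Indices are shifted by one: the range \<open>[1,m]\<close> becomes \<open>{..<m}\<close>, with mutable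
  directions \<open>{..<n}\<close>, so that the library's matrices and vectors can be used.
\<close>

section \<open>Linear monoidal abelian categories\<close>

record ('o, 'a, 'k) mon_cat =
  Obj :: "'o set"
  Arr :: "'a set"
  Dom :: "'a \<Rightarrow> 'o"
  Cod :: "'a \<Rightarrow> 'o"
  idt :: "'o \<Rightarrow> 'a"
  cmp :: "'a \<Rightarrow> 'a \<Rightarrow> 'a" (infixr \<open>\<cdot>\<index>\<close> 75)
  hadd :: "'a \<Rightarrow> 'a \<Rightarrow> 'a" (infixl \<open>+\<^sub>h\<index>\<close> 65)
  hzero :: "'o \<Rightarrow> 'o \<Rightarrow> 'a"
  hscale :: "'k \<Rightarrow> 'a \<Rightarrow> 'a" (infixr \<open>*\<^sub>h\<index>\<close> 76)
  tens :: "'o \<Rightarrow> 'o \<Rightarrow> 'o" (infixr \<open>\<boxtimes>\<index>\<close> 78)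
  tensa :: "'a \<Rightarrow> 'a \<Rightarrow> 'a" (infixr \<open>\<boxtimes>\<^sub>h\<index>\<close> 78)
  munit :: "'o"
  associator :: "'o \<Rightarrow> 'o \<Rightarrow> 'o \<Rightarrow> 'a"
  lunitor :: "'o \<Rightarrow> 'a"
  runitor :: "'o \<Rightarrow> 'a"

definition Hom :: "('o, 'a, 'k, 'z) mon_cat_scheme \<Rightarrow> 'o \<Rightarrow> 'o \<Rightarrow> 'a set" where
  "Hom C X Y = {f \<in> Arr C. Dom C f = X \<and> Cod C f = Y}"

text \<open>The fields \<open>monoid.mult\<close> and \<open>one\<close> of the record are irrelevant for modules.\<close>

definition hom_module ::
    "('o, 'a, 'k, 'z) mon_cat_scheme \<Rightarrow> 'o \<Rightarrow> 'o \<Rightarrow> ('k, 'a) module" where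
  "hom_module C X Y =
    \<lparr>carrier = Hom C X Y, monoid.mult = undefined, one = undefined,
     zero = hzero C X Y, add = hadd C, smult = hscale C\<rparr>"

definition is_iso :: "('o, 'a, 'k, 'z) mon_cat_scheme \<Rightarrow> 'a \<Rightarrow> bool" where
  "is_iso C f \<longleftrightarrow> f \<in> Arr C \<and>
    (\<exists>g \<in> Hom C (Cod C f) (Dom C f).
       g \<cdot>\<^bsub>C\<^esub> f = idt C (Dom C f) \<and> f \<cdot>\<^bsub>C\<^esub> g = idt C (Cod C f))"

definition iso_objs :: "('o, 'a, 'k, 'z) mon_cat_scheme \<Rightarrow> 'o \<Rightarrow> 'o \<Rightarrow> bool" where
  "iso_objs C X Y \<longleftrightarrow> X \<in> Obj C \<and> Y \<in> Obj C \<and> (\<exists>f \<in> Hom C X Y. is_iso C f)"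

definition is_mono :: "('o, 'a, 'k, 'z) mon_cat_scheme \<Rightarrow> 'a \<Rightarrow> bool" where
  "is_mono C f \<longleftrightarrow> f \<in> Arr C \<and>
    (\<forall>W \<in> Obj C. \<forall>g \<in> Hom C W (Dom C f). \<forall>h \<in> Hom C W (Dom C f).
       f \<cdot>\<^bsub>C\<^esub> g = f \<cdot>\<^bsub>C\<^esub> h \<longrightarrow> g = h)"

definition is_epi :: "('o, 'a, 'k, 'z) mon_cat_scheme \<Rightarrow> 'a \<Rightarrow> bool" where
  "is_epi C f \<longleftrightarrow> f \<in> Arr C \<and>
    (\<forall>W \<in> Obj C. \<forall>g \<in> Hom C (Cod C f) W. \<forall>h \<in> Hom C (Cod C f) W.
       g \<cdot>\<^bsub>C\<^esub> f = h \<cdot>\<^bsub>C\<^esub> f \<longrightarrow> g = h)"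

definition is_zero_obj :: "('o, 'a, 'k, 'z) mon_cat_scheme \<Rightarrow> 'o \<Rightarrow> bool" where
  "is_zero_obj C Z \<longleftrightarrow> Z \<in> Obj C \<and>
    (\<forall>X \<in> Obj C. (\<exists>!f. f \<in> Hom C Z X) \<and> (\<exists>!f. f \<in> Hom C X Z))"

definition is_biproduct :: "('o, 'a, 'k, 'z) mon_cat_scheme \<Rightarrow> 'o \<Rightarrow> 'o \<Rightarrow> 'o \<Rightarrow> bool" where
  "is_biproduct C X Y P \<longleftrightarrow> X \<in> Obj C \<and> Y \<in> Obj C \<and> P \<in> Obj C \<and>
    (\<exists>i \<in> Hom C X P. \<exists>j \<in> Hom C Y P. \<exists>p \<in> Hom C P X. \<exists>q \<in> Hom C P Y.
       p \<cdot>\<^bsub>C\<^esub> i = idt C X \<and> q \<cdot>\<^bsub>C\<^esub> j = idt C Y \<and>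
       p \<cdot>\<^bsub>C\<^esub> j = hzero C Y X \<and> q \<cdot>\<^bsub>C\<^esub> i = hzero C X Y \<and>
       (i \<cdot>\<^bsub>C\<^esub> p) +\<^sub>h\<^bsub>C\<^esub> (j \<cdot>\<^bsub>C\<^esub> q) = idt C P)"

definition is_kernel :: "('o, 'a, 'k, 'z) mon_cat_scheme \<Rightarrow> 'a \<Rightarrow> 'a \<Rightarrow> bool" where
  "is_kernel C k f \<longleftrightarrow> f \<in> Arr C \<and> k \<in> Arr C \<and> Cod C k = Dom C f \<and>
    f \<cdot>\<^bsub>C\<^esub> k = hzero C (Dom C k) (Cod C f) \<and>
    (\<forall>W \<in> Obj C. \<forall>h \<in> Hom C W (Dom C f). f \<cdot>\<^bsub>C\<^esub> h = hzero C W (Cod C f) \<longrightarrow>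
       (\<exists>!h'. h' \<in> Hom C W (Dom C k) \<and> k \<cdot>\<^bsub>C\<^esub> h' = h))"

definition is_cokernel :: "('o, 'a, 'k, 'z) mon_cat_scheme \<Rightarrow> 'a \<Rightarrow> 'a \<Rightarrow> bool" where
  "is_cokernel C c f \<longleftrightarrow> f \<in> Arr C \<and> c \<in> Arr C \<and> Dom C c = Cod C f \<and>
    c \<cdot>\<^bsub>C\<^esub> f = hzero C (Dom C f) (Cod C c) \<and>
    (\<forall>W \<in> Obj C. \<forall>h \<in> Hom C (Cod C f) W. h \<cdot>\<^bsub>C\<^esub> f = hzero C (Dom C f) W \<longrightarrow>
       (\<exists>!h'. h' \<in> Hom C (Cod C c) W \<and> h' \<cdot>\<^bsub>C\<^esub> c = h))"

definition short_exact :: "('o, 'a, 'k, 'z) mon_cat_scheme \<Rightarrow> 'a \<Rightarrow> 'a \<Rightarrow> bool" where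
  "short_exact C f g \<longleftrightarrow> is_kernel C f g \<and> is_cokernel C g f"

definition subquotient :: "('o, 'a, 'k, 'z) mon_cat_scheme \<Rightarrow> 'o \<Rightarrow> 'o \<Rightarrow> bool" where
  "subquotient C X' X \<longleftrightarrow>
    (\<exists>i p. is_mono C i \<and> Cod C i = X \<and> is_epi C p \<and> Dom C p = Dom C i \<and> Cod C p = X')"

definition simple_obj :: "('o, 'a, 'k, 'z) mon_cat_scheme \<Rightarrow> 'o \<Rightarrow> bool" where
  "simple_obj C X \<longleftrightarrow> X \<in> Obj C \<and> \<not> is_zero_obj C X \<and>
    (\<forall>i. is_mono C i \<and> Cod C i = X \<longrightarrow> is_zero_obj C (Dom C i) \<or> is_iso C i)"

text \<open>Finite length means existence of a composition series, built up from the bottom.\<close>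

inductive finite_length :: "('o, 'a, 'k, 'z) mon_cat_scheme \<Rightarrow> 'o \<Rightarrow> bool" for C where
  zero: "is_zero_obj C Z \<Longrightarrow> finite_length C Z"
| step: "\<lbrakk>short_exact C f g; finite_length C (Dom C f); simple_obj C (Cod C g)\<rbrakk>
          \<Longrightarrow> finite_length C (Cod C f)"

inductive semisimple_obj :: "('o, 'a, 'k, 'z) mon_cat_scheme \<Rightarrow> 'o \<Rightarrow> bool" for C where
  zero: "is_zero_obj C Z \<Longrightarrow> semisimple_obj C Z"
| step: "\<lbrakk>semisimple_obj C X; simple_obj C S; is_biproduct C X S P\<rbrakk> \<Longrightarrow> semisimple_obj C P"

text \<open>The head is the largest semisimple quotient; it is determined up to isomorphism.\<close>

definition is_head :: "('o, 'a, 'k, 'z) mon_cat_scheme \<Rightarrow> 'o \<Rightarrow> 'o \<Rightarrow> bool" where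
  "is_head C X H \<longleftrightarrow> semisimple_obj C H \<and>
    (\<exists>q \<in> Hom C X H. is_epi C q \<and>
      (\<forall>Y. \<forall>p \<in> Hom C X Y. is_epi C p \<and> semisimple_obj C Y \<longrightarrow>
         (\<exists>h \<in> Hom C H Y. p = h \<cdot>\<^bsub>C\<^esub> q)))"

definition head_tensor :: "('o, 'a, 'k, 'z) mon_cat_scheme \<Rightarrow> 'o \<Rightarrow> 'o \<Rightarrow> 'o"
    (infixr \<open>\<nabla>\<index>\<close> 78) where
  "M \<nabla>\<^bsub>C\<^esub> N = (SOME H. is_head C (M \<boxtimes>\<^bsub>C\<^esub> N) H)"

definition real_simple :: "('o, 'a, 'k, 'z) mon_cat_scheme \<Rightarrow> 'o \<Rightarrow> bool" where
  "real_simple C M \<longleftrightarrow> simple_obj C M \<and> simple_obj C (M \<boxtimes>\<^bsub>C\<^esub> M)"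

definition strongly_commute :: "('o, 'a, 'k, 'z) mon_cat_scheme \<Rightarrow> 'o \<Rightarrow> 'o \<Rightarrow> bool" where
  "strongly_commute C M N \<longleftrightarrow> simple_obj C M \<and> simple_obj C N \<and>
    iso_objs C (M \<boxtimes>\<^bsub>C\<^esub> N) (N \<boxtimes>\<^bsub>C\<^esub> M) \<and> simple_obj C (M \<boxtimes>\<^bsub>C\<^esub> N)"

locale mcat =
  fixes C :: "('o, 'a, 'k, 'z) mon_cat_scheme" (structure)
  assumes Dom_in: "f \<in> Arr C \<Longrightarrow> Dom C f \<in> Obj C"
    and Cod_in: "f \<in> Arr C \<Longrightarrow> Cod C f \<in> Obj C"
    and idt_in: "X \<in> Obj C \<Longrightarrow> idt C X \<in> Hom C X X"
    and cmp_in: "\<lbrakk>f \<in> Hom C X Y; g \<in> Hom C Y Z\<rbrakk> \<Longrightarrow> g \<cdot> f \<in> Hom C X Z"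
    and cmp_idt: "f \<in> Hom C X Y \<Longrightarrow> f \<cdot> idt C X = f"
    and idt_cmp: "f \<in> Hom C X Y \<Longrightarrow> idt C Y \<cdot> f = f"
    and cmp_assoc: "\<lbrakk>f \<in> Hom C W X; g \<in> Hom C X Y; h \<in> Hom C Y Z\<rbrakk>
                     \<Longrightarrow> (h \<cdot> g) \<cdot> f = h \<cdot> (g \<cdot> f)"

locale linear_mcat = mcat C
  for K :: "('k, 'r) ring_scheme" and C :: "('o, 'a, 'k, 'z) mon_cat_scheme" (structure) +
  assumes K_field: "field K"
    and hom_mod: "\<lbrakk>X \<in> Obj C; Y \<in> Obj C\<rbrakk> \<Longrightarrow> Module.module K (hom_module C X Y)"
    and cmp_add_left: "\<lbrakk>f \<in> Hom C X Y; g \<in> Hom C Y Z; g' \<in> Hom C Y Z\<rbrakk>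
                        \<Longrightarrow> (g +\<^sub>h g') \<cdot> f = (g \<cdot> f) +\<^sub>h (g' \<cdot> f)"
    and cmp_add_right: "\<lbrakk>f \<in> Hom C X Y; f' \<in> Hom C X Y; g \<in> Hom C Y Z\<rbrakk>
                        \<Longrightarrow> g \<cdot> (f +\<^sub>h f') = (g \<cdot> f) +\<^sub>h (g \<cdot> f')"
    and cmp_scale_left: "\<lbrakk>c \<in> carrier K; f \<in> Hom C X Y; g \<in> Hom C Y Z\<rbrakk>
                        \<Longrightarrow> (c *\<^sub>h g) \<cdot> f = c *\<^sub>h (g \<cdot> f)"
    and cmp_scale_right: "\<lbrakk>c \<in> carrier K; f \<in> Hom C X Y; g \<in> Hom C Y Z\<rbrakk>
                        \<Longrightarrow> g \<cdot> (c *\<^sub>h f) = c *\<^sub>h (g \<cdot> f)"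

locale abelian_mcat = linear_mcat K C
  for K :: "('k, 'r) ring_scheme" and C :: "('o, 'a, 'k, 'z) mon_cat_scheme" (structure) +
  assumes ex_zero: "\<exists>Z. is_zero_obj C Z"
    and ex_biproduct: "\<lbrakk>X \<in> Obj C; Y \<in> Obj C\<rbrakk> \<Longrightarrow> \<exists>P. is_biproduct C X Y P"
    and ex_kernel: "f \<in> Arr C \<Longrightarrow> \<exists>k. is_kernel C k f"
    and ex_cokernel: "f \<in> Arr C \<Longrightarrow> \<exists>c. is_cokernel C c f"
    and mono_normal: "is_mono C f \<Longrightarrow> \<exists>g. is_kernel C f g"
    and epi_normal: "is_epi C f \<Longrightarrow> \<exists>g. is_cokernel C f g"

locale monoidal_abelian_mcat = abelian_mcat K C
  for K :: "('k, 'r) ring_scheme" and C :: "('o, 'a, 'k, 'z) mon_cat_scheme" (structure) +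
  assumes tens_in: "\<lbrakk>X \<in> Obj C; Y \<in> Obj C\<rbrakk> \<Longrightarrow> X \<boxtimes> Y \<in> Obj C"
    and tensa_in: "\<lbrakk>f \<in> Hom C X X'; g \<in> Hom C Y Y'\<rbrakk>
                    \<Longrightarrow> f \<boxtimes>\<^sub>h g \<in> Hom C (X \<boxtimes> Y) (X' \<boxtimes> Y')"
    and tensa_idt: "\<lbrakk>X \<in> Obj C; Y \<in> Obj C\<rbrakk> \<Longrightarrow> idt C X \<boxtimes>\<^sub>h idt C Y = idt C (X \<boxtimes> Y)"
    and tensa_cmp: "\<lbrakk>f \<in> Hom C X X'; f' \<in> Hom C X' X''; g \<in> Hom C Y Y'; g' \<in> Hom C Y' Y''\<rbrakk>
                    \<Longrightarrow> (f' \<cdot> f) \<boxtimes>\<^sub>h (g' \<cdot> g) = (f' \<boxtimes>\<^sub>h g') \<cdot> (f \<boxtimes>\<^sub>h g)"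
    and tensa_add_left: "\<lbrakk>f \<in> Hom C X X'; f' \<in> Hom C X X'; g \<in> Hom C Y Y'\<rbrakk>
                    \<Longrightarrow> (f +\<^sub>h f') \<boxtimes>\<^sub>h g = (f \<boxtimes>\<^sub>h g) +\<^sub>h (f' \<boxtimes>\<^sub>h g)"
    and tensa_add_right: "\<lbrakk>f \<in> Hom C X X'; g \<in> Hom C Y Y'; g' \<in> Hom C Y Y'\<rbrakk>
                    \<Longrightarrow> f \<boxtimes>\<^sub>h (g +\<^sub>h g') = (f \<boxtimes>\<^sub>h g) +\<^sub>h (f \<boxtimes>\<^sub>h g')"
    and tensa_scale_left: "\<lbrakk>c \<in> carrier K; f \<in> Hom C X X'; g \<in> Hom C Y Y'\<rbrakk>
                    \<Longrightarrow> (c *\<^sub>h f) \<boxtimes>\<^sub>h g = c *\<^sub>h (f \<boxtimes>\<^sub>h g)"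
    and tensa_scale_right: "\<lbrakk>c \<in> carrier K; f \<in> Hom C X X'; g \<in> Hom C Y Y'\<rbrakk>
                    \<Longrightarrow> f \<boxtimes>\<^sub>h (c *\<^sub>h g) = c *\<^sub>h (f \<boxtimes>\<^sub>h g)"
    and munit_in: "munit C \<in> Obj C"
    and associator_in: "\<lbrakk>X \<in> Obj C; Y \<in> Obj C; Z \<in> Obj C\<rbrakk>
                    \<Longrightarrow> associator C X Y Z \<in> Hom C ((X \<boxtimes> Y) \<boxtimes> Z) (X \<boxtimes> (Y \<boxtimes> Z))"
    and associator_iso: "\<lbrakk>X \<in> Obj C; Y \<in> Obj C; Z \<in> Obj C\<rbrakk> \<Longrightarrow> is_iso C (associator C X Y Z)"
    and associator_nat: "\<lbrakk>f \<in> Hom C X X'; g \<in> Hom C Y Y'; h \<in> Hom C Z Z'\<rbrakk>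
                    \<Longrightarrow> associator C X' Y' Z' \<cdot> ((f \<boxtimes>\<^sub>h g) \<boxtimes>\<^sub>h h)
                        = (f \<boxtimes>\<^sub>h (g \<boxtimes>\<^sub>h h)) \<cdot> associator C X Y Z"
    and lunitor_in: "X \<in> Obj C \<Longrightarrow> lunitor C X \<in> Hom C (munit C \<boxtimes> X) X"
    and lunitor_iso: "X \<in> Obj C \<Longrightarrow> is_iso C (lunitor C X)"
    and lunitor_nat: "f \<in> Hom C X Y \<Longrightarrow>
                    lunitor C Y \<cdot> (idt C (munit C) \<boxtimes>\<^sub>h f) = f \<cdot> lunitor C X"
    and runitor_in: "X \<in> Obj C \<Longrightarrow> runitor C X \<in> Hom C (X \<boxtimes> munit C) X"
    and runitor_iso: "X \<in> Obj C \<Longrightarrow> is_iso C (runitor C X)"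
    and runitor_nat: "f \<in> Hom C X Y \<Longrightarrow>
                    runitor C Y \<cdot> (f \<boxtimes>\<^sub>h idt C (munit C)) = f \<cdot> runitor C X"
    and pentagon: "\<lbrakk>W \<in> Obj C; X \<in> Obj C; Y \<in> Obj C; Z \<in> Obj C\<rbrakk> \<Longrightarrow>
                    (idt C W \<boxtimes>\<^sub>h associator C X Y Z) \<cdot>
                      (associator C W (X \<boxtimes> Y) Z \<cdot> (associator C W X Y \<boxtimes>\<^sub>h idt C Z))
                    = associator C W X (Y \<boxtimes> Z) \<cdot> associator C (W \<boxtimes> X) Y Z"
    and triangle: "\<lbrakk>X \<in> Obj C; Y \<in> Obj C\<rbrakk> \<Longrightarrow>
                    (idt C X \<boxtimes>\<^sub>h lunitor C Y) \<cdot> associator C X (munit C) Y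
                    = runitor C X \<boxtimes>\<^sub>h idt C Y"

section \<open>The Grothendieck ring\<close>

definition K0_rels :: "('o, 'a, 'k, 'z) mon_cat_scheme \<Rightarrow> ('o \<Rightarrow>\<^sub>0 int) set" where
  "K0_rels C = generate (free_Abelian_group (Obj C))
    {frag_of (Cod C f) - frag_of (Dom C f) - frag_of (Cod C g) | f g. short_exact C f g}"

definition K0_class :: "('o, 'a, 'k, 'z) mon_cat_scheme \<Rightarrow> 'o \<Rightarrow> ('o \<Rightarrow>\<^sub>0 int) set" where
  "K0_class C X = K0_rels C #>\<^bsub>free_Abelian_group (Obj C)\<^esub> frag_of X"

definition frag_tens ::
    "('o, 'a, 'k, 'z) mon_cat_scheme \<Rightarrow> ('o \<Rightarrow>\<^sub>0 int) \<Rightarrow> ('o \<Rightarrow>\<^sub>0 int) \<Rightarrow> ('o \<Rightarrow>\<^sub>0 int)" where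
  "frag_tens C a b = frag_extend (\<lambda>X. frag_extend (\<lambda>Y. frag_of (X \<boxtimes>\<^bsub>C\<^esub> Y)) b) a"

text \<open>
  The product of two classes is the union of the cosets of all products of representatives.
  It is again a single coset exactly when \<open>[X][Y] = [X \<boxtimes> Y]\<close> gives a well-defined
  product, so \<open>ring (K0 C)\<close> includes well-definedness. Exactness of the tensor product is not
  assumed beyond this.
\<close>

definition K0 :: "('o, 'a, 'k, 'z) mon_cat_scheme \<Rightarrow> ('o \<Rightarrow>\<^sub>0 int) set ring" where
  "K0 C = (let G = free_Abelian_group (Obj C); H = K0_rels C in
    \<lparr>carrier = carrier (G Mod H),
     monoid.mult = (\<lambda>A B. \<Union>a\<in>A. \<Union>b\<in>B. H #>\<^bsub>G\<^esub> frag_tens C a b),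
     one = K0_class C (munit C),
     zero = \<one>\<^bsub>G Mod H\<^esub>,
     add = monoid.mult (G Mod H)\<rparr>)"

section \<open>Cluster algebras\<close>

text \<open>Evaluation of a polynomial in the variables indexed by the natural numbers.\<close>

definition mpoly_eval ::
    "('c::zero \<Rightarrow> 'f::field) \<Rightarrow> (nat \<Rightarrow> 'f) \<Rightarrow> ((nat \<Rightarrow>\<^sub>0 nat) \<Rightarrow>\<^sub>0 'c) \<Rightarrow> 'f" where
  "mpoly_eval h x p = (\<Sum>a \<in> Poly_Mapping.keys p. h (Poly_Mapping.lookup p a) *
     (\<Prod>i \<in> Poly_Mapping.keys a. x i ^ Poly_Mapping.lookup a i))"

definition mpoly_in :: "nat \<Rightarrow> ((nat \<Rightarrow>\<^sub>0 nat) \<Rightarrow>\<^sub>0 'c::zero) \<Rightarrow> bool" where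
  "mpoly_in r p \<longleftrightarrow> (\<forall>a \<in> Poly_Mapping.keys p. Poly_Mapping.keys a \<subseteq> {..<r})"

text \<open>
  \<open>'f\<close> is the ambient field. Demanding a free generating set of size \<open>m\<close> for the whole type
  makes it a field of rational functions in \<open>m\<close> variables over the rationals.
\<close>

definition free_generating :: "nat \<Rightarrow> 'f::field_char_0 vec \<Rightarrow> bool" where
  "free_generating m x \<longleftrightarrow> x \<in> carrier_vec m \<and>
    (\<forall>p. mpoly_in m p \<and> mpoly_eval of_rat (($) x) p = 0 \<longrightarrow> p = 0) \<and>
    (\<forall>z. \<exists>p q. mpoly_in m p \<and> mpoly_in m q \<and> mpoly_eval of_rat (($) x) q \<noteq> 0 \<and>
       z = mpoly_eval of_rat (($) x) p / mpoly_eval of_rat (($) x) q)"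

abbreviation pos_part :: "int \<Rightarrow> int" (\<open>[_]\<^sub>+\<close>) where
  "[a]\<^sub>+ \<equiv> max a 0"

definition mutation_matrix :: "nat \<Rightarrow> nat \<Rightarrow> int mat \<Rightarrow> bool" where
  "mutation_matrix m n B \<longleftrightarrow> B \<in> carrier_mat m n \<and>
    (\<exists>s. (\<forall>i<n. s i > 0) \<and>
         (\<forall>i<n. \<forall>j<n. s i * B $$ (i, j) = - (s j * B $$ (j, i))))"

definition mutate_mat :: "nat \<Rightarrow> int mat \<Rightarrow> int mat" where
  "mutate_mat k B = mat (dim_row B) (dim_col B) (\<lambda>(i, j).
     if i = k \<or> j = k then - B $$ (i, j)
     else B $$ (i, j) + [B $$ (i, k)]\<^sub>+ * [B $$ (k, j)]\<^sub>+ - [- B $$ (i, k)]\<^sub>+ * [- B $$ (k, j)]\<^sub>+)"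

type_synonym 'f seed = "'f vec \<times> int mat"

definition is_seed :: "nat \<Rightarrow> nat \<Rightarrow> 'f::field_char_0 seed \<Rightarrow> bool" where
  "is_seed m n S \<longleftrightarrow> free_generating m (fst S) \<and> mutation_matrix m n (snd S)"

definition mutate_seed :: "nat \<Rightarrow> 'f::field seed \<Rightarrow> 'f seed" where
  "mutate_seed k = (\<lambda>(x, B).
     (vec (dim_vec x) (\<lambda>i.
        if i = k then
          ((\<Prod>j<dim_vec x. x $ j ^ nat [B $$ (j, k)]\<^sub>+) +
           (\<Prod>j<dim_vec x. x $ j ^ nat [- B $$ (j, k)]\<^sub>+)) / x $ k
        else x $ i),
      mutate_mat k B))"

text \<open>
  The vertices of the \<open>n\<close>-regular tree are the words in the edge labels without equal
  neighbours (the labels along the path to the root, which is \<open>[]\<close>).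
\<close>

definition tree_verts :: "nat \<Rightarrow> nat list set" where
  "tree_verts n = {t. set t \<subseteq> {..<n} \<and> distinct_adj t}"

definition tree_edge :: "nat \<Rightarrow> nat \<Rightarrow> nat list \<Rightarrow> nat list \<Rightarrow> bool" where
  "tree_edge n k t t' \<longleftrightarrow>
     t \<in> tree_verts n \<and> t' \<in> tree_verts n \<and> (t' = k # t \<or> t = k # t')"

type_synonym 'f pattern = "nat list \<Rightarrow> 'f seed"

abbreviation xv :: "'f pattern \<Rightarrow> nat list \<Rightarrow> 'f vec" where
  "xv P t \<equiv> fst (P t)"

abbreviation bm :: "'f pattern \<Rightarrow> nat list \<Rightarrow> int mat" where
  "bm P t \<equiv> snd (P t)"

definition cluster_pattern :: "nat \<Rightarrow> nat \<Rightarrow> 'f::field_char_0 pattern \<Rightarrow> bool" where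
  "cluster_pattern m n P \<longleftrightarrow> (\<forall>t \<in> tree_verts n. is_seed m n (P t)) \<and>
     (\<forall>k t t'. tree_edge n k t t' \<longrightarrow> P t' = mutate_seed k (P t))"

definition yhat :: "nat \<Rightarrow> 'f::field pattern \<Rightarrow> nat list \<Rightarrow> nat \<Rightarrow> 'f" where
  "yhat m P t k = (\<Prod>j<m. xv P t $ j powi bm P t $$ (j, k))"

inductive_set int_alg :: "'f::field set \<Rightarrow> 'f set" for X where
  gen: "x \<in> X \<Longrightarrow> x \<in> int_alg X"
| one: "1 \<in> int_alg X"
| diff: "\<lbrakk>a \<in> int_alg X; b \<in> int_alg X\<rbrakk> \<Longrightarrow> a - b \<in> int_alg X"
| mult: "\<lbrakk>a \<in> int_alg X; b \<in> int_alg X\<rbrakk> \<Longrightarrow> a * b \<in> int_alg X"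

inductive_set nat_alg :: "'f::field set \<Rightarrow> 'f set" for X where
  gen: "x \<in> X \<Longrightarrow> x \<in> nat_alg X"
| zero: "0 \<in> nat_alg X"
| one: "1 \<in> nat_alg X"
| add: "\<lbrakk>a \<in> nat_alg X; b \<in> nat_alg X\<rbrakk> \<Longrightarrow> a + b \<in> nat_alg X"
| mult: "\<lbrakk>a \<in> nat_alg X; b \<in> nat_alg X\<rbrakk> \<Longrightarrow> a * b \<in> nat_alg X"

text \<open>Subtraction-free expressions; over free generators these never vanish.\<close>

inductive_set subtraction_free :: "'f::field set \<Rightarrow> 'f set" for X where
  gen: "x \<in> X \<Longrightarrow> x \<in> subtraction_free X"
| add: "\<lbrakk>a \<in> subtraction_free X; b \<in> subtraction_free X\<rbrakk> \<Longrightarrow> a + b \<in> subtraction_free X"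
| mult: "\<lbrakk>a \<in> subtraction_free X; b \<in> subtraction_free X\<rbrakk> \<Longrightarrow> a * b \<in> subtraction_free X"
| divide: "\<lbrakk>a \<in> subtraction_free X; b \<in> subtraction_free X\<rbrakk> \<Longrightarrow> a / b \<in> subtraction_free X"

definition cluster_algebra :: "nat \<Rightarrow> nat \<Rightarrow> 'f::field pattern \<Rightarrow> 'f set" where
  "cluster_algebra m n P = int_alg {xv P t $ i | t i. t \<in> tree_verts n \<and> i < m}"

definition cluster_ring :: "nat \<Rightarrow> nat \<Rightarrow> 'f::field pattern \<Rightarrow> 'f ring" where
  "cluster_ring m n P =
     \<lparr>carrier = cluster_algebra m n P, monoid.mult = (*), one = 1, zero = 0, add = (+)\<rparr>"

definition cluster_monomial :: "nat \<Rightarrow> nat \<Rightarrow> 'f::field pattern \<Rightarrow> 'f \<Rightarrow> bool" where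
  "cluster_monomial m n P z \<longleftrightarrow>
     (\<exists>t \<in> tree_verts n. \<exists>a :: nat \<Rightarrow> nat. z = (\<Prod>j<m. xv P t $ j ^ a j))"

definition compatible_pair :: "nat \<Rightarrow> nat \<Rightarrow> int mat \<Rightarrow> int mat \<Rightarrow> bool" where
  "compatible_pair m n B L \<longleftrightarrow> B \<in> carrier_mat m n \<and> L \<in> carrier_mat m m \<and>
     transpose_mat L = - L \<and>
     (\<exists>s. (\<forall>i<n. s i > 0) \<and>
        transpose_mat B * L = mat n m (\<lambda>(i, j). if i = j then s i else 0))"

section \<open>Good elements and their invariants\<close>

definition tropical_point :: "nat \<Rightarrow> nat \<Rightarrow> 'f pattern \<Rightarrow> (nat list \<Rightarrow> int vec) \<Rightarrow> bool" where
  "tropical_point m n P g \<longleftrightarrow> (\<forall>t \<in> tree_verts n. g t \<in> carrier_vec m) \<and>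
     (\<forall>k t t'. tree_edge n k t t' \<longrightarrow> g t' $ k = - (g t $ k) \<and>
        (\<forall>i<m. i \<noteq> k \<longrightarrow> g t' $ i =
           g t $ i + [- bm P t $$ (i, k)]\<^sub>+ * g t $ k + bm P t $$ (i, k) * [g t $ k]\<^sub>+))"

definition pointed ::
    "nat \<Rightarrow> nat \<Rightarrow> 'f::field pattern \<Rightarrow> nat list \<Rightarrow> 'f \<Rightarrow> int vec \<Rightarrow> bool" where
  "pointed m n P t u g \<longleftrightarrow> g \<in> carrier_vec m \<and>
     (\<exists>F :: (nat \<Rightarrow>\<^sub>0 nat) \<Rightarrow>\<^sub>0 int. mpoly_in n F \<and> Poly_Mapping.lookup F 0 = 1 \<and>
        u = (\<Prod>j<m. xv P t $ j powi (g $ j)) * mpoly_eval of_int (yhat m P t) F)"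

definition gvec :: "nat \<Rightarrow> nat \<Rightarrow> 'f::field pattern \<Rightarrow> 'f \<Rightarrow> nat list \<Rightarrow> int vec" where
  "gvec m n P u t = (THE g. pointed m n P t u g)"

definition good :: "nat \<Rightarrow> nat \<Rightarrow> 'f::field pattern \<Rightarrow> 'f \<Rightarrow> bool" where
  "good m n P u \<longleftrightarrow> u \<in> cluster_algebra m n P \<and>
     (\<forall>t \<in> tree_verts n. \<exists>g. pointed m n P t u g) \<and>
     tropical_point m n P (gvec m n P u) \<and>
     (\<forall>t \<in> tree_verts n.
        u \<in> nat_alg ({xv P t $ i | i. i < m} \<union> {inverse (xv P t $ i) | i. i < m}))"

text \<open>Semifield homomorphisms into the integers with multiplication \<open>+\<close> and addition \<open>max\<close>.\<close>

definition semifield_hom :: "'f::field set \<Rightarrow> ('f \<Rightarrow> int) \<Rightarrow> bool" where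
  "semifield_hom Q \<beta> \<longleftrightarrow>
     (\<forall>a \<in> Q. \<forall>b \<in> Q. \<beta> (a * b) = \<beta> a + \<beta> b \<and> \<beta> (a + b) = max (\<beta> a) (\<beta> b))"

text \<open>
  \<open>L\<close> is the family of matrices of the compatible pairs. The homomorphism is unique on the
  subtraction-free elements (in particular on good elements); its values elsewhere are arbitrary.
\<close>

definition trop_hom ::
    "nat \<Rightarrow> nat \<Rightarrow> 'f::field pattern \<Rightarrow> (nat list \<Rightarrow> int mat) \<Rightarrow> 'f \<Rightarrow> 'f \<Rightarrow> int" where
  "trop_hom m n P L u = (SOME \<beta>.
     semifield_hom (subtraction_free {xv P [] $ i | i. i < m}) \<beta> \<and>
     (\<forall>t \<in> tree_verts n. \<forall>i<m. \<beta> (xv P t $ i) = (L t *\<^sub>v gvec m n P u t) $ i))"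

definition trop_pairing ::
    "nat \<Rightarrow> nat \<Rightarrow> 'f::field pattern \<Rightarrow> (nat list \<Rightarrow> int mat) \<Rightarrow> 'f \<Rightarrow> 'f \<Rightarrow> int" where
  "trop_pairing m n P L u u' = trop_hom m n P L u' u"

definition F_pairing ::
    "nat \<Rightarrow> nat \<Rightarrow> 'f::field pattern \<Rightarrow> (nat list \<Rightarrow> int mat) \<Rightarrow> 'f \<Rightarrow> 'f \<Rightarrow> int" where
  "F_pairing m n P L u u' = trop_hom m n P L u' u + trop_hom m n P L u u'"

section \<open>Monoidal categorification\<close>

definition monoidal_categorification ::
    "nat \<Rightarrow> nat \<Rightarrow> 'f::field_char_0 pattern \<Rightarrow> ('k, 'r) ring_scheme \<Rightarrow>
     ('o, 'a, 'k, 'z) mon_cat_scheme \<Rightarrow> (('o \<Rightarrow>\<^sub>0 int) set \<Rightarrow> 'f) \<Rightarrow> bool" where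
  "monoidal_categorification m n P K C \<phi> \<longleftrightarrow>
     monoidal_abelian_mcat K C \<and> (\<forall>X \<in> Obj C. finite_length C X) \<and>
     ring (K0 C) \<and> \<phi> \<in> ring_iso (K0 C) (cluster_ring m n P) \<and>
     (\<forall>z. cluster_monomial m n P z \<longrightarrow> (\<exists>M. simple_obj C M \<and> \<phi> (K0_class C M) = z))"

definition reachable ::
    "nat \<Rightarrow> nat \<Rightarrow> 'f::field pattern \<Rightarrow> ('o, 'a, 'k, 'z) mon_cat_scheme \<Rightarrow>
     (('o \<Rightarrow>\<^sub>0 int) set \<Rightarrow> 'f) \<Rightarrow> 'o \<Rightarrow> bool" where
  "reachable m n P C \<phi> M \<longleftrightarrow> simple_obj C M \<and> cluster_monomial m n P (\<phi> (K0_class C M))"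

text \<open>The monoidal cluster; its members are determined up to isomorphism.\<close>

definition cluster_obj ::
    "'f::field pattern \<Rightarrow> ('o, 'a, 'k, 'z) mon_cat_scheme \<Rightarrow> (('o \<Rightarrow>\<^sub>0 int) set \<Rightarrow> 'f) \<Rightarrow>
     nat list \<Rightarrow> nat \<Rightarrow> 'o" where
  "cluster_obj P C \<phi> t i = (SOME M. simple_obj C M \<and> \<phi> (K0_class C M) = xv P t $ i)"

definition Lambda_mat ::
    "nat \<Rightarrow> 'f::field pattern \<Rightarrow> ('o, 'a, 'k, 'z) mon_cat_scheme \<Rightarrow>
     (('o \<Rightarrow>\<^sub>0 int) set \<Rightarrow> 'f) \<Rightarrow> ('o \<Rightarrow> 'o \<Rightarrow> int) \<Rightarrow> nat list \<Rightarrow> int mat" where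
  "Lambda_mat m P C \<phi> \<Lambda> t =
     mat m m (\<lambda>(i, j). \<Lambda> (cluster_obj P C \<phi> t i) (cluster_obj P C \<phi> t j))"

definition dinv :: "('o \<Rightarrow> 'o \<Rightarrow> int) \<Rightarrow> 'o \<Rightarrow> 'o \<Rightarrow> rat" where
  "dinv \<Lambda> M N = 1/2 * (of_int (\<Lambda> M N) + of_int (\<Lambda> N M))"

definition Lambda_structure ::
    "('o, 'a, 'k, 'z) mon_cat_scheme \<Rightarrow> 'o set \<Rightarrow> ('o \<Rightarrow> 'o \<Rightarrow> int) \<Rightarrow> bool" where
  "Lambda_structure C \<Omega> \<Lambda> \<longleftrightarrow>
     (\<forall>M \<in> \<Omega>. M \<in> Obj C \<and> \<not> is_zero_obj C M) \<and>
     (\<forall>M. simple_obj C M \<longrightarrow> M \<in> \<Omega>) \<and>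
     (\<forall>M \<in> \<Omega>. \<forall>N. iso_objs C M N \<longrightarrow> N \<in> \<Omega>) \<and>
     (\<forall>M \<in> \<Omega>. \<forall>N \<in> \<Omega>. M \<boxtimes>\<^bsub>C\<^esub> N \<in> \<Omega>) \<and>
     (\<forall>M \<in> \<Omega>. \<forall>M'. subquotient C M' M \<and> \<not> is_zero_obj C M' \<longrightarrow> M' \<in> \<Omega>) \<and>
     (\<forall>M \<in> \<Omega>. \<forall>N \<in> \<Omega>. \<forall>M' \<in> \<Omega>. \<forall>N' \<in> \<Omega>.
        iso_objs C M M' \<and> iso_objs C N N' \<longrightarrow> \<Lambda> M N = \<Lambda> M' N') \<and>
     (\<forall>M N. real_simple C M \<and> real_simple C N \<and> strongly_commute C M N \<longrightarrow> dinv \<Lambda> M N = 0) \<and>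
     (\<forall>M \<in> \<Omega>. \<forall>N \<in> \<Omega>. \<forall>L. simple_obj C L \<longrightarrow>
        \<Lambda> (M \<boxtimes>\<^bsub>C\<^esub> N) L = \<Lambda> M L + \<Lambda> N L \<and> \<Lambda> L (M \<boxtimes>\<^bsub>C\<^esub> N) = \<Lambda> L M + \<Lambda> L N) \<and>
     (\<forall>M N L. simple_obj C M \<and> simple_obj C N \<and> real_simple C L \<longrightarrow>
        (strongly_commute C L N \<longrightarrow> \<Lambda> (M \<nabla>\<^bsub>C\<^esub> N) L = \<Lambda> M L + \<Lambda> N L) \<and>
        (strongly_commute C L M \<longrightarrow> \<Lambda> L (M \<nabla>\<^bsub>C\<^esub> N) = \<Lambda> L M + \<Lambda> L N)) \<and>
     (\<forall>M \<in> \<Omega>. \<forall>N \<in> \<Omega>. \<forall>M' N'.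
        subquotient C M' M \<and> \<not> is_zero_obj C M' \<and> subquotient C N' N \<and> \<not> is_zero_obj C N' \<longrightarrow>
        \<Lambda> M' N' \<le> \<Lambda> M N)"

definition Lambda_monoidal_categorification ::
    "nat \<Rightarrow> nat \<Rightarrow> 'f::field_char_0 pattern \<Rightarrow> ('k, 'r) ring_scheme \<Rightarrow>
     ('o, 'a, 'k, 'z) mon_cat_scheme \<Rightarrow> (('o \<Rightarrow>\<^sub>0 int) set \<Rightarrow> 'f) \<Rightarrow>
     'o set \<Rightarrow> ('o \<Rightarrow> 'o \<Rightarrow> int) \<Rightarrow> bool" where
  "Lambda_monoidal_categorification m n P K C \<phi> \<Omega> \<Lambda> \<longleftrightarrow>
     monoidal_categorification m n P K C \<phi> \<and> Lambda_structure C \<Omega> \<Lambda> \<and>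
     (\<forall>M N. simple_obj C M \<and> simple_obj C N \<and> (real_simple C M \<or> real_simple C N) \<longrightarrow>
        simple_obj C (M \<nabla>\<^bsub>C\<^esub> N)) \<and>
     (\<exists>w \<in> tree_verts n. compatible_pair m n (bm P w) (Lambda_mat m P C \<phi> \<Lambda> w))"

end

theory Submission
  imports Defs
begin

text \<open>
  Let \<open>u = \<phi>(M)\<close> be good, and let \<open>N\<close> correspond to the cluster monomial \<open>x\<^sup>a\<close> at the vertex \<open>t\<close>.
  Clearing denominators, \<open>x\<^sup>d u\<close> is a linear combination of ordinary monomials \<open>x\<^sup>e\<close> with
  \<open>e = d + g + B v\<close>. By the Jordan-Hoelder theorem the simple classes are linearly independent in
      the
  Grothendieck group, so the coefficients are multiplicities, hence positive, and the cluster
  objects with classes \<open>x\<^sup>e\<close> are exactly the composition factors of \<open>D \<otimes> M\<close>, where \<open>D\<close> is the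
  simple object with class \<open>x\<^sup>d\<close>. Monotonicity of \<open>\<Lambda>\<close> on subquotients bounds \<open>\<Lambda>(M, N)\<close> from below
    by the
  maximum of the values at the factors, and the simple heads of \<open>M \<otimes> D\<close> and \<open>D \<otimes> M\<close>, on which
  \<open>\<Lambda>(-, N)\<close> and \<open>\<Lambda>(N, -)\<close> are additive, attain the maximum. That maximum is the tropical evaluation
  of \<open>u\<close>. In the other order, compatibility turns \<open>\<Lambda>(N, -)\<close> of the factor \<open>v\<close> into a constant
      minus a
  nonnegative combination of the entries of \<open>v\<close>, so the maximum is attained at the constant term of
  the F-polynomial.
\<close>

section \<open>Abelian categories\<close>

text \<open>\<open>gvec\<close>, \<open>trop_hom\<close> and \<open>head_tensor\<close> are given by
  choice operators, so each needs a theorem before it can be computed with. Pointed expansions are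
  unique because compatibility makes the exchange matrix injective on exponent vectors; the tropical
  homomorphism exists because \<open>\<Lambda>_t g_t\<close> mutates like tropical cluster
  variables; heads exist by maximality of length. Compatibility is given at one vertex only. It
  spreads along edges because the exchange relation is itself a two-term expansion with denominator
  \<open>x_k\<close>, so the estimate behind the theorem also computes the mutated matrix. No
  exactness of the tensor product is at hand: the step from an identity of monomials to the
  composition factors of \<open>D \<boxtimes> M\<close> goes through classes in the Grothendieck
  ring alone. Commutativity of the ambient field gives \<open>M \<boxtimes> D\<close> the same
  factors. Both orders occur, since additivity of \<open>\<Lambda>(-, N)\<close> on a head requires
  \<open>N\<close> to commute strongly with the right factor, and that of
  \<open>\<Lambda>(N, -)\<close> with the left one.\<close>

context mcat begin

lemma HomD:
  assumes "f \<in> Hom C X Y"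
  shows "f \<in> Arr C" "Dom C f = X" "Cod C f = Y" "X \<in> Obj C" "Y \<in> Obj C"
  using assms Dom_in Cod_in unfolding Hom_def by auto

lemma HomI: "f \<in> Arr C \<Longrightarrow> f \<in> Hom C (Dom C f) (Cod C f)"
  by (simp add: Hom_def)

lemma is_isoI:
  assumes "f \<in> Hom C X Y" "g \<in> Hom C Y X" "g \<cdot> f = idt C X" "f \<cdot> g = idt C Y"
  shows "is_iso C f"
  using assms HomD[OF assms(1)] unfolding is_iso_def by auto

lemma is_isoE:
  assumes "is_iso C f" "f \<in> Hom C X Y"
  obtains g where "g \<in> Hom C Y X" "g \<cdot> f = idt C X" "f \<cdot> g = idt C Y"
  using assms HomD[OF assms(2)] unfolding is_iso_def by auto

lemma iso_objsI:
  assumes "f \<in> Hom C X Y" "g \<in> Hom C Y X" "g \<cdot> f = idt C X" "f \<cdot> g = idt C Y"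
  shows "iso_objs C X Y"
  using is_isoI[OF assms] assms HomD unfolding iso_objs_def by blast

lemma iso_objsE:
  assumes "iso_objs C X Y"
  obtains f g where "f \<in> Hom C X Y" "g \<in> Hom C Y X" "g \<cdot> f = idt C X" "f \<cdot> g = idt C Y"
  using assms is_isoE unfolding iso_objs_def by metis

lemma iso_objs_refl: "X \<in> Obj C \<Longrightarrow> iso_objs C X X"
  by (rule iso_objsI[of "idt C X" _ _ "idt C X"]) (auto intro: idt_in cmp_idt)

lemma iso_objs_sym: "iso_objs C X Y \<Longrightarrow> iso_objs C Y X"
  by (elim iso_objsE) (rule iso_objsI)

text \<open>The one computation behind inverses of composites and behind the transport of exact
  sequences along an isomorphism.\<close>

lemma cmp_cancel_mid:
  assumes "f \<in> Hom C X Y" "u \<in> Hom C Y Z" "v \<in> Hom C Z Y" "g \<in> Hom C Y W" "v \<cdot> u = idt C Y"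
  shows "(g \<cdot> v) \<cdot> (u \<cdot> f) = g \<cdot> f"
proof -
  have "(g \<cdot> v) \<cdot> (u \<cdot> f) = g \<cdot> (v \<cdot> (u \<cdot> f))"
    using assms cmp_in cmp_assoc by metis
  also have "v \<cdot> (u \<cdot> f) = (v \<cdot> u) \<cdot> f" using assms cmp_assoc by metis
  also have "\<dots> = f" using assms idt_cmp by metis
  finally show ?thesis .
qed

lemma iso_objs_trans:
  assumes "iso_objs C X Y" "iso_objs C Y Z" shows "iso_objs C X Z"
proof -
  obtain f g where f: "f \<in> Hom C X Y" "g \<in> Hom C Y X" "g \<cdot> f = idt C X" "f \<cdot> g = idt C Y"
    using assms iso_objsE by blast
  obtain u v where u: "u \<in> Hom C Y Z" "v \<in> Hom C Z Y" "v \<cdot> u = idt C Y" "u \<cdot> v = idt C Z"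
    using assms iso_objsE by blast
  show ?thesis
    by (rule iso_objsI[of "u \<cdot> f" _ _ "g \<cdot> v"])
      (use f u cmp_in cmp_cancel_mid[OF f(1) u(1,2) f(2) u(3)]
        cmp_cancel_mid[OF u(2) f(2,1) u(1) f(4)] in auto)
qed

lemma is_monoD:
  assumes "is_mono C f" "f \<in> Hom C X Y" "g \<in> Hom C W X" "h \<in> Hom C W X" "f \<cdot> g = f \<cdot> h"
  shows "g = h"
  using assms HomD[OF assms(2)] HomD[OF assms(3)] unfolding is_mono_def by metis

lemma is_epiD:
  assumes "is_epi C f" "f \<in> Hom C X Y" "g \<in> Hom C Y W" "h \<in> Hom C Y W" "g \<cdot> f = h \<cdot> f"
  shows "g = h"
  using assms HomD[OF assms(2)] HomD[OF assms(3)] unfolding is_epi_def by metis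

lemma is_mono_cmp:
  assumes "is_mono C f" "f \<in> Hom C X Y" "is_mono C g" "g \<in> Hom C Y Z"
  shows "is_mono C (g \<cdot> f)"
proof -
  have gf: "g \<cdot> f \<in> Hom C X Z" using assms cmp_in by blast
  have "a = b" if ab: "a \<in> Hom C W X" "b \<in> Hom C W X" and eq: "(g \<cdot> f) \<cdot> a = (g \<cdot> f) \<cdot> b" for W a b
  proof -
    have "g \<cdot> (f \<cdot> a) = g \<cdot> (f \<cdot> b)" using eq cmp_assoc[OF _ assms(2,4)] ab by metis
    then have "f \<cdot> a = f \<cdot> b" using is_monoD[OF assms(3,4)] cmp_in ab assms(2) by metis
    then show ?thesis using is_monoD[OF assms(1,2)] ab by metis
  qed
  then show ?thesis using HomD[OF gf] unfolding is_mono_def by metis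
qed

lemma is_epi_cmp:
  assumes "is_epi C f" "f \<in> Hom C X Y" "is_epi C g" "g \<in> Hom C Y Z"
  shows "is_epi C (g \<cdot> f)"
proof -
  have gf: "g \<cdot> f \<in> Hom C X Z" using assms cmp_in by blast
  have "a = b" if ab: "a \<in> Hom C Z W" "b \<in> Hom C Z W" and eq: "a \<cdot> (g \<cdot> f) = b \<cdot> (g \<cdot> f)" for W a b
  proof -
    have "(a \<cdot> g) \<cdot> f = (b \<cdot> g) \<cdot> f" using eq cmp_assoc[OF assms(2,4)] ab by metis
    then have "a \<cdot> g = b \<cdot> g" using is_epiD[OF assms(1,2)] cmp_in ab assms(4) by metis
    then show ?thesis using is_epiD[OF assms(3,4)] ab by metis
  qed
  then show ?thesis using HomD[OF gf] unfolding is_epi_def by metis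
qed

lemma section_imp_mono:
  assumes "f \<in> Hom C X Y" "g \<in> Hom C Y X" "g \<cdot> f = idt C X" shows "is_mono C f"
proof -
  have "a = b" if ab: "a \<in> Hom C W X" "b \<in> Hom C W X" and eq: "f \<cdot> a = f \<cdot> b" for W a b
    using arg_cong[OF eq, of
        "\<lambda>h. g \<cdot> h"] cmp_assoc[OF ab(1) assms(1,2)] cmp_assoc[OF ab(2) assms(1,2)]
      idt_cmp[OF ab(1)] idt_cmp[OF ab(2)] assms(3) by simp
  then show ?thesis using HomD[OF assms(1)] unfolding is_mono_def by metis
qed

lemma retraction_imp_epi:
  assumes "f \<in> Hom C X Y" "g \<in> Hom C Y X" "f \<cdot> g = idt C Y" shows "is_epi C f"
proof -
  have "a = b" if ab: "a \<in> Hom C Y W" "b \<in> Hom C Y W" and eq: "a \<cdot> f = b \<cdot> f" for W a b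
    using arg_cong[OF eq, of
        "\<lambda>h. h \<cdot> g"] cmp_assoc[OF assms(2,1) ab(1)] cmp_assoc[OF assms(2,1) ab(2)]
      cmp_idt[OF ab(1)] cmp_idt[OF ab(2)] assms(3) by simp
  then show ?thesis using HomD[OF assms(1)] unfolding is_epi_def by metis
qed

lemma is_iso_epi: "is_iso C f \<Longrightarrow> is_epi C f"
  using is_isoE retraction_imp_epi HomI unfolding is_iso_def by metis

lemma kernel_Arr: "is_kernel C k f \<Longrightarrow> f \<in> Arr C"
  and cokernel_Arr: "is_cokernel C c f \<Longrightarrow> f \<in> Arr C"
  unfolding is_kernel_def is_cokernel_def by (elim conjE, assumption)+

lemma kernelD:
  assumes "is_kernel C k f" "f \<in> Hom C X Y"
  shows "k \<in> Hom C (Dom C k) X" "f \<cdot> k = hzero C (Dom C k) Y"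
  using assms HomD[OF assms(2)] unfolding is_kernel_def Hom_def by auto

lemma kernel_ex1:
  assumes "is_kernel C k f" "f \<in> Hom C X Y" "h \<in> Hom C W X" "f \<cdot> h = hzero C W Y"
  shows "\<exists>!h'. h' \<in> Hom C W (Dom C k) \<and> k \<cdot> h' = h"
  using assms(1)[unfolded is_kernel_def HomD(2,3)[OF assms(2)]] HomD(4)[OF assms(3)] assms(3,4)
  by (elim conjE) (drule (1) bspec, drule (1) bspec, erule (1) mp)

lemma kernel_factor:
  assumes "is_kernel C k f" "f \<in> Hom C X Y" "h \<in> Hom C W X" "f \<cdot> h = hzero C W Y"
  obtains h' where "h' \<in> Hom C W (Dom C k)" "k \<cdot> h' = h"
  using kernel_ex1[OF assms] by (elim ex1E conjE)

lemma cokernelD: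
  assumes "is_cokernel C c f" "f \<in> Hom C X Y"
  shows "c \<in> Hom C Y (Cod C c)" "c \<cdot> f = hzero C X (Cod C c)"
  using assms HomD[OF assms(2)] unfolding is_cokernel_def Hom_def by auto

lemma cokernel_ex1:
  assumes "is_cokernel C c f" "f \<in> Hom C X Y" "h \<in> Hom C Y W" "h \<cdot> f = hzero C X W"
  shows "\<exists>!h'. h' \<in> Hom C (Cod C c) W \<and> h' \<cdot> c = h"
  using assms(1)[unfolded is_cokernel_def HomD(2,3)[OF assms(2)]] HomD(5)[OF assms(3)] assms(3,4)
  by (elim conjE) (drule (1) bspec, drule (1) bspec, erule (1) mp)

lemma cokernel_factor:
  assumes "is_cokernel C c f" "f \<in> Hom C X Y" "h \<in> Hom C Y W" "h \<cdot> f = hzero C X W"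
  obtains h' where "h' \<in> Hom C (Cod C c) W" "h' \<cdot> c = h"
  using cokernel_ex1[OF assms] by (elim ex1E conjE)

lemma short_exactD:
  assumes "short_exact C f g"
  shows "is_kernel C f g" "is_cokernel C g f"
    "f \<in> Hom C (Dom C f) (Cod C f)" "g \<in> Hom C (Cod C f) (Cod C g)"
    "g \<cdot> f = hzero C (Dom C f) (Cod C g)"
proof -
  show k: "is_kernel C f g" and c: "is_cokernel C g f"
    using assms by (simp_all add: short_exact_def)
  have 0: "f \<in> Arr C \<and> g \<in> Arr C \<and> Cod C f = Dom C g \<and> g \<cdot> f = hzero C (Dom C f) (Cod C g)"
    using k[unfolded is_kernel_def] by (elim conjE) (intro conjI)
  then show "f \<in> Hom C (Dom C f) (Cod C f)" "g \<in> Hom C (Cod C f) (Cod C g)"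
    by (simp_all add: Hom_def)
  show "g \<cdot> f = hzero C (Dom C f) (Cod C g)" using 0 by (elim conjE)
qed

end

section \<open>Additive structure: zero arrows, tests for monomorphisms and epimorphisms,
  kernels\<close>

context linear_mcat begin

lemma hom_abelian_group: "\<lbrakk>X \<in> Obj C; Y \<in> Obj C\<rbrakk> \<Longrightarrow> abelian_group (hom_module C X Y)"
  using hom_mod by (simp add: Module.module_def)

lemma hzero_in: "\<lbrakk>X \<in> Obj C; Y \<in> Obj C\<rbrakk> \<Longrightarrow> hzero C X Y \<in> Hom C X Y"
  using abelian_monoid.zero_closed[OF abelian_group.axioms(1)[OF hom_abelian_group]]
  by (fastforce simp: hom_module_def)

lemma hadd_in:
  assumes "f \<in> Hom C X Y" "g \<in> Hom C X Y" shows "f +\<^sub>h g \<in> Hom C X Y"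
  using assms HomD[OF assms(1)]
    abelian_monoid.a_closed[OF abelian_group.axioms(1)[OF hom_abelian_group], of X Y f g]
  by (simp add: hom_module_def)

lemma hadd_zero_right:
  assumes "f \<in> Hom C X Y" shows "f +\<^sub>h hzero C X Y = f"
  using assms HomD[OF assms(1)]
    abelian_monoid.r_zero[OF abelian_group.axioms(1)[OF hom_abelian_group], of X Y f]
  by (simp add: hom_module_def)

lemma hadd_zero_left:
  assumes "f \<in> Hom C X Y" shows "hzero C X Y +\<^sub>h f = f"
  using assms HomD[OF assms(1)]
    abelian_monoid.l_zero[OF abelian_group.axioms(1)[OF hom_abelian_group], of X Y f]
  by (simp add: hom_module_def)

lemma hadd_cancel_right:
  assumes "f \<in> Hom C X Y" "g \<in> Hom C X Y" "h \<in> Hom C X Y" "f +\<^sub>h h = g +\<^sub>h h" shows "f = g"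
  using assms HomD[OF assms(1)]
    group.right_cancel[OF abelian_group.a_group[OF hom_abelian_group], of X Y h f g]
  by (simp add: hom_module_def)

text \<open>The category record has addition of arrows but no negation; \<open>d\<close> plays the
  part of the difference \<open>f - g\<close>, supplied by the module structure on the Hom
  set.\<close>

lemma hadd_solve:
  assumes "f \<in> Hom C X Y" "g \<in> Hom C X Y"
  obtains d where "d \<in> Hom C X Y" "d +\<^sub>h g = f"
proof -
  interpret abelian_group "hom_module C X Y" using hom_abelian_group HomD[OF assms(1)] by blast
  have "f \<in> carrier (hom_module C X Y)" "g \<in> carrier (hom_module C X Y)"
    using assms by (auto simp: hom_module_def)
  then have "(f \<ominus>\<^bsub>hom_module C X Y\<^esub> g) \<oplus>\<^bsub>hom_module C X Y\<^esub> g = f"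
    "f \<ominus>\<^bsub>hom_module C X Y\<^esub> g \<in> carrier (hom_module C X Y)"
    by (auto simp: a_minus_def a_assoc l_neg)
  then show ?thesis using that by (simp add: hom_module_def)
qed

text \<open>By bilinearity the composite equals its own double, so it can be cancelled to
  zero.\<close>

lemma zero_cmp:
  assumes f: "f \<in> Hom C X Y" and Z: "Z \<in> Obj C"
  shows "hzero C Y Z \<cdot> f = hzero C X Z"
proof -
  have z: "hzero C Y Z \<in> Hom C Y Z" using hzero_in HomD[OF f] Z by blast
  have zf: "hzero C Y Z \<cdot> f \<in> Hom C X Z" using f z cmp_in by blast
  have "hzero C Y Z \<cdot> f +\<^sub>h hzero C Y Z \<cdot> f = hzero C Y Z \<cdot> f"
    using cmp_add_left[OF f z z] hadd_zero_left[OF z] by simp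
  also have "\<dots> = hzero C X Z +\<^sub>h hzero C Y Z \<cdot> f" using hadd_zero_left[OF zf] by simp
  finally show ?thesis using hadd_cancel_right zf hzero_in HomD[OF zf] by blast
qed

lemma cmp_zero:
  assumes f: "f \<in> Hom C X Y" and W: "W \<in> Obj C"
  shows "f \<cdot> hzero C W X = hzero C W Y"
proof -
  have z: "hzero C W X \<in> Hom C W X" using hzero_in HomD[OF f] W by blast
  have fz: "f \<cdot> hzero C W X \<in> Hom C W Y" using f z cmp_in by blast
  have "f \<cdot> hzero C W X +\<^sub>h f \<cdot> hzero C W X = f \<cdot> hzero C W X"
    using cmp_add_right[OF z z f] hadd_zero_left[OF z] by simp
  also have "\<dots> = hzero C W Y +\<^sub>h f \<cdot> hzero C W X" using hadd_zero_left[OF fz] by simp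
  finally show ?thesis using hadd_cancel_right fz hzero_in HomD[OF fz] by blast
qed

text \<open>If \<open>f\<close> identifies \<open>a\<close> and \<open>b\<close>, it kills their
  difference, so testing against zero suffices.\<close>

lemma monoI:
  assumes f: "f \<in> Hom C X Y"
    and 0: "\<And>W g. \<lbrakk>g \<in> Hom C W X; f \<cdot> g = hzero C W Y\<rbrakk> \<Longrightarrow> g = hzero C W X"
  shows "is_mono C f"
proof -
  have "a = b" if ab: "a \<in> Hom C W X" "b \<in> Hom C W X" "f \<cdot> a = f \<cdot> b" for W a b
  proof -
    obtain d where d: "d \<in> Hom C W X" "d +\<^sub>h b = a" using hadd_solve ab by blast
    have fd: "f \<cdot> d \<in> Hom C W Y" "f \<cdot> b \<in> Hom C W Y" using d f ab cmp_in by blast+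
    have "f \<cdot> d +\<^sub>h f \<cdot> b = f \<cdot> a" using cmp_add_right[OF d(1) ab(2) f] d(2) by simp
    also have "\<dots> = hzero C W Y +\<^sub>h f \<cdot> b" using hadd_zero_left[OF fd(2)] ab(3) by simp
    finally have "f \<cdot> d = hzero C W Y" using hadd_cancel_right fd hzero_in HomD[OF fd(1)] by blast
    then have "d = hzero C W X" using 0 d by blast
    then show ?thesis using d hadd_zero_left[OF ab(2)] by simp
  qed
  then show ?thesis using HomD[OF f] unfolding is_mono_def by metis
qed

lemma epiI:
  assumes f: "f \<in> Hom C X Y"
    and 0: "\<And>W g. \<lbrakk>g \<in> Hom C Y W; g \<cdot> f = hzero C X W\<rbrakk> \<Longrightarrow> g = hzero C Y W"
  shows "is_epi C f"
proof -
  have "a = b" if ab: "a \<in> Hom C Y W" "b \<in> Hom C Y W" "a \<cdot> f = b \<cdot> f" for W a b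
  proof -
    obtain d where d: "d \<in> Hom C Y W" "d +\<^sub>h b = a" using hadd_solve ab by blast
    have fd: "d \<cdot> f \<in> Hom C X W" "b \<cdot> f \<in> Hom C X W" using d f ab cmp_in by blast+
    have "d \<cdot> f +\<^sub>h b \<cdot> f = a \<cdot> f" using cmp_add_left[OF f d(1) ab(2)] d(2) by simp
    also have "\<dots> = hzero C X W +\<^sub>h b \<cdot> f" using hadd_zero_left[OF fd(2)] ab(3) by simp
    finally have "d \<cdot> f = hzero C X W" using hadd_cancel_right fd hzero_in HomD[OF fd(1)] by blast
    then have "d = hzero C Y W" using 0 d by blast
    then show ?thesis using d hadd_zero_left[OF ab(2)] by simp
  qed
  then show ?thesis using HomD[OF f] unfolding is_epi_def by metis
qed

lemma monoD0:
  assumes "is_mono C f" "f \<in> Hom C X Y" "g \<in> Hom C W X" "f \<cdot> g = hzero C W Y"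
  shows "g = hzero C W X"
  using is_monoD[OF assms(1,2,3)] cmp_zero[OF assms(2)] hzero_in HomD[OF assms(3)] assms(4) by metis

lemma epiD0:
  assumes "is_epi C f" "f \<in> Hom C X Y" "g \<in> Hom C Y W" "g \<cdot> f = hzero C X W"
  shows "g = hzero C Y W"
  using is_epiD[OF assms(1,2,3)] zero_cmp[OF assms(2)] hzero_in HomD[OF assms(3)] assms(4) by metis

lemma kernel_mono:
  assumes "is_kernel C k f" shows "is_mono C k"
proof -
  have f: "f \<in> Hom C (Dom C f) (Cod C f)" using HomI[OF kernel_Arr[OF assms]] .
  have kk: "k \<in> Hom C (Dom C k) (Dom C f)" using kernelD[OF assms f] by blast
  show ?thesis
  proof (rule monoI[OF kk])
    fix W g assume g: "g \<in> Hom C W (Dom C k)" "k \<cdot> g = hzero C W (Dom C f)"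
    note z = hzero_in[OF HomD(4)[OF g(1)] HomD(4)[OF kk]]
    have "k \<cdot> hzero C W (Dom C k) = hzero C W (Dom C f)" using cmp_zero[OF kk] HomD[OF g(1)]
      by blast
    moreover have "\<exists>!h'. h' \<in> Hom C W (Dom C k) \<and> k \<cdot> h' = hzero C W (Dom C f)"
      using kernel_ex1[OF assms f hzero_in] cmp_zero[OF f] HomD(4)[OF g(1)] HomD(4)[OF f] by blast
    ultimately show "g = hzero C W (Dom C k)" using g z by blast
  qed
qed

lemma cokernel_epi:
  assumes "is_cokernel C c f" shows "is_epi C c"
proof -
  have f: "f \<in> Hom C (Dom C f) (Cod C f)" using HomI[OF cokernel_Arr[OF assms]] .
  have cc: "c \<in> Hom C (Cod C f) (Cod C c)" using cokernelD[OF assms f] by blast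
  show ?thesis
  proof (rule epiI[OF cc])
    fix W g assume g: "g \<in> Hom C (Cod C c) W" "g \<cdot> c = hzero C (Cod C f) W"
    note z = hzero_in[OF HomD(5)[OF cc] HomD(5)[OF g(1)]]
    have "hzero C (Cod C c) W \<cdot> c = hzero C (Cod C f) W" using zero_cmp[OF cc] HomD[OF g(1)]
      by blast
    moreover have "\<exists>!h'. h' \<in> Hom C (Cod C c) W \<and> h' \<cdot> c = hzero C (Cod C f) W"
      using cokernel_ex1[OF assms f hzero_in] zero_cmp[OF f] HomD(5)[OF g(1)] HomD(5)[OF f] by blast
    ultimately show "g = hzero C (Cod C c) W" using g z by blast
  qed
qed

text \<open>For a monomorphism \<open>k\<close> uniqueness of factorizations is automatic; only
  their existence remains to be checked.\<close>

lemma kernelI: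
  assumes f: "f \<in> Hom C X Y" and k: "k \<in> Hom C K' X" and m: "is_mono C k"
      and 0: "f \<cdot> k = hzero C K' Y"
    and fac: "\<And>W h. \<lbrakk>h \<in> Hom C W X; f \<cdot> h = hzero C W Y\<rbrakk> \<Longrightarrow> \<exists>h' \<in> Hom C W K'. k \<cdot> h' = h"
  shows "is_kernel C k f"
proof -
  have "\<exists>!h'. h' \<in> Hom C W K' \<and> k \<cdot> h' = h" if h: "h \<in> Hom C W X" "f \<cdot> h = hzero C W Y" for W h
  proof -
    obtain h' where h': "h' \<in> Hom C W K'" "k \<cdot> h' = h" using fac[OF h] by blast
    show ?thesis
    proof (rule ex1I[of _ h'])
      fix h'' assume "h'' \<in> Hom C W K' \<and> k \<cdot> h'' = h"
      then show "h'' = h'" using is_monoD[OF m k _ h'(1)] h'(2) by simp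
    qed (use h' in simp)
  qed
  then show ?thesis unfolding is_kernel_def HomD(2,3)[OF f] HomD(2,3)[OF k]
    using HomD(1)[OF f] HomD(1)[OF k] 0 by simp
qed

lemma cokernelI:
  assumes f: "f \<in> Hom C X Y" and c: "c \<in> Hom C Y Q" and m: "is_epi C c" and 0: "c \<cdot> f = hzero C X Q"
    and fac: "\<And>W h. \<lbrakk>h \<in> Hom C Y W; h \<cdot> f = hzero C X W\<rbrakk> \<Longrightarrow> \<exists>h' \<in> Hom C Q W. h' \<cdot> c = h"
  shows "is_cokernel C c f"
proof -
  have "\<exists>!h'. h' \<in> Hom C Q W \<and> h' \<cdot> c = h" if h: "h \<in> Hom C Y W" "h \<cdot> f = hzero C X W" for W h
  proof -
    obtain h' where h': "h' \<in> Hom C Q W" "h' \<cdot> c = h" using fac[OF h] by blast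
    show ?thesis
    proof (rule ex1I[of _ h'])
      fix h'' assume "h'' \<in> Hom C Q W \<and> h'' \<cdot> c = h"
      then show "h'' = h'" using is_epiD[OF m c _ h'(1)] h'(2) by simp
    qed (use h' in simp)
  qed
  then show ?thesis unfolding is_cokernel_def HomD(2,3)[OF f] HomD(2,3)[OF c]
    using HomD(1)[OF f] HomD(1)[OF c] 0 by simp
qed

lemma zero_objD:
  assumes "is_zero_obj C Z"
  shows "Z \<in> Obj C" "f \<in> Hom C X Z \<Longrightarrow> f = hzero C X Z" "f \<in> Hom C Z X \<Longrightarrow> f = hzero C Z X"
  using assms hzero_in HomD unfolding is_zero_obj_def by metis+

text \<open>Every arrow into or out of \<open>Z\<close> passes through
  \<open>idt C Z\<close>.\<close>

lemma zero_objI: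
  assumes Z: "Z \<in> Obj C" and id0: "idt C Z = hzero C Z Z" shows "is_zero_obj C Z"
proof -
  have "f = hzero C X Z" if "f \<in> Hom C X Z" for f X
    using that idt_cmp[OF that] id0 zero_cmp[OF that Z] by simp
  moreover have "f = hzero C Z X" if "f \<in> Hom C Z X" for f X
    using that cmp_idt[OF that] id0 cmp_zero[OF that Z] by simp
  ultimately show ?thesis using Z hzero_in unfolding is_zero_obj_def by metis
qed

lemma zero_obj_if_epi:
  assumes "is_epi C f" "f \<in> Hom C X Y" "f = hzero C X Y" shows "is_zero_obj C Y"
proof (rule zero_objI)
  show "Y \<in> Obj C" using HomD assms by blast
  then show "idt C Y = hzero C Y Y"
    using epiD0[OF assms(1,2) idt_in] idt_cmp assms by metis
qed

lemma zero_obj_iso: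
  assumes "iso_objs C X Y" "is_zero_obj C X" shows "is_zero_obj C Y"
proof -
  obtain f g where f: "f \<in> Hom C X Y" "g \<in> Hom C Y X" "g \<cdot> f = idt C X" "f \<cdot> g = idt C Y"
    using assms iso_objsE by blast
  have "f = hzero C X Y" using zero_objD(3)[OF assms(2)] f by blast
  moreover have "is_epi C f" using retraction_imp_epi f by blast
  ultimately show ?thesis using zero_obj_if_epi f by blast
qed

text \<open>Moves the middle term along an isomorphism while both ends stay fixed. Composition
  series and Grothendieck classes become isomorphism invariants through this.\<close>

lemma short_exact_iso:
  assumes se: "short_exact C f g" and u: "u \<in> Hom C (Cod C f) Y" "v \<in> Hom C Y (Cod C f)"
    "v \<cdot> u = idt C (Cod C f)" "u \<cdot> v = idt C Y"
  shows "short_exact C (u \<cdot> f) (g \<cdot> v)"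
    "u \<cdot> f \<in> Hom C (Dom C f) Y" "g \<cdot> v \<in> Hom C Y (Cod C g)"
proof -
  note s = short_exactD[OF se]
  show uf: "u \<cdot> f \<in> Hom C (Dom C f) Y" and gv: "g \<cdot> v \<in> Hom C Y (Cod C g)"
    using s u cmp_in by blast+
  have mu: "is_mono C u" and ev: "is_epi C v" using u section_imp_mono retraction_imp_epi by blast+
  have 0: "(g \<cdot> v) \<cdot> (u \<cdot> f) = hzero C (Dom C f) (Cod C g)"
    using cmp_cancel_mid[OF s(3) u(1,2) s(4) u(3)] s(5) by simp
  have "is_kernel C (u \<cdot> f) (g \<cdot> v)"
  proof (rule kernelI[OF gv uf _ 0])
    show "is_mono C (u \<cdot> f)" using is_mono_cmp[OF kernel_mono[OF s(1)] s(3) mu u(1)] .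
    fix W h assume h: "h \<in> Hom C W Y" "(g \<cdot> v) \<cdot> h = hzero C W (Cod C g)"
    have "g \<cdot> (v \<cdot> h) = hzero C W (Cod C g)" using cmp_assoc[OF h(1) u(2) s(4)] h by simp
    then obtain h' where h': "h' \<in> Hom C W (Dom C f)" "f \<cdot> h' = v \<cdot> h"
      using kernel_factor[OF s(1,4) cmp_in[OF h(1) u(2)]] by blast
    have "(u \<cdot> f) \<cdot> h' = u \<cdot> (v \<cdot> h)" using cmp_assoc[OF h'(1) s(3) u(1)] h' by simp
    also have "\<dots> = h" using cmp_assoc[OF h(1) u(2,1)] u(4) idt_cmp[OF h(1)] by simp
    finally show "\<exists>h'\<in>Hom C W (Dom C f). (u \<cdot> f) \<cdot> h' = h" using h' by blast
  qed
  moreover have "is_cokernel C (g \<cdot> v) (u \<cdot> f)"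
  proof (rule cokernelI[OF uf gv _ 0])
    show "is_epi C (g \<cdot> v)" using is_epi_cmp[OF ev u(2) cokernel_epi[OF s(2)] s(4)] .
    fix W h assume h: "h \<in> Hom C Y W" "h \<cdot> (u \<cdot> f) = hzero C (Dom C f) W"
    have "(h \<cdot> u) \<cdot> f = hzero C (Dom C f) W" using cmp_assoc[OF s(3) u(1) h(1)] h by simp
    then obtain h' where h': "h' \<in> Hom C (Cod C g) W" "h' \<cdot> g = h \<cdot> u"
      using cokernel_factor[OF s(2,3) cmp_in[OF u(1) h(1)]] by blast
    have "h' \<cdot> (g \<cdot> v) = (h \<cdot> u) \<cdot> v" using cmp_assoc[OF u(2) s(4) h'(1)] h' by simp
    also have "\<dots> = h" using cmp_assoc[OF u(2,1) h(1)] u(4) cmp_idt[OF h(1)] by simp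
    finally show "\<exists>h'\<in>Hom C (Cod C g) W. h' \<cdot> (g \<cdot> v) = h" using h' by blast
  qed
  ultimately show "short_exact C (u \<cdot> f) (g \<cdot> v)" by (simp add: short_exact_def)
qed

end

section \<open>Consequences of normality of monomorphisms and epimorphisms\<close>

context abelian_mcat begin

text \<open>By normality \<open>f\<close> is the kernel of some \<open>g\<close>. As
  \<open>g\<close> kills \<open>f\<close>, it factors through the cokernel \<open>c\<close>, so
  everything killed by \<open>c\<close> is killed by \<open>g\<close> and lifts through
  \<open>f\<close>.\<close>

lemma kernel_of_cokernel:
  assumes m: "is_mono C f" and f: "f \<in> Hom C X Y" and c: "is_cokernel C c f"
  shows "is_kernel C f c"
proof -
  obtain g where g: "is_kernel C f g" using mono_normal[OF m] by blast
  have "g \<in> Hom C (Dom C g) (Cod C g)" using HomI[OF kernel_Arr[OF g]] .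
  moreover have "Dom C g = Y"
    using g[unfolded is_kernel_def] HomD[OF f] by (elim conjE) simp
  ultimately have gH: "g \<in> Hom C Y (Cod C g)" by simp
  note cH = cokernelD[OF c f]
  have gf: "g \<cdot> f = hzero C X (Cod C g)" using kernelD(2)[OF g gH] HomD[OF f] by simp
  obtain g' where g': "g' \<in> Hom C (Cod C c) (Cod C g)" "g' \<cdot> c = g"
    using cokernel_factor[OF c f gH gf] .
  show ?thesis
  proof (rule kernelI[OF cH(1) f m cH(2)])
    fix W h assume h: "h \<in> Hom C W Y" "c \<cdot> h = hzero C W (Cod C c)"
    have "g \<cdot> h = g' \<cdot> (c \<cdot> h)" using cmp_assoc[OF h(1) cH(1) g'(1)] g'(2) by simp
    then have "g \<cdot> h = hzero C W (Cod C g)" using h cmp_zero[OF g'(1)] HomD[OF h(1)] by simp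
    then show "\<exists>h'\<in>Hom C W X. f \<cdot> h' = h"
      using kernel_factor[OF g gH h(1)] HomD[OF f] by metis
  qed
qed

lemma cokernel_of_kernel:
  assumes e: "is_epi C f" and f: "f \<in> Hom C X Y" and k: "is_kernel C k f"
  shows "is_cokernel C f k"
proof -
  obtain g where g: "is_cokernel C f g" using epi_normal[OF e] by blast
  have "g \<in> Hom C (Dom C g) (Cod C g)" using HomI[OF cokernel_Arr[OF g]] .
  moreover have "Cod C g = X"
    using g[unfolded is_cokernel_def] HomD[OF f] by (elim conjE) simp
  ultimately have gH: "g \<in> Hom C (Dom C g) X" by simp
  note kH = kernelD[OF k f]
  have fg: "f \<cdot> g = hzero C (Dom C g) Y" using cokernelD(2)[OF g gH] HomD[OF f] by simp
  obtain g' where g': "g' \<in> Hom C (Dom C g) (Dom C k)" "k \<cdot> g' = g"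
    using kernel_factor[OF k f gH fg] .
  show ?thesis
  proof (rule cokernelI[OF kH(1) f e kH(2)])
    fix W h assume h: "h \<in> Hom C X W" "h \<cdot> k = hzero C (Dom C k) W"
    have "h \<cdot> g = (h \<cdot> k) \<cdot> g'" using cmp_assoc[OF g'(1) kH(1) h(1)] g'(2) by simp
    then have "h \<cdot> g = hzero C (Dom C g) W" using h zero_cmp[OF g'(1)] HomD[OF h(1)] by simp
    then show "\<exists>h'\<in>Hom C Y W. h' \<cdot> f = h"
      using cokernel_factor[OF g gH h(1)] HomD[OF f] by metis
  qed
qed

lemma epi_short_exact:
  assumes e: "is_epi C f" and f: "f \<in> Hom C X Y"
  obtains k where "short_exact C k f" "k \<in> Hom C (Dom C k) X"
proof -
  obtain k where k: "is_kernel C k f" using ex_kernel HomD[OF f] by blast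
  then show ?thesis using that cokernel_of_kernel[OF e f k] kernelD[OF k f]
    by (simp add: short_exact_def)
qed

lemma short_exactH:
  assumes "short_exact C f g" "f \<in> Hom C A X" "g \<in> Hom C X Y"
  shows "is_kernel C f g" "is_cokernel C g f" "is_mono C f" "is_epi C g" "g \<cdot> f = hzero C A Y"
  using assms short_exactD[OF assms(1)] kernel_mono cokernel_epi HomD[OF assms(2)] HomD[OF assms(3)]
  by auto

text \<open>A zero quotient kills the identity of \<open>X\<close>, which therefore lifts through
  \<open>f\<close> to an inverse.\<close>

lemma short_exact_iso_left:
  assumes se: "short_exact C f g" "f \<in> Hom C A X" "g \<in> Hom C X Y" and Y: "is_zero_obj C Y"
  shows "iso_objs C A X"
proof -
  note s = short_exactH[OF se]
  have X: "idt C X \<in> Hom C X X" using HomD[OF se(2)] idt_in by blast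
  have "g \<cdot> idt C X = hzero C X Y" using zero_objD(2)[OF Y cmp_in[OF X se(3)]] .
  then obtain h where h: "h \<in> Hom C X A" "f \<cdot> h = idt C X"
    using kernel_factor[OF s(1) se(3) X] HomD[OF se(2)] by auto
  have "f \<cdot> (h \<cdot> f) = f \<cdot> idt C A"
    using cmp_assoc[OF se(2) h(1) se(2)] h(2) idt_cmp[OF se(2)] cmp_idt[OF se(2)] by simp
  then have "h \<cdot> f = idt C A"
    using is_monoD[OF s(3) se(2) cmp_in[OF se(2) h(1)] idt_in] HomD[OF se(2)] by blast
  then show ?thesis using iso_objsI[OF se(2) h(1)] h by blast
qed

lemma short_exact_iso_right:
  assumes se: "short_exact C f g" "f \<in> Hom C A X" "g \<in> Hom C X Y" and A: "is_zero_obj C A"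
  shows "iso_objs C X Y"
proof -
  note s = short_exactH[OF se]
  have X: "idt C X \<in> Hom C X X" using HomD[OF se(2)] idt_in by blast
  have "idt C X \<cdot> f = hzero C A X" using zero_objD(3)[OF A cmp_in[OF se(2) X]] .
  then obtain h where h: "h \<in> Hom C Y X" "h \<cdot> g = idt C X"
    using cokernel_factor[OF s(2) se(2) X] HomD[OF se(3)] by auto
  have "(g \<cdot> h) \<cdot> g = idt C Y \<cdot> g"
    using cmp_assoc[OF se(3) h(1) se(3)] h(2) idt_cmp[OF se(3)] cmp_idt[OF se(3)] by simp
  then have "g \<cdot> h = idt C Y"
    using is_epiD[OF s(4) se(3) cmp_in[OF h(1) se(3)] idt_in] HomD[OF se(3)] by blast
  then show ?thesis using iso_objsI[OF se(3) h(1)] h by blast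
qed

lemma short_exact_id:
  assumes X: "X \<in> Obj C" and Z: "is_zero_obj C Z"
  shows "short_exact C (hzero C Z X) (idt C X)"
proof -
  have id: "idt C X \<in> Hom C X X" using X idt_in by blast
  have z: "hzero C Z X \<in> Hom C Z X" using X hzero_in zero_objD(1)[OF Z] by blast
  have e: "is_epi C (idt C X)" using retraction_imp_epi[OF id id] cmp_idt[OF id] by blast
  have m: "is_mono C (hzero C Z X)"
    by (rule monoI[OF z]) (use zero_objD(2)[OF Z] in blast)
  have 0: "idt C X \<cdot> hzero C Z X = hzero C Z X" using idt_cmp[OF z] .
  have "is_kernel C (hzero C Z X) (idt C X)"
  proof (rule kernelI[OF id z m 0])
    fix W h assume h: "h \<in> Hom C W X" "idt C X \<cdot> h = hzero C W X"
    have "h = hzero C W X" using h idt_cmp[OF h(1)] by simp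
    moreover have "hzero C Z X \<cdot> hzero C W Z = hzero C W X"
      using cmp_zero[OF z] HomD[OF h(1)] by blast
    ultimately show "\<exists>h'\<in>Hom C W Z. hzero C Z X \<cdot> h' = h"
      using hzero_in[OF HomD(4)[OF h(1)] zero_objD(1)[OF Z]] by blast
  qed
  then show ?thesis using cokernel_of_kernel[OF e id] by (simp add: short_exact_def)
qed

subsection \<open>Simple objects and composition series\<close>

lemma simple_iso:
  assumes S: "simple_obj C X" and iso: "iso_objs C X Y" shows "simple_obj C Y"
proof -
  obtain u v where u: "u \<in> Hom C X Y" "v \<in> Hom C Y X" "v \<cdot> u = idt C X" "u \<cdot> v = idt C Y"
    using iso iso_objsE by blast
  have mv: "is_mono C v" using section_imp_mono u by blast
  have "is_zero_obj C (Dom C i) \<or> is_iso C i" if i: "is_mono C i" "Cod C i = Y" for i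
  proof -
    have iH: "i \<in> Hom C (Dom C i) Y" using i HomI unfolding is_mono_def by blast
    have vi: "v \<cdot> i \<in> Hom C (Dom C i) X" using cmp_in[OF iH u(2)] .
    have "is_mono C (v \<cdot> i)" using is_mono_cmp[OF i(1) iH mv u(2)] .
    then have "is_zero_obj C (Dom C i) \<or> is_iso C (v \<cdot> i)"
      using S HomD[OF vi] unfolding simple_obj_def by metis
    moreover have "is_iso C i" if iso: "is_iso C (v \<cdot> i)"
    proof -
      obtain w where w: "w \<in> Hom C X (Dom C i)" "w \<cdot> (v \<cdot> i) = idt C (Dom C i)"
          "(v \<cdot> i) \<cdot> w = idt C X"
        using is_isoE[OF iso vi] by blast
      have wv: "w \<cdot> v \<in> Hom C Y (Dom C i)" using cmp_in[OF u(2) w(1)] .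
      have 1: "(w \<cdot> v) \<cdot> i = idt C (Dom C i)" using cmp_assoc[OF iH u(2) w(1)] w by simp
      have "v \<cdot> (i \<cdot> (w \<cdot> v)) = (v \<cdot> i) \<cdot> (w \<cdot> v)" using cmp_assoc[OF wv iH u(2)] by simp
      also have "\<dots> = ((v \<cdot> i) \<cdot> w) \<cdot> v" using cmp_assoc[OF u(2) w(1) vi] by simp
      also have "\<dots> = v \<cdot> idt C Y" using w(3) idt_cmp[OF u(2)] cmp_idt[OF u(2)] by simp
      finally have "i \<cdot> (w \<cdot> v) = idt C Y"
        using is_monoD[OF mv u(2) cmp_in[OF wv iH] idt_in] HomD[OF u(2)] by blast
      then show ?thesis using is_isoI[OF iH wv] 1 by blast
    qed
    ultimately show ?thesis by blast
  qed
  moreover have "\<not> is_zero_obj C Y"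
    using S zero_obj_iso[OF iso_objs_sym[OF iso]] unfolding simple_obj_def by blast
  ultimately show ?thesis using HomD[OF u(1)] unfolding simple_obj_def by blast
qed

lemma simple_in_Obj: "simple_obj C S \<Longrightarrow> S \<in> Obj C"
  by (simp add: simple_obj_def)

lemma simple_mono_cases:
  assumes "simple_obj C S" "is_mono C i" "i \<in> Hom C A S"
  shows "is_zero_obj C A \<or> is_iso C i"
  using assms HomD[OF assms(3)] unfolding simple_obj_def by blast

text \<open>Half of Schur's lemma. If \<open>g\<close> kills \<open>f\<close>, then \<open>f\<close>
  passes through the kernel of \<open>g\<close>, a subobject of \<open>S\<close> that cannot be zero
  and so is all of \<open>S\<close>; hence \<open>g\<close> vanishes.\<close>

lemma simple_epi:
  assumes S: "simple_obj C S" and f: "f \<in> Hom C X S" and nz: "f \<noteq> hzero C X S"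
  shows "is_epi C f"
proof (rule epiI[OF f])
  fix W g assume g: "g \<in> Hom C S W" "g \<cdot> f = hzero C X W"
  obtain k where k: "is_kernel C k g" using ex_kernel HomD[OF g(1)] by blast
  note kH = kernelD[OF k g(1)]
  obtain f' where f': "f' \<in> Hom C X (Dom C k)" "k \<cdot> f' = f" using kernel_factor[OF k g(1) f g(2)] .
  have "\<not> is_zero_obj C (Dom C k)"
  proof
    assume "is_zero_obj C (Dom C k)"
    then have "f' = hzero C X (Dom C k)" using zero_objD(2) f' by blast
    then show False using f'(2) cmp_zero[OF kH(1)] HomD[OF f] nz by simp
  qed
  then have "is_iso C k" using simple_mono_cases[OF S kernel_mono[OF k] kH(1)] by blast
  then show "g = hzero C S W" using epiD0[OF is_iso_epi kH(1) g(1) kH(2)] by blast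
qed

text \<open>Other half of Schur's lemma: a nonzero arrow \<open>g\<close> into \<open>S\<close> is
  an epimorphism, so it cannot be killed by a nonzero \<open>f\<close>.\<close>

lemma simple_mono:
  assumes S: "simple_obj C S" and f: "f \<in> Hom C S X" and nz: "f \<noteq> hzero C S X"
  shows "is_mono C f"
proof (rule monoI[OF f])
  fix W g assume g: "g \<in> Hom C W S" "f \<cdot> g = hzero C W X"
  show "g = hzero C W S"
  proof (rule ccontr)
    assume "g \<noteq> hzero C W S"
    then show False using epiD0[OF simple_epi[OF S g(1)] g(1) f g(2)] nz by blast
  qed
qed

lemma epi_simple_nonzero:
  assumes "simple_obj C S" "is_epi C f" "f \<in> Hom C X S" shows "f \<noteq> hzero C X S"
  using zero_obj_if_epi[OF assms(2,3)] assms(1) unfolding simple_obj_def by blast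

end

text \<open>Isomorphism classes serve as labels of composition factors, so that multisets of factors
  can be compared by equality.\<close>

definition obj_class :: "('o, 'a, 'k, 'z) mon_cat_scheme \<Rightarrow> 'o \<Rightarrow> 'o set" where
  "obj_class C X = {Y. iso_objs C X Y}"

text \<open>The series of \<open>finite_length\<close> with the multiset of its factors recorded.
  Domain and codomain are explicit parameters so that case analysis yields plain object
  variables.\<close>

inductive comp_series ::
    "('o, 'a, 'k, 'z) mon_cat_scheme \<Rightarrow> 'o \<Rightarrow> 'o set multiset \<Rightarrow> bool" for C where
  zero: "is_zero_obj C Z \<Longrightarrow> comp_series C Z {#}"
| step: "\<lbrakk>short_exact C f g; f \<in> Hom C A X; g \<in> Hom C X S; comp_series C A L; simple_obj C S\<rbrakk>
          \<Longrightarrow> comp_series C X (add_mset (obj_class C S) L)"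

context abelian_mcat begin

lemma obj_class_eq_iff:
  assumes "Y \<in> Obj C" shows "obj_class C X = obj_class C Y \<longleftrightarrow> iso_objs C X Y"
  using iso_objs_refl[OF assms] iso_objs_trans iso_objs_sym unfolding obj_class_def by blast

lemma comp_series_iso:
  assumes "comp_series C X L" and iso: "iso_objs C X Y" shows "comp_series C Y L"
  using assms(1)
proof cases
  case zero
  then show ?thesis using comp_series.zero zero_obj_iso[OF iso] by simp
next
  case (step f g A S L')
  obtain u v where u: "u \<in> Hom C X Y" "v \<in> Hom C Y X" "v \<cdot> u = idt C X" "u \<cdot> v = idt C Y"
    using iso iso_objsE by blast
  note d = HomD(2,3)[OF step(3)] HomD(2,3)[OF step(4)]
  show ?thesis
    using short_exact_iso[OF step(2), unfolded d, OF u] comp_series.step[OF _ _ _ step(5,6)]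
        step(1) by blast
qed

lemma comp_series_nonzero:
  assumes "simple_obj C S" "g \<in> Hom C X S" "is_epi C g" shows "\<not> is_zero_obj C X"
  using epi_simple_nonzero[OF assms(1,3,2)] zero_objD(3) assms(2) by blast

lemma comp_series_zero_iff:
  assumes "comp_series C X L" shows "is_zero_obj C X \<longleftrightarrow> L = {#}"
  using assms
proof cases
  case (step f g A S L')
  then show ?thesis using comp_series_nonzero[OF step(6,4)] short_exactH(4)[OF step(2-4)] by simp
qed simp

lemma comp_series_simple:
  assumes S: "simple_obj C S" shows "comp_series C S {#obj_class C S#}"
proof -
  obtain Z where Z: "is_zero_obj C Z" using ex_zero by blast
  have "S \<in> Obj C" using S simple_in_Obj by blast
  then show ?thesis
    using comp_series.step[OF short_exact_id[OF _ Z] hzero_in idt_in comp_series.zero[OF Z] S]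
      zero_objD(1)[OF Z] by blast
qed

text \<open>\<open>Dom C k\<close> is the preimage of the subobject \<open>Y'\<close> under
  \<open>g\<close>, and \<open>b\<close> is the restriction of \<open>g\<close> to it. This is an
  element-free form of the fact that the pullback of an epimorphism is one.\<close>

lemma epi_restrict_to_preimage:
  assumes se: "short_exact C f g" "f \<in> Hom C A X" "g \<in> Hom C X Y"
    and se': "short_exact C f' g'" "f' \<in> Hom C Y' Y" "g' \<in> Hom C Y S"
    and k: "is_kernel C k (g' \<cdot> g)" and b: "b \<in> Hom C (Dom C k) Y'" "f' \<cdot> b = g \<cdot> k"
  shows "is_epi C b"
proof (rule epiI[OF b(1)])
  note s = short_exactH[OF se] and s' = short_exactH[OF se']
  have g'g: "g' \<cdot> g \<in> Hom C X S" using cmp_in[OF se(3) se'(3)] .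
  note kH = kernelD[OF k g'g]
  have e: "is_epi C (g' \<cdot> g)" using is_epi_cmp[OF s(4) se(3) s'(4) se'(3)] .
  have ck: "is_cokernel C (g' \<cdot> g) k" using cokernel_of_kernel[OF e g'g k] .
  \<comment> \<open>As \<open>g' \<cdot> g\<close> is the cokernel of \<open>k\<close>, such a
    \<open>z\<close> factors through \<open>g'\<close>, which kills \<open>f'\<close>.\<close>
  have *: "z \<cdot> f' = hzero C Y' W" if z: "z \<in> Hom C Y W" "z \<cdot> (g \<cdot> k) = hzero C (Dom C k) W" for z W
  proof -
    have "(z \<cdot> g) \<cdot> k = hzero C (Dom C k) W" using cmp_assoc[OF kH(1) se(3) z(1)] z(2) by simp
    then obtain w where "w \<in> Hom C (Cod C (g' \<cdot> g)) W" and w': "w \<cdot> (g' \<cdot> g) = z \<cdot> g"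
      using cokernel_factor[OF ck kH(1) cmp_in[OF se(3) z(1)]] by blast
    then have w: "w \<in> Hom C S W" using HomD[OF g'g] by simp
    have "(w \<cdot> g') \<cdot> g = z \<cdot> g" using cmp_assoc[OF se(3) se'(3) w] w' by simp
    then have wz: "w \<cdot> g' = z" using is_epiD[OF s(4) se(3) cmp_in[OF se'(3) w] z(1)] by blast
    have "z \<cdot> f' = w \<cdot> (g' \<cdot> f')" using cmp_assoc[OF se'(2,3) w] wz by simp
    also have "\<dots> = hzero C Y' W" using s'(5) cmp_zero[OF w] HomD[OF se'(2)] by simp
    finally show ?thesis .
  qed
  fix W c assume c: "c \<in> Hom C Y' W" "c \<cdot> b = hzero C (Dom C k) W"
  obtain m where m: "is_kernel C m c" using ex_kernel HomD[OF c(1)] by blast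
  note mH = kernelD[OF m c(1)]
  obtain e where e: "e \<in> Hom C (Dom C k) (Dom C m)" "m \<cdot> e = b"
    using kernel_factor[OF m c(1) b(1) c(2)] .
  have f'm: "f' \<cdot> m \<in> Hom C (Dom C m) Y" using cmp_in[OF mH(1) se'(2)] .
  \<comment> \<open>\<open>z\<close> divides \<open>Y\<close> by the subobject of \<open>Y'\<close>
    on which \<open>c\<close> vanishes. It kills \<open>g \<cdot> k\<close>, hence all of
    \<open>Y'\<close>, so that subobject is \<open>Y'\<close> itself and \<open>c\<close> is
    zero.\<close>
  obtain z where z: "is_cokernel C z (f' \<cdot> m)" using ex_cokernel HomD[OF f'm] by blast
  note zH = cokernelD[OF z f'm]
  have kz: "is_kernel C (f' \<cdot> m) z"
    using kernel_of_cokernel[OF is_mono_cmp[OF kernel_mono[OF m] mH(1) s'(3) se'(2)] f'm z] .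
  have "g \<cdot> k = (f' \<cdot> m) \<cdot> e" using cmp_assoc[OF e(1) mH(1) se'(2)] e(2) b(2) by simp
  then have "z \<cdot> (g \<cdot> k) = (z \<cdot> (f' \<cdot> m)) \<cdot> e" using cmp_assoc[OF e(1) f'm zH(1)] by simp
  also have "\<dots> = hzero C (Dom C k) (Cod C z)" using zH zero_cmp[OF e(1)] HomD[OF zH(1)] by simp
  finally have "z \<cdot> f' = hzero C Y' (Cod C z)" using * zH(1) by blast
  then obtain r where "r \<in> Hom C Y' (Dom C (f' \<cdot> m))" and fr: "(f' \<cdot> m) \<cdot> r = f'"
    using kernel_factor[OF kz zH(1) se'(2)] by blast
  then have r: "r \<in> Hom C Y' (Dom C m)" using HomD[OF f'm] by simp
  have "f' \<cdot> (m \<cdot> r) = f' \<cdot> idt C Y'" using fr cmp_assoc[OF r mH(1) se'(2)] cmp_idt[OF se'(2)]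
    by simp
  then have mr: "m \<cdot> r = idt C Y'"
    using is_monoD[OF s'(3) se'(2) cmp_in[OF r mH(1)] idt_in] HomD[OF c(1)] by blast
  have "c = (c \<cdot> m) \<cdot> r" using cmp_assoc[OF r mH(1) c(1)] mr cmp_idt[OF c(1)] by simp
  then show "c = hzero C Y' W" using mH(2) zero_cmp[OF r] HomD[OF c(1)] by simp
qed

text \<open>Induction on the series of the quotient \<open>Y\<close>: the maximal subobject
  \<open>Y'\<close> of \<open>Y\<close> is pulled back to the subobject \<open>Dom C k\<close> of
  \<open>X\<close>. The latter is an extension of \<open>Y'\<close> by \<open>A\<close>, and
  \<open>X\<close> modulo it is the top factor \<open>S\<close>.\<close>

lemma comp_series_extension:
  assumes "comp_series C Y L'" "short_exact C f g" "f \<in> Hom C A X" "g \<in> Hom C X Y"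
      "comp_series C A L"
  shows "comp_series C X (L + L')"
  using assms
proof (induction arbitrary: f g A X L rule: comp_series.induct)
  case (zero Y)
  then show ?case using comp_series_iso short_exact_iso_left by fastforce
next
  case (step f' g' Y' Y S L')
  note se = step.prems(1-3) and se' = step.hyps(1-3)
  note s = short_exactH[OF se] and s' = short_exactH[OF se']
  have g'g: "g' \<cdot> g \<in> Hom C X S" using cmp_in[OF se(3) se'(3)] .
  have e: "is_epi C (g' \<cdot> g)" using is_epi_cmp[OF s(4) se(3) s'(4) se'(3)] .
  obtain k where k: "short_exact C k (g' \<cdot> g)" "k \<in> Hom C (Dom C k) X"
    using epi_short_exact[OF e g'g] .
  note sk = short_exactH[OF k g'g]
  have "(g' \<cdot> g) \<cdot> f = g' \<cdot> (g \<cdot> f)" using cmp_assoc[OF se(2,3) se'(3)] .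
  also have "\<dots> = hzero C A S" using s(5) cmp_zero[OF se'(3)] HomD[OF se(2)] by simp
  finally obtain a where a: "a \<in> Hom C A (Dom C k)" "k \<cdot> a = f"
    using kernel_factor[OF sk(1) g'g se(2)] by blast
  have gk: "g \<cdot> k \<in> Hom C (Dom C k) Y" using cmp_in[OF k(2) se(3)] .
  have "g' \<cdot> (g \<cdot> k) = hzero C (Dom C k) S" using cmp_assoc[OF k(2) se(3) se'(3)] sk(5) by simp
  then obtain b where b': "b \<in> Hom C (Dom C k) (Dom C f')" "f' \<cdot> b = g \<cdot> k"
    using kernel_factor[OF s'(1) se'(3) gk] by blast
  then have b: "b \<in> Hom C (Dom C k) Y'" using HomD[OF se'(2)] by simp
  have eb: "is_epi C b" using epi_restrict_to_preimage[OF se se' sk(1) b b'(2)] .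
  have ma: "is_mono C a"
  proof (rule monoI[OF a(1)])
    fix W h assume h: "h \<in> Hom C W A" "a \<cdot> h = hzero C W (Dom C k)"
    have "f \<cdot> h = k \<cdot> (a \<cdot> h)" using cmp_assoc[OF h(1) a(1) k(2)] a(2) by simp
    also have "\<dots> = hzero C W X" using h(2) cmp_zero[OF k(2)] HomD[OF h(1)] by simp
    finally show "h = hzero C W A" using monoD0[OF s(3) se(2) h(1)] by blast
  qed
  have "f' \<cdot> (b \<cdot> a) = (g \<cdot> k) \<cdot> a" using cmp_assoc[OF a(1) b se'(2)] b'(2) by simp
  also have "\<dots> = hzero C A Y" using cmp_assoc[OF a(1) k(2) se(3)] a(2) s(5) by simp
  finally have ba: "b \<cdot> a = hzero C A Y'" using monoD0[OF s'(3) se'(2) cmp_in[OF a(1) b]] by blast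
  have "is_kernel C a b"
  proof (rule kernelI[OF b a(1) ma ba])
    fix W h assume h: "h \<in> Hom C W (Dom C k)" "b \<cdot> h = hzero C W Y'"
    have kh: "k \<cdot> h \<in> Hom C W X" using cmp_in[OF h(1) k(2)] .
    have "g \<cdot> (k \<cdot> h) = f' \<cdot> (b \<cdot> h)"
      using cmp_assoc[OF h(1) k(2) se(3)] cmp_assoc[OF h(1) b se'(2)] b'(2) by simp
    also have "\<dots> = hzero C W Y" using h(2) cmp_zero[OF se'(2)] HomD[OF h(1)] by simp
    finally obtain h' where h': "h' \<in> Hom C W (Dom C f)" "f \<cdot> h' = k \<cdot> h"
      using kernel_factor[OF s(1) se(3) kh] by blast
    then have h'A: "h' \<in> Hom C W A" using HomD[OF se(2)] by simp
    have "k \<cdot> (a \<cdot> h') = k \<cdot> h" using cmp_assoc[OF h'A a(1) k(2)] a(2) h' by simp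
    then have "a \<cdot> h' = h" using is_monoD[OF sk(3) k(2) cmp_in[OF h'A a(1)] h(1)] by blast
    then show "\<exists>h'\<in>Hom C W A. a \<cdot> h' = h" using h'A by blast
  qed
  then have "short_exact C a b" using cokernel_of_kernel[OF eb b] by (simp add: short_exact_def)
  then have "comp_series C (Dom C k) (L + L')" using step.IH a(1) b step.prems(4) by blast
  then show ?case using comp_series.step[OF k g'g _ step.hyps(5)] by simp
qed

text \<open>If \<open>p\<close> killed \<open>j\<close>, it would factor as
  \<open>r \<cdot> q\<close> with \<open>r\<close> nonzero between simple objects, hence a
  monomorphism; then \<open>r \<cdot> (q \<cdot> i) = p \<cdot> i = 0\<close> would force
  \<open>q \<cdot> i\<close> to vanish.\<close>

lemma composite_nonzero_swap:
  assumes se: "short_exact C i p" "i \<in> Hom C A X" "p \<in> Hom C X S"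
    and se': "short_exact C j q" "j \<in> Hom C B X" "q \<in> Hom C X T"
    and S: "simple_obj C S" and T: "simple_obj C T" and nz: "q \<cdot> i \<noteq> hzero C A T"
  shows "p \<cdot> j \<noteq> hzero C B S"
proof
  note s = short_exactH[OF se] and s' = short_exactH[OF se']
  assume "p \<cdot> j = hzero C B S"
  then obtain r where "r \<in> Hom C (Cod C q) S" and rq: "r \<cdot> q = p"
    using cokernel_factor[OF s'(2) se'(2) se(3)] by blast
  then have r: "r \<in> Hom C T S" using HomD[OF se'(3)] by simp
  have "hzero C T S \<cdot> q = hzero C X S" using zero_cmp[OF se'(3)] HomD[OF r] by blast
  then have "r \<noteq> hzero C T S" using rq epi_simple_nonzero[OF S s(4) se(3)] by blast
  then have "is_mono C r" using simple_mono[OF T r] by blast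
  moreover have "r \<cdot> (q \<cdot> i) = hzero C A S" using cmp_assoc[OF se(2) se'(3) r] rq s(5) by simp
  ultimately show False using monoD0[OF _ r cmp_in[OF se(2) se'(3)]] nz by blast
qed

text \<open>The two vanishing composites say that each of the subobjects \<open>A\<close> and
  \<open>B\<close> of \<open>X\<close> is contained in the other.\<close>

lemma maximal_subobjects_iso:
  assumes se: "short_exact C i p" "i \<in> Hom C A X" "p \<in> Hom C X S"
    and se': "short_exact C j q" "j \<in> Hom C B X" "q \<in> Hom C X T"
    and z: "q \<cdot> i = hzero C A T" and z': "p \<cdot> j = hzero C B S"
  shows "iso_objs C A B" "iso_objs C S T"
proof -
  note s = short_exactH[OF se] and s' = short_exactH[OF se']
  obtain a where "a \<in> Hom C A (Dom C j)" and ja: "j \<cdot> a = i"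
    using kernel_factor[OF s'(1) se'(3) se(2) z] .
  then have a: "a \<in> Hom C A B" using HomD[OF se'(2)] by simp
  obtain b where "b \<in> Hom C B (Dom C i)" and ib: "i \<cdot> b = j"
    using kernel_factor[OF s(1) se(3) se'(2) z'] .
  then have b: "b \<in> Hom C B A" using HomD[OF se(2)] by simp
  have "i \<cdot> (b \<cdot> a) = i \<cdot> idt C A" using cmp_assoc[OF a b se(2)] ib ja cmp_idt[OF se(2)] by simp
  then have ba: "b \<cdot> a = idt C A" using is_monoD[OF s(3) se(2) cmp_in[OF a b] idt_in] HomD[OF a]
    by blast
  have "j \<cdot> (a \<cdot> b) = j \<cdot> idt C B" using cmp_assoc[OF b a se'(2)] ib ja cmp_idt[OF se'(2)] by simp
  then have ab: "a \<cdot> b = idt C B" using is_monoD[OF s'(3) se'(2) cmp_in[OF b a] idt_in] HomD[OF a]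
    by blast
  show "iso_objs C A B" using iso_objsI[OF a b ba ab] .
  obtain r where "r \<in> Hom C (Cod C q) S" and rq: "r \<cdot> q = p"
    using cokernel_factor[OF s'(2) se'(2) se(3) z'] .
  then have r: "r \<in> Hom C T S" using HomD[OF se'(3)] by simp
  obtain t where "t \<in> Hom C (Cod C p) T" and tp: "t \<cdot> p = q"
    using cokernel_factor[OF s(2) se(2) se'(3) z] .
  then have t: "t \<in> Hom C S T" using HomD[OF se(3)] by simp
  have "(r \<cdot> t) \<cdot> p = idt C S \<cdot> p" using cmp_assoc[OF se(3) t r] rq tp idt_cmp[OF se(3)] by simp
  then have rt: "r \<cdot> t = idt C S" using is_epiD[OF s(4) se(3) cmp_in[OF t r] idt_in] HomD[OF t]
    by blast
  have "(t \<cdot> r) \<cdot> q = idt C T \<cdot> q" using cmp_assoc[OF se'(3) r t] rq tp idt_cmp[OF se'(3)] by simp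
  then have tr: "t \<cdot> r = idt C T" using is_epiD[OF s'(4) se'(3) cmp_in[OF r t] idt_in] HomD[OF t]
    by blast
  show "iso_objs C S T" using iso_objsI[OF t r rt tr] .
qed

text \<open>\<open>Dom C k\<close> is the intersection of the maximal subobjects \<open>A\<close>
  and \<open>B\<close>. Modulo it \<open>A\<close> becomes \<open>T\<close> and \<open>B\<close>
  becomes \<open>S\<close>: the two factors change places.\<close>

lemma exchange:
  assumes se: "short_exact C i p" "i \<in> Hom C A X" "p \<in> Hom C X S"
    and se': "short_exact C j q" "j \<in> Hom C B X" "q \<in> Hom C X T"
    and S: "simple_obj C S" and T: "simple_obj C T" and nz: "q \<cdot> i \<noteq> hzero C A T"
  obtains k l where "short_exact C k (q \<cdot> i)" "k \<in> Hom C (Dom C k) A"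
    "short_exact C l (p \<cdot> j)" "l \<in> Hom C (Dom C k) B"
proof -
  note s = short_exactH[OF se] and s' = short_exactH[OF se']
  have qi: "q \<cdot> i \<in> Hom C A T" and pj: "p \<cdot> j \<in> Hom C B S" using cmp_in se se' by blast+
  obtain k where k: "short_exact C k (q \<cdot> i)" "k \<in> Hom C (Dom C k) A"
    using epi_short_exact[OF simple_epi[OF T qi nz] qi] .
  note sk = short_exactH[OF k qi]
  have pje: "is_epi C (p \<cdot> j)" using simple_epi[OF S pj composite_nonzero_swap[OF se se' S T nz]] .
  have ik: "i \<cdot> k \<in> Hom C (Dom C k) X" using cmp_in[OF k(2) se(2)] .
  have "q \<cdot> (i \<cdot> k) = hzero C (Dom C k) T" using cmp_assoc[OF k(2) se(2) se'(3)] sk(5) by simp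
  then obtain l where "l \<in> Hom C (Dom C k) (Dom C j)" and jl: "j \<cdot> l = i \<cdot> k"
    using kernel_factor[OF s'(1) se'(3) ik] by blast
  then have l: "l \<in> Hom C (Dom C k) B" using HomD[OF se'(2)] by simp
  have ml: "is_mono C l"
  proof (rule monoI[OF l])
    fix W h assume h: "h \<in> Hom C W (Dom C k)" "l \<cdot> h = hzero C W B"
    have "(i \<cdot> k) \<cdot> h = j \<cdot> (l \<cdot> h)" using cmp_assoc[OF h(1) l se'(2)] jl by simp
    also have "\<dots> = hzero C W X" using h(2) cmp_zero[OF se'(2)] HomD[OF h(1)] by simp
    finally show "h = hzero C W (Dom C k)"
      using monoD0[OF is_mono_cmp[OF sk(3) k(2) s(3) se(2)] ik h(1)] by blast
  qed
  have "(p \<cdot> j) \<cdot> l = p \<cdot> (i \<cdot> k)" using cmp_assoc[OF l se'(2) se(3)] jl by simp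
  also have "\<dots> = (p \<cdot> i) \<cdot> k" using cmp_assoc[OF k(2) se(2,3)] by simp
  also have "\<dots> = hzero C (Dom C k) S" using s(5) zero_cmp[OF k(2)] HomD[OF se(3)] by simp
  finally have z: "(p \<cdot> j) \<cdot> l = hzero C (Dom C k) S" .
  have "is_kernel C l (p \<cdot> j)"
  proof (rule kernelI[OF pj l ml z])
    fix W h assume h: "h \<in> Hom C W B" "(p \<cdot> j) \<cdot> h = hzero C W S"
    have jh: "j \<cdot> h \<in> Hom C W X" using cmp_in[OF h(1) se'(2)] .
    have "p \<cdot> (j \<cdot> h) = hzero C W S" using cmp_assoc[OF h(1) se'(2) se(3)] h(2) by simp
    then obtain h' where "h' \<in> Hom C W (Dom C i)" and ih': "i \<cdot> h' = j \<cdot> h"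
      using kernel_factor[OF s(1) se(3) jh] by blast
    then have h': "h' \<in> Hom C W A" using HomD[OF se(2)] by simp
    have "(q \<cdot> i) \<cdot> h' = q \<cdot> (j \<cdot> h)" using cmp_assoc[OF h' se(2) se'(3)] ih' by simp
    also have "\<dots> = (q \<cdot> j) \<cdot> h" using cmp_assoc[OF h(1) se'(2,3)] by simp
    also have "\<dots> = hzero C W T" using s'(5) zero_cmp[OF h(1)] HomD[OF se'(3)] by simp
    finally obtain h'' where h'': "h'' \<in> Hom C W (Dom C k)" "k \<cdot> h'' = h'"
      using kernel_factor[OF sk(1) qi h'] by blast
    have "j \<cdot> (l \<cdot> h'') = (i \<cdot> k) \<cdot> h''" using cmp_assoc[OF h''(1) l se'(2)] jl by simp
    also have "\<dots> = j \<cdot> h" using cmp_assoc[OF h''(1) k(2) se(2)] h''(2) ih' by simp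
    finally have "l \<cdot> h'' = h" using is_monoD[OF s'(3) se'(2) cmp_in[OF h''(1) l] h(1)] by blast
    then show "\<exists>h'\<in>Hom C W (Dom C k). l \<cdot> h' = h" using h''(1) by blast
  qed
  then have "short_exact C l (p \<cdot> j)" using cokernel_of_kernel[OF pje pj]
    by (simp add: short_exact_def)
  then show ?thesis using that k l by blast
qed

end

section \<open>Jordan-Hoelder multiplicities\<close>

locale finite_length_mcat = abelian_mcat K C
  for K :: "('k, 'r) ring_scheme" and C :: "('o, 'a, 'k, 'z) mon_cat_scheme" (structure) +
  assumes all_finite_length: "X \<in> Obj C \<Longrightarrow> finite_length C X"
begin

lemma finite_length_imp_comp_series: "finite_length C X \<Longrightarrow> \<exists>L. comp_series C X L"
proof (induction rule: finite_length.induct)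
  case (zero Z)
  show ?case by (rule exI, rule comp_series.zero, rule zero)
next
  case (step f g)
  then obtain L where L: "comp_series C (Dom C f) L" by blast
  show ?case
    by (rule exI, rule comp_series.step[OF step.hyps(1) short_exactD(3,4)[OF step.hyps(1)] L
        step.hyps(3)])
qed

lemma ex_comp_series:
  assumes "X \<in> Obj C" obtains L where "comp_series C X L"
  using finite_length_imp_comp_series all_finite_length[OF assms] by blast

text \<open>
  Jordan-Hoelder theorem: if two maximal subobjects differ, their intersection is maximal in both.
\<close>

lemma comp_series_unique:
  assumes "comp_series C X L" "comp_series C X L'" shows "L = L'"
  using assms
proof (induction "size L" arbitrary: X L L')
  case 0
  then show ?case using comp_series_zero_iff by auto
next
  case (Suc N)
  from Suc.prems(1) Suc.hyps(2) obtain i p A S L1 where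
    se: "short_exact C i p" "i \<in> Hom C A X" "p \<in> Hom C X S" and
    L1: "comp_series C A L1" "simple_obj C S" "L = add_mset (obj_class C S) L1"
    by (cases rule: comp_series.cases) auto
  have "L \<noteq> {#}" using Suc.hyps(2) by auto
  then have "L' \<noteq> {#}" using comp_series_zero_iff[OF Suc.prems(1)] comp_series_zero_iff[OF
      Suc.prems(2)] by simp
  with Suc.prems(2) obtain j q B T L2 where
    se': "short_exact C j q" "j \<in> Hom C B X" "q \<in> Hom C X T" and
    L2: "comp_series C B L2" "simple_obj C T" "L' = add_mset (obj_class C T) L2"
    by (cases rule: comp_series.cases) auto
  have N: "N = size L1" using Suc.hyps(2) L1(3) by simp
  show ?case
  proof (cases "q \<cdot> i = hzero C A T")
    case True
    have z: "p \<cdot> j = hzero C B S"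
      using True composite_nonzero_swap[OF se' se L2(2) L1(2)] by blast
    note iso = maximal_subobjects_iso[OF se se' True z]
    have "comp_series C A L2" using comp_series_iso[OF L2(1)] iso(1) iso_objs_sym by blast
    then have "L1 = L2" using Suc.hyps(1)[OF N L1(1)] by blast
    then show ?thesis using L1(3) L2(3) iso(2) obj_class_eq_iff simple_in_Obj[OF L2(2)] by simp
  next
    case False
    obtain k l where k: "short_exact C k (q \<cdot> i)" "k \<in> Hom C (Dom C k) A"
      and l: "short_exact C l (p \<cdot> j)" "l \<in> Hom C (Dom C k) B"
      using exchange[OF se se' L1(2) L2(2) False] .
    obtain LK where LK: "comp_series C (Dom C k) LK" using ex_comp_series HomD[OF k(2)] by blast
    have "comp_series C A (add_mset (obj_class C T) LK)"
      using comp_series.step[OF k cmp_in[OF se(2) se'(3)] LK L2(2)] .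
    then have L1_eq: "L1 = add_mset (obj_class C T) LK" using Suc.hyps(1)[OF N L1(1)] by blast
    have B: "comp_series C B (add_mset (obj_class C S) LK)"
      using comp_series.step[OF l cmp_in[OF se'(2) se(3)] LK L1(2)] .
    \<comment> \<open>The length of \<open>L2\<close> is not known in advance. The induction
      hypothesis is applied to the series of \<open>B\<close> through the intersection, which has
      the length of \<open>L1\<close>.\<close>
    have "add_mset (obj_class C S) LK = L2"
      using Suc.hyps(1)[OF _ B L2(1)] N L1_eq by simp
    then show ?thesis using L1_eq L1(3) L2(3) by (auto simp: add_mset_commute)
  qed
qed

definition jh :: "'o \<Rightarrow> 'o set multiset" where
  "jh X = (THE L. comp_series C X L)"

lemma jh_eq: "comp_series C X L \<Longrightarrow> jh X = L"
  unfolding jh_def using comp_series_unique by blast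

lemma comp_series_jh: "X \<in> Obj C \<Longrightarrow> comp_series C X (jh X)"
  using ex_comp_series jh_eq by metis

lemma jh_short_exact:
  assumes "short_exact C f g" "f \<in> Hom C A X" "g \<in> Hom C X Y"
  shows "jh X = jh A + jh Y"
  using comp_series_extension[OF comp_series_jh assms comp_series_jh] jh_eq
    HomD[OF assms(2)] HomD[OF assms(3)] by blast

lemma jh_simple: "simple_obj C S \<Longrightarrow> jh S = {#obj_class C S#}"
  by (rule jh_eq, rule comp_series_simple)

text \<open>The only factor sits on top of a zero subobject, so the quotient map onto it is
  invertible.\<close>

lemma jh_singleton_imp_iso:
  assumes X: "X \<in> Obj C" and S: "simple_obj C S" and jh: "jh X = {#obj_class C S#}"
  shows "iso_objs C X S"
  using comp_series_jh[OF X]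
proof cases
  case zero
  then show ?thesis using jh by simp
next
  case (step f g A T L)
  have "L = {#}" "obj_class C T = obj_class C S" using step(1) jh by (auto split: if_splits)
  then have "is_zero_obj C A" "iso_objs C T S"
    using comp_series_zero_iff step(5) obj_class_eq_iff simple_in_Obj[OF S] by auto
  then show ?thesis using short_exact_iso_right[OF step(2-4)] iso_objs_trans by blast
qed

lemma jh_quotient:
  assumes "is_epi C p" "p \<in> Hom C X Y" shows "jh Y \<subseteq># jh X"
  using epi_short_exact[OF assms] jh_short_exact[OF _ _ assms(2)]
    by (metis mset_subset_eq_add_right)

lemma simple_quotient_in_jh:
  assumes "is_epi C p" "p \<in> Hom C X S" "simple_obj C S" shows "obj_class C S \<in># jh X"
  using jh_quotient[OF assms(1,2)] jh_simple[OF assms(3)] by simp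

lemma subquotient_of_mono:
  assumes "subquotient C X' A" and f: "is_mono C f" "f \<in> Hom C A X" shows "subquotient C X' X"
proof -
  obtain i p where i: "is_mono C i" "Cod C i = A" "is_epi C p" "Dom C p = Dom C i" "Cod C p = X'"
    using assms(1) unfolding subquotient_def by blast
  have iH: "i \<in> Hom C (Dom C i) A" using i HomI unfolding is_mono_def by blast
  note fi = cmp_in[OF iH f(2)]
  have "is_mono C (f \<cdot> i)" using is_mono_cmp[OF i(1) iH f] .
  then show ?thesis using i HomD[OF fi] unfolding subquotient_def by metis
qed

lemma subquotient_of_epi:
  assumes p: "is_epi C p" "p \<in> Hom C X Y" shows "subquotient C Y X"
proof -
  have id: "idt C X \<in> Hom C X X" using idt_in HomD[OF p(2)] by blast
  have "is_mono C (idt C X)" using section_imp_mono[OF id id] cmp_idt[OF id] by blast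
  then show ?thesis using p HomD[OF p(2)] HomD[OF id] unfolding subquotient_def by metis
qed

lemma subquotient_refl:
  assumes "X \<in> Obj C" shows "subquotient C X X"
  using retraction_imp_epi[OF idt_in[OF assms] idt_in[OF assms]] cmp_idt idt_in[OF assms]
    subquotient_of_epi by blast

text \<open>Links multiplicities to the monotonicity axiom, which is stated for subquotients: a
  factor is either the top quotient or a subquotient of the next smaller subobject.\<close>

lemma in_jh_imp_subquotient:
  assumes "X \<in> Obj C" "c \<in># jh X"
  shows "\<exists>S. subquotient C S X \<and> simple_obj C S \<and> c = obj_class C S"
proof -
  have "c \<in># L \<Longrightarrow> \<exists>S. subquotient C S X \<and> simple_obj C S \<and> c = obj_class C S"
    if "comp_series C X L" for L
    using that
  proof induction
    case (step f g A X S L)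
    note s = short_exactH[OF step.hyps(1-3)]
    show ?case
    proof (cases "c = obj_class C S")
      case True
      then show ?thesis using subquotient_of_epi[OF s(4) step.hyps(3)] step.hyps(5) by blast
    next
      case False
      then show ?thesis using step.IH step.prems subquotient_of_mono[OF _ s(3) step.hyps(2)] by auto
    qed
  qed simp
  then show ?thesis using comp_series_jh assms by blast
qed

subsection \<open>Existence of heads\<close>

lemma biproduct_short_exact:
  assumes "X \<in> Obj C" "S \<in> Obj C"
    and i: "i \<in> Hom C X P" and j: "j \<in> Hom C S P" and p: "p \<in> Hom C P X" and q: "q \<in> Hom C P S"
    and eq: "p \<cdot> i = idt C X" "q \<cdot> j = idt C S" "p \<cdot> j = hzero C S X" "q \<cdot> i = hzero C X S"
      "(i \<cdot> p) +\<^sub>h (j \<cdot> q) = idt C P"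
  shows "short_exact C i q"
proof -
  have mi: "is_mono C i" using section_imp_mono[OF i p eq(1)] .
  have eq': "is_epi C q" using retraction_imp_epi[OF q j eq(2)] .
  have "is_kernel C i q"
  proof (rule kernelI[OF q i mi eq(4)])
    fix W h assume h: "h \<in> Hom C W P" "q \<cdot> h = hzero C W S"
    have ip: "i \<cdot> p \<in> Hom C P P" and jq: "j \<cdot> q \<in> Hom C P P" using cmp_in i j p q by blast+
    have ph: "i \<cdot> (p \<cdot> h) \<in> Hom C W P" using cmp_in i p h by blast
    have "h = ((i \<cdot> p) +\<^sub>h (j \<cdot> q)) \<cdot> h" using eq(5) idt_cmp[OF h(1)] by simp
    also have "\<dots> = ((i \<cdot> p) \<cdot> h) +\<^sub>h ((j \<cdot> q) \<cdot> h)" using cmp_add_left[OF h(1) ip jq] .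
    also have "(i \<cdot> p) \<cdot> h = i \<cdot> (p \<cdot> h)" using cmp_assoc[OF h(1) p i] .
    also have "(j \<cdot> q) \<cdot> h = hzero C W P"
      using cmp_assoc[OF h(1) q j] h(2) cmp_zero[OF j] HomD[OF h(1)] by simp
    also have "i \<cdot> (p \<cdot> h) +\<^sub>h hzero C W P = i \<cdot> (p \<cdot> h)" using hadd_zero_right[OF ph] .
    finally have "i \<cdot> (p \<cdot> h) = h" by simp
    then show "\<exists>h'\<in>Hom C W X. i \<cdot> h' = h" using cmp_in[OF h(1) p] by blast
  qed
  then show ?thesis using cokernel_of_kernel[OF eq' q] by (simp add: short_exact_def)
qed

text \<open>An arrow \<open>p\<close> that does not factor through \<open>q\<close> is nonzero on
  the kernel of \<open>q\<close>, hence already an epimorphism from there to \<open>S\<close>. The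
  pair of \<open>q\<close> and \<open>p\<close> is therefore an epimorphism onto the
  biproduct.\<close>

lemma epi_to_biproduct:
  assumes q: "is_epi C q" "q \<in> Hom C X H" and p: "p \<in> Hom C X S" and S: "simple_obj C S"
    and nf: "\<nexists>h. h \<in> Hom C H S \<and> p = h \<cdot> q"
    and bi: "is_biproduct C H S P"
  shows "\<exists>r \<in> Hom C X P. is_epi C r"
proof -
  obtain i j u v where i: "i \<in> Hom C H P" and j: "j \<in> Hom C S P" and u: "u \<in> Hom C P H"
    and v: "v \<in> Hom C P S"
    and eq: "u \<cdot> i = idt C H" "v \<cdot> j = idt C S" "u \<cdot> j = hzero C S H" "v \<cdot> i = hzero C H S"
      "(i \<cdot> u) +\<^sub>h (j \<cdot> v) = idt C P"
    using bi unfolding is_biproduct_def by blast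
  obtain k where k: "short_exact C k q" "k \<in> Hom C (Dom C k) X" using epi_short_exact[OF q] .
  note sk = short_exactH[OF k q(2)]
  have pk: "p \<cdot> k \<in> Hom C (Dom C k) S" using cmp_in[OF k(2) p] .
  have "p \<cdot> k \<noteq> hzero C (Dom C k) S"
  proof
    assume "p \<cdot> k = hzero C (Dom C k) S"
    then obtain h where "h \<in> Hom C (Cod C q) S" "h \<cdot> q = p" using cokernel_factor[OF sk(2) k(2) p]
      by blast
    then show False using nf HomD[OF q(2)] by auto
  qed
  then have epk: "is_epi C (p \<cdot> k)" using simple_epi[OF S pk] by blast
  have iq: "i \<cdot> q \<in> Hom C X P" and jp: "j \<cdot> p \<in> Hom C X P" using cmp_in i j q p by blast+
  define r where "r = (i \<cdot> q) +\<^sub>h (j \<cdot> p)"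
  have r: "r \<in> Hom C X P" unfolding r_def using hadd_in[OF iq jp] .
  have "is_epi C r"
  proof (rule epiI[OF r])
    fix W g assume g: "g \<in> Hom C P W" "g \<cdot> r = hzero C X W"
    have gi: "g \<cdot> i \<in> Hom C H W" and gj: "g \<cdot> j \<in> Hom C S W" using cmp_in g i j by blast+
    have giq: "(g \<cdot> i) \<cdot> q \<in> Hom C X W" and gjp: "(g \<cdot> j) \<cdot> p \<in> Hom C X W" using cmp_in gi gj q p
      by blast+
    have sum: "(g \<cdot> i) \<cdot> q +\<^sub>h (g \<cdot> j) \<cdot> p = hzero C X W"
      using g(2) cmp_add_right[OF iq jp g(1)] cmp_assoc[OF q(2) i g(1)] cmp_assoc[OF p j g(1)]
      unfolding r_def by simp
    have z: "((g \<cdot> i) \<cdot> q) \<cdot> k = hzero C (Dom C k) W"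
      using cmp_assoc[OF k(2) q(2) gi] sk(5) cmp_zero[OF gi] HomD[OF k(2)] by simp
    have gjpk: "(g \<cdot> j) \<cdot> (p \<cdot> k) \<in> Hom C (Dom C k) W" using cmp_in[OF pk gj] .
    have "hzero C (Dom C k) W = ((g \<cdot> i) \<cdot> q +\<^sub>h (g \<cdot> j) \<cdot> p) \<cdot> k"
      using sum zero_cmp[OF k(2)] HomD[OF g(1)] by simp
    also have "\<dots> = hzero C (Dom C k) W +\<^sub>h (g \<cdot> j) \<cdot> (p \<cdot> k)"
      using cmp_add_left[OF k(2) giq gjp] z cmp_assoc[OF k(2) p gj] by simp
    also have "\<dots> = (g \<cdot> j) \<cdot> (p \<cdot> k)" using hadd_zero_left[OF gjpk] .
    \<comment> \<open>Restricting to the kernel of \<open>q\<close> isolates the component of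
      \<open>g\<close> on \<open>S\<close>; the component on \<open>H\<close> then follows because
      \<open>q\<close> is an epimorphism.\<close>
    finally have gj0: "g \<cdot> j = hzero C S W" using epiD0[OF epk pk gj] by simp
    have "(g \<cdot> j) \<cdot> p = hzero C X W" using gj0 zero_cmp[OF p] HomD[OF g(1)] by simp
    then have "(g \<cdot> i) \<cdot> q = hzero C X W" using sum hadd_zero_right[OF giq] by simp
    then have gi0: "g \<cdot> i = hzero C H W" using epiD0[OF q gi] by blast
    have iu: "i \<cdot> u \<in> Hom C P P" and jv: "j \<cdot> v \<in> Hom C P P" using cmp_in i j u v by blast+
    have "g = g \<cdot> ((i \<cdot> u) +\<^sub>h (j \<cdot> v))" using eq(5) cmp_idt[OF g(1)] by simp
    also have "\<dots> = (g \<cdot> i) \<cdot> u +\<^sub>h (g \<cdot> j) \<cdot> v"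
      using cmp_add_right[OF iu jv g(1)] cmp_assoc[OF u i g(1)] cmp_assoc[OF v j g(1)] by simp
    also have "\<dots> = hzero C P W"
      using gi0 gj0 zero_cmp[OF u] zero_cmp[OF v] HomD[OF g(1)] hadd_zero_left hzero_in by simp
    finally show "g = hzero C P W" .
  qed
  then show ?thesis using r by blast
qed

text \<open>Among the semisimple quotients one of maximal length is taken, lengths being bounded by
  that of \<open>X\<close>. A map to a simple object not factoring through it would give a longer
  semisimple quotient; other semisimple targets are treated one summand at a time.\<close>

lemma ex_head:
  assumes X: "X \<in> Obj C" shows "\<exists>H. is_head C X H"
proof -
  define Q where "Q H \<longleftrightarrow> semisimple_obj C H \<and> (\<exists>q \<in> Hom C X H. is_epi C q)" for H
  obtain Z where Z: "is_zero_obj C Z" using ex_zero by blast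
  have z: "hzero C X Z \<in> Hom C X Z" using hzero_in X zero_objD(1)[OF Z] by blast
  have "is_epi C (hzero C X Z)" by (rule epiI[OF z]) (use zero_objD(3)[OF Z] in blast)
  then have "Q Z" unfolding Q_def using semisimple_obj.zero[OF Z] z by blast
  moreover have "\<forall>H. Q H \<longrightarrow> size (jh H) < Suc (size (jh X))"
    unfolding Q_def using jh_quotient size_mset_mono by (metis le_imp_less_Suc)
  ultimately obtain H where H: "Q H" and max: "\<And>H'. Q H' \<Longrightarrow> size (jh H') \<le> size (jh H)"
    using ex_has_greatest_nat[of Q Z "\<lambda>H. size (jh H)"] by blast
  obtain q where q: "q \<in> Hom C X H" "is_epi C q" using H unfolding Q_def by blast
  have ssH: "semisimple_obj C H" using H unfolding Q_def by blast
  have simple: "\<exists>h \<in> Hom C H S. p = h \<cdot> q" if p: "p \<in> Hom C X S" and S: "simple_obj C S" for p S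
  proof (rule ccontr)
    assume "\<not> ?thesis"
    then have nf: "\<nexists>h. h \<in> Hom C H S \<and> p = h \<cdot> q" by blast
    have HS: "H \<in> Obj C" "S \<in> Obj C" using HomD[OF q(1)] HomD[OF p] by blast+
    obtain P where P: "is_biproduct C H S P" using ex_biproduct[OF HS] by blast
    have QP: "Q P" unfolding Q_def
      using epi_to_biproduct[OF q(2,1) p S nf P] semisimple_obj.step[OF ssH S P] by blast
    obtain i v where "short_exact C i v" "i \<in> Hom C H P" "v \<in> Hom C P S"
      using P biproduct_short_exact[OF HS] unfolding is_biproduct_def by blast
    then have "jh P = jh H + jh S" using jh_short_exact by blast
    then show False using max[OF QP] jh_simple[OF S] by simp
  qed
  have "\<exists>h \<in> Hom C H Y. p = h \<cdot> q" if "semisimple_obj C Y" "p \<in> Hom C X Y" for p Y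
    using that
  proof (induction arbitrary: p rule: semisimple_obj.induct)
    case (zero Y)
    have "hzero C H Y \<cdot> q = p"
      using zero_cmp[OF q(1) zero_objD(1)[OF zero.hyps]] zero_objD(2)[OF zero.hyps zero.prems]
        by simp
    then show ?case using hzero_in HomD[OF q(1)] zero_objD(1)[OF zero.hyps] by blast
  next
    case (step Y S P)
    obtain i j u v where i: "i \<in> Hom C Y P" and j: "j \<in> Hom C S P" and u: "u \<in> Hom C P Y"
      and v: "v \<in> Hom C P S" and eq: "(i \<cdot> u) +\<^sub>h (j \<cdot> v) = idt C P"
      using step.hyps(3) unfolding is_biproduct_def by blast
    obtain a where a: "a \<in> Hom C H Y" "u \<cdot> p = a \<cdot> q" using step.IH cmp_in[OF step.prems u] by blast
    obtain b where b: "b \<in> Hom C H S" "v \<cdot> p = b \<cdot> q"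
      using simple[OF cmp_in[OF step.prems v] step.hyps(2)] by blast
    have iu: "i \<cdot> u \<in> Hom C P P" and jv: "j \<cdot> v \<in> Hom C P P" using cmp_in i j u v by blast+
    have ia: "i \<cdot> a \<in> Hom C H P" and jb: "j \<cdot> b \<in> Hom C H P" using cmp_in a b i j by blast+
    have "p = ((i \<cdot> u) +\<^sub>h (j \<cdot> v)) \<cdot> p" using eq idt_cmp[OF step.prems] by simp
    also have "\<dots> = i \<cdot> (a \<cdot> q) +\<^sub>h j \<cdot> (b \<cdot> q)"
      using cmp_add_left[OF step.prems iu jv] cmp_assoc[OF step.prems u i] cmp_assoc[OF step.prems
          v j] a b
      by simp
    also have "\<dots> = ((i \<cdot> a) +\<^sub>h (j \<cdot> b)) \<cdot> q"
      using cmp_add_left[OF q(1) ia jb] cmp_assoc[OF q(1) a(1) i] cmp_assoc[OF q(1) b(1) j] by simp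
    finally show ?case using hadd_in[OF ia jb] by blast
  qed
  then have "is_head C X H" unfolding is_head_def using ssH q by blast
  then show ?thesis by blast
qed

end

section \<open>Simple classes in the Grothendieck ring\<close>

context finite_length_mcat begin

abbreviation frags :: "('o \<Rightarrow>\<^sub>0 int) monoid" where
  "frags \<equiv> free_Abelian_group (Obj C)"

lemma K0_rels_generators:
  "{frag_of (Cod C f) - frag_of (Dom C f) - frag_of (Cod C g) | f g. short_exact C f g} \<subseteq> carrier frags"
proof clarify
  fix f g assume s: "short_exact C f g"
  have "Cod C f \<in> Obj C" "Dom C f \<in> Obj C" "Cod C g \<in> Obj C"
    using short_exactD(3,4)[OF s] HomD(4,5) by blast+
  then show "frag_of (Cod C f) - frag_of (Dom C f) - frag_of (Cod C g) \<in> carrier frags"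
    using keys_diff[of "frag_of (Cod C f) - frag_of (Dom C f)" "frag_of (Cod C g)"]
      keys_diff[of "frag_of (Cod C f)" "frag_of (Dom C f)"] by auto
qed

lemma K0_rels_subgroup: "subgroup (K0_rels C) frags"
  unfolding K0_rels_def
  by (rule group.generate_is_subgroup[OF group_free_Abelian_group K0_rels_generators])

lemma K0_rels_normal: "normal (K0_rels C) frags"
  using abelian_free_Abelian_group K0_rels_subgroup comm_group.normal_iff_subgroup by blast

text \<open>The composition factors as a formal sum, so that they extend to the free abelian group.\<close>

definition jh_frag :: "'o \<Rightarrow> 'o set \<Rightarrow>\<^sub>0 int" where
  "jh_frag X = (\<Sum>c\<in>#jh X. frag_of c)"

lemma lookup_jh_frag: "Poly_Mapping.lookup (jh_frag X) c = int (count (jh X) c)"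
proof -
  have "Poly_Mapping.lookup (\<Sum>c\<in>#L. frag_of c) c = int (count L c)" for L :: "'o set multiset"
    by (induction L) (auto simp: Poly_Mapping.lookup_add)
  then show ?thesis unfolding jh_frag_def .
qed

text \<open>Multiplicities are additive on short exact sequences, so their linear extension kills
  every defining relation and descends to the Grothendieck group. This separates the classes of
  nonisomorphic simple objects.\<close>

lemma frag_extend_jh_rels:
  assumes "a \<in> K0_rels C" shows "frag_extend jh_frag a = 0"
proof -
  have gen0: "frag_extend jh_frag h = 0"
      if h: "h \<in> {frag_of (Cod C f) - frag_of (Dom C f) - frag_of (Cod C g) | f g. short_exact C f g}" for h
  proof -
    obtain f g where s: "short_exact C f g"
        and h: "h = frag_of (Cod C f) - frag_of (Dom C f) - frag_of (Cod C g)"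
      using h by blast
    have "jh_frag (Cod C f) = jh_frag (Dom C f) + jh_frag (Cod C g)"
      using jh_short_exact[OF s short_exactD(3,4)[OF s]] by (simp add: jh_frag_def)
    then show ?thesis using h by (simp add: frag_extend_diff)
  qed
  show ?thesis using assms unfolding K0_rels_def
  proof (induction rule: generate.induct)
    case (inv h)
    then have "Poly_Mapping.keys h \<subseteq> Obj C"
      using subsetD[OF K0_rels_generators inv] by simp
    then show ?case using gen0[OF inv] by (simp add: frag_extend_minus)
  next
    case (eng h1 h2)
    then show ?case by (simp add: frag_extend_add)
  qed (use gen0 in auto)
qed

lemma coset_eq_imp_jh:
  assumes "Poly_Mapping.keys a \<subseteq> Obj C" "Poly_Mapping.keys b \<subseteq> Obj C"
    and eq: "K0_rels C #>\<^bsub>frags\<^esub> a = K0_rels C #>\<^bsub>frags\<^esub> b"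
  shows "frag_extend jh_frag a = frag_extend jh_frag b"
proof -
  have "a \<in> K0_rels C #>\<^bsub>frags\<^esub> b"
    using eq group.rcos_self[OF group_free_Abelian_group _ K0_rels_subgroup, of a] assms(1) by simp
  then obtain h where "h \<in> K0_rels C" "a = h + b" by (auto simp: r_coset_def)
  then show ?thesis using frag_extend_jh_rels by (simp add: frag_extend_add)
qed

lemma K0_class_short_exact:
  assumes s: "short_exact C f g"
  shows "K0_class C (Cod C f) = K0_rels C #>\<^bsub>frags\<^esub> (frag_of (Dom C f) + frag_of (Cod C g))"
proof -
  have obj: "Cod C f \<in> Obj C" "Dom C f \<in> Obj C" "Cod C g \<in> Obj C"
    using short_exactD(3,4)[OF s] HomD(4,5) by blast+
  have "frag_of (Cod C f) - frag_of (Dom C f) - frag_of (Cod C g) \<in> K0_rels C"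
    unfolding K0_rels_def using s by (blast intro: generate.incl)
  then have "frag_of (Cod C f) \<in> K0_rels C #>\<^bsub>frags\<^esub> (frag_of (Dom C f) + frag_of (Cod C g))"
    unfolding r_coset_def by (auto intro: bexI[rotated] simp: algebra_simps)
  moreover have "frag_of (Dom C f) + frag_of (Cod C g) \<in> carrier frags"
    using obj keys_add[of "frag_of (Dom C f)" "frag_of (Cod C g)"] by auto
  ultimately show ?thesis unfolding K0_class_def
    using group.repr_independence[OF group_free_Abelian_group _ _ K0_rels_subgroup] by metis
qed

end

section \<open>Classes of objects as elements of the ambient field\<close>

locale categorification = monoidal_abelian_mcat K C + finite_length_mcat K C
  for K :: "('k, 'r) ring_scheme" and C :: "('o, 'a, 'k, 'z) mon_cat_scheme" (structure) +
  fixes \<phi> :: "('o \<Rightarrow>\<^sub>0 int) set \<Rightarrow> 'f::field_char_0"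
  assumes K0_ring: "ring (K0 C)"
    and \<phi>_inj: "inj_on \<phi> (carrier (K0 C))"
    and \<phi>_add: "\<lbrakk>x \<in> carrier (K0 C); y \<in> carrier (K0 C)\<rbrakk> \<Longrightarrow> \<phi> (x \<oplus>\<^bsub>K0 C\<^esub> y) = \<phi> x + \<phi> y"
    and \<phi>_mult: "\<lbrakk>x \<in> carrier (K0 C); y \<in> carrier (K0 C)\<rbrakk> \<Longrightarrow> \<phi> (x \<otimes>\<^bsub>K0 C\<^esub> y) = \<phi> x * \<phi> y"
begin

definition val :: "'o \<Rightarrow> 'f" where
  "val X = \<phi> (K0_class C X)"

definition frag_val :: "('o \<Rightarrow>\<^sub>0 int) \<Rightarrow> 'f" where
  "frag_val a = \<phi> (K0_rels C #>\<^bsub>frags\<^esub> a)"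

lemma carrier_K0: "carrier (K0 C) = rcosets\<^bsub>frags\<^esub> (K0_rels C)"
  by (simp add: K0_def Let_def FactGroup_def)

lemma coset_in_K0: "Poly_Mapping.keys a \<subseteq> Obj C \<Longrightarrow> K0_rels C #>\<^bsub>frags\<^esub> a \<in> carrier (K0 C)"
  unfolding carrier_K0 RCOSETS_def by auto

lemma frag_val_add:
  assumes "Poly_Mapping.keys a \<subseteq> Obj C" "Poly_Mapping.keys b \<subseteq> Obj C"
  shows "frag_val (a + b) = frag_val a + frag_val b"
proof -
  have "(K0_rels C #>\<^bsub>frags\<^esub> a) \<oplus>\<^bsub>K0 C\<^esub> (K0_rels C #>\<^bsub>frags\<^esub> b) = K0_rels C #>\<^bsub>frags\<^esub> (a + b)"
    using normal.rcos_sum[OF K0_rels_normal, of a b] assms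
      by (simp add: K0_def Let_def FactGroup_def)
  then show ?thesis using \<phi>_add[OF coset_in_K0 coset_in_K0] assms unfolding frag_val_def by metis
qed

lemma frag_val_cmul:
  assumes a: "Poly_Mapping.keys a \<subseteq> Obj C" shows "frag_val (frag_cmul k a) = of_int k * frag_val a"
proof -
  have k: "Poly_Mapping.keys (frag_cmul j a) \<subseteq> Obj C" for j using a keys_cmul by blast
  have 0: "frag_val 0 = 0" using frag_val_add[of 0 0] by simp
  have nat: "frag_val (frag_cmul (int j) a) = of_nat j * frag_val a" for j
  proof (induction j)
    case (Suc j)
    then show ?case
      using frag_val_add[OF k a, of "int j"] frag_cmul_distrib[of "int j" 1 a]
        by (simp add: algebra_simps)
  qed (simp add: 0)
  show ?thesis
  proof (cases k)
    case (nonneg j)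
    then show ?thesis using nat by simp
  next
    case (neg j)
    have "frag_val (frag_cmul k a) + frag_val (frag_cmul (int (Suc j)) a) = frag_val 0"
      using frag_val_add[OF k k, of k "int (Suc j)"] frag_cmul_distrib[of k "int (Suc j)" a] neg
        by simp
    then have "frag_val (frag_cmul k a) = - (of_nat (Suc j) * frag_val a)"
      by (simp only: nat 0 eq_neg_iff_add_eq_0)
    then show ?thesis unfolding neg by (simp add: algebra_simps)
  qed
qed

lemma frag_val_sum:
  assumes "finite I" "\<And>v. v \<in> I \<Longrightarrow> S v \<in> Obj C"
  shows "Poly_Mapping.keys (\<Sum>v\<in>I. frag_cmul (c v) (frag_of (S v))) \<subseteq> Obj C \<and>
    frag_val (\<Sum>v\<in>I. frag_cmul (c v) (frag_of (S v))) = (\<Sum>v\<in>I. of_int (c v) * val (S v))"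
  using assms
proof (induction I)
  case empty
  then show ?case using frag_val_add[of 0 0] by simp
next
  case (insert v I)
  have Sv: "Poly_Mapping.keys (frag_of (S v)) \<subseteq> Obj C" using insert.prems by simp
  have kv: "Poly_Mapping.keys (frag_cmul (c v) (frag_of (S v))) \<subseteq> Obj C"
    using Sv keys_cmul by blast
  have k: "Poly_Mapping.keys (\<Sum>v\<in>I. frag_cmul (c v) (frag_of (S v))) \<subseteq> Obj C"
    and e: "frag_val (\<Sum>v\<in>I. frag_cmul (c v) (frag_of (S v))) = (\<Sum>v\<in>I. of_int (c v) * val (S v))"
    using insert by auto
  show ?case
  proof
    show "frag_val (\<Sum>v\<in>insert v I. frag_cmul (c v) (frag_of (S v)))
        = (\<Sum>v\<in>insert v I. of_int (c v) * val (S v))"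
      using insert.hyps e frag_val_add[OF kv k] frag_val_cmul[OF Sv]
        by (simp add: val_def frag_val_def K0_class_def)
    show "Poly_Mapping.keys (\<Sum>v\<in>insert v I. frag_cmul (c v) (frag_of (S v))) \<subseteq> Obj C"
      unfolding sum.insert[OF insert.hyps]
      using kv k keys_add[of "frag_cmul (c v) (frag_of (S v))"
          "\<Sum>v\<in>I. frag_cmul (c v) (frag_of (S v))"]
      by blast
  qed
qed

lemma val_short_exact:
  assumes "short_exact C f g" "f \<in> Hom C A X" "g \<in> Hom C X Y" shows "val X = val A + val Y"
proof -
  have "val X = frag_val (frag_of A + frag_of Y)"
    using K0_class_short_exact[OF assms(1)] HomD[OF assms(2)] HomD[OF assms(3)]
    unfolding val_def frag_val_def by simp
  then show ?thesis using frag_val_add[of "frag_of A"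
      "frag_of Y"] HomD[OF assms(2)] HomD[OF assms(3)]
    by (simp add: val_def frag_val_def K0_class_def)
qed

text \<open>The trivial sequence with middle term \<open>X\<close> and its transport to the middle
  term \<open>Y\<close> have the same ends.\<close>

lemma val_iso:
  assumes "iso_objs C X Y" shows "val X = val Y"
proof -
  obtain u v where u: "u \<in> Hom C X Y" "v \<in> Hom C Y X" "v \<cdot> u = idt C X" "u \<cdot> v = idt C Y"
    using assms iso_objsE by blast
  obtain Z where Z: "is_zero_obj C Z" using ex_zero by blast
  have X: "X \<in> Obj C" using HomD[OF u(1)] by blast
  have z: "hzero C Z X \<in> Hom C Z X" using hzero_in X zero_objD(1)[OF Z] by blast
  note se = short_exact_id[OF X Z]
  note d = HomD(2,3)[OF z] HomD(2,3)[OF idt_in[OF X]]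
  show ?thesis
    using val_short_exact[OF se z idt_in[OF X]] val_short_exact[OF short_exact_iso[OF se, unfolded
        d, OF u]]
    by simp
qed

text \<open>The product in \<open>K0\<close> is a union of cosets. The ring axioms make it a single
  coset \<open>?U\<close>, and it contains \<open>frag_of (X \<boxtimes> Y)\<close>, so it is the
  class of the tensor product.\<close>

lemma val_tensor:
  assumes X: "X \<in> Obj C" and Y: "Y \<in> Obj C" shows "val (X \<boxtimes> Y) = val X * val Y"
proof -
  let ?H = "K0_rels C"
  let ?U = "K0_class C X \<otimes>\<^bsub>K0 C\<^esub> K0_class C Y"
  have XY: "K0_class C X \<in> carrier (K0 C)" "K0_class C Y \<in> carrier (K0 C)"
    using coset_in_K0[of "frag_of X"] coset_in_K0[of "frag_of Y"] X Y unfolding K0_class_def by auto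
  then have "?U \<in> carrier (K0 C)" using K0_ring by (simp add: ring.ring_simprules)
  then obtain u where u: "u \<in> carrier frags" "?U = ?H #>\<^bsub>frags\<^esub> u"
    unfolding carrier_K0 RCOSETS_def by auto
  have self: "frag_of (X \<boxtimes> Y) \<in> ?H #>\<^bsub>frags\<^esub> frag_tens C (frag_of X) (frag_of Y)"
    using group.rcos_self[OF group_free_Abelian_group _ K0_rels_subgroup] tens_in[OF X Y]
    by (simp add: frag_tens_def)
  have "frag_of X \<in> K0_class C X" "frag_of Y \<in> K0_class C Y"
    unfolding K0_class_def
    using group.rcos_self[OF group_free_Abelian_group _ K0_rels_subgroup] X Y by simp_all
  with self have "frag_of (X \<boxtimes> Y)
      \<in> (\<Union>a\<in>K0_class C X. \<Union>b\<in>K0_class C Y. ?H #>\<^bsub>frags\<^esub> frag_tens C a b)"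
    by (intro UN_I)
  then have "frag_of (X \<boxtimes> Y) \<in> ?U" by (simp add: K0_def Let_def)
  then have "K0_class C (X \<boxtimes> Y) = ?U"
    using group.repr_independence[OF group_free_Abelian_group _ u(1) K0_rels_subgroup] u(2)
    unfolding K0_class_def by metis
  then show ?thesis using \<phi>_mult[OF XY] unfolding val_def by simp
qed

text \<open>Injectivity of \<open>\<phi>\<close> turns an identity in the field into one in the
  Grothendieck group, where multiplicities can be read off. Isomorphic members \<open>S v\<close>
  pool their coefficients.\<close>

lemma jh_of_val:
  assumes X: "X \<in> Obj C" and I: "finite I" and S: "\<And>v. v \<in> I \<Longrightarrow> simple_obj C (S v)"
    and eq: "val X = (\<Sum>v\<in>I. of_int (c v) * val (S v))"
  shows "int (count (jh X) L) = (\<Sum>v\<in>I. if obj_class C (S v) = L then c v else 0)"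
proof -
  let ?a = "\<Sum>v\<in>I. frag_cmul (c v) (frag_of (S v))"
  have SO: "\<And>v. v \<in> I \<Longrightarrow> S v \<in> Obj C" using S simple_in_Obj by blast
  have k: "Poly_Mapping.keys ?a \<subseteq> Obj C" using frag_val_sum[OF I, of S c] SO by blast
  have "\<phi> (K0_rels C #>\<^bsub>frags\<^esub> frag_of X) = \<phi> (K0_rels C #>\<^bsub>frags\<^esub> ?a)"
    using eq frag_val_sum[OF I, of S c] SO by (simp add: val_def frag_val_def K0_class_def)
  then have "K0_rels C #>\<^bsub>frags\<^esub> frag_of X = K0_rels C #>\<^bsub>frags\<^esub> ?a"
    using inj_onD[OF \<phi>_inj] coset_in_K0[OF k] coset_in_K0[of "frag_of X"] X by simp
  then have "jh_frag X = frag_extend jh_frag ?a" using coset_eq_imp_jh[OF _ k, of "frag_of X"] X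
    by simp
  also have "\<dots> = (\<Sum>v\<in>I. frag_cmul (c v) (jh_frag (S v)))"
    by (simp add: frag_extend_sum[OF I] frag_extend_cmul)
  finally have "Poly_Mapping.lookup (jh_frag X) L
      = (\<Sum>v\<in>I. Poly_Mapping.lookup (frag_cmul (c v) (jh_frag (S v))) L)"
    by (simp add: Poly_Mapping.lookup_sum)
  then show ?thesis
    unfolding lookup_frag_cmul lookup_jh_frag using jh_simple[OF S] by (auto intro!: sum.cong)
qed

text \<open>With a one-term sum, \<open>X\<close> has \<open>S\<close> as its only composition
  factor. Simplicity of tensor products of cluster objects is detected in this way.\<close>

lemma val_simple_imp_iso:
  assumes X: "X \<in> Obj C" and S: "simple_obj C S" and eq: "val X = val S"
  shows "iso_objs C X S" "simple_obj C X"
proof -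
  have "int (count (jh X) L) = (if obj_class C S = L then 1 else 0)" for L
    using jh_of_val[OF X, of "{()}" "\<lambda>_. S" "\<lambda>_. 1" L] S eq by simp
  then have "jh X = {#obj_class C S#}"
    by (intro multiset_eqI) (metis count_single of_nat_0 of_nat_1 of_nat_eq_iff)
  then show "iso_objs C X S" using jh_singleton_imp_iso[OF X S] by blast
  then show "simple_obj C X" using simple_iso[OF S] iso_objs_sym by blast
qed

lemma class_eq_imp_val_eq:
  assumes "simple_obj C T" "obj_class C S = obj_class C T" shows "val S = val T"
  using assms obj_class_eq_iff[OF simple_in_Obj] val_iso by blast

text \<open>Distinct values make the \<open>S v\<close> pairwise nonisomorphic, so
  \<open>c v\<close> by itself is a multiplicity.\<close>

lemma coeff_nonneg:
  assumes X: "X \<in> Obj C" and I: "finite I" and S: "\<And>v. v \<in> I \<Longrightarrow> simple_obj C (S v)"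
    and eq: "val X = (\<Sum>v\<in>I. of_int (c v) * val (S v))"
    and inj: "inj_on (\<lambda>v. val (S v)) I" and v: "v \<in> I"
  shows "0 \<le> c v"
proof -
  have "(\<Sum>w\<in>I. if obj_class C (S w) = obj_class C (S v) then c w else 0) = (\<Sum>w\<in>I. if w
      = v then c w else 0)"
    using class_eq_imp_val_eq[OF S] inj v by (intro sum.cong) (auto dest: inj_onD)
  also have "\<dots> = c v" using I v by simp
  finally show ?thesis using jh_of_val[OF X I S eq] by (metis of_nat_0_le_iff)
qed

text \<open>Positive coefficients cannot cancel among isomorphic members, so each class occurs with
  positive multiplicity.\<close>

lemma composition_factor_subquotient:
  assumes X: "X \<in> Obj C" and I: "finite I" and S: "\<And>v. v \<in> I \<Longrightarrow> simple_obj C (S v)"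
    and eq: "val X = (\<Sum>v\<in>I. of_int (c v) * val (S v))"
    and pos: "\<And>v. v \<in> I \<Longrightarrow> 0 < c v" and v: "v \<in> I"
  shows "\<exists>T. subquotient C T X \<and> simple_obj C T \<and> iso_objs C T (S v)"
proof -
  have "0 < (\<Sum>w\<in>I. if obj_class C (S w) = obj_class C (S v) then c w else 0)"
    using pos v by (intro sum_pos2[OF I v]) (auto intro: less_imp_le)
  then have "0 < int (count (jh X) (obj_class C (S v)))" using jh_of_val[OF X I S eq] by simp
  then have "obj_class C (S v) \<in># jh X" by simp
  then obtain T where "subquotient C T X" "simple_obj C T" "obj_class C (S v) = obj_class C T"
    using in_jh_imp_subquotient[OF X] by blast
  then show ?thesis using obj_class_eq_iff[OF simple_in_Obj] iso_objs_sym by blast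
qed

text \<open>The expansion accounts for all multiplicities: a simple quotient isomorphic to no
  \<open>S v\<close> would have multiplicity zero.\<close>

lemma simple_quotient_factor:
  assumes X: "X \<in> Obj C" and I: "finite I" and S: "\<And>v. v \<in> I \<Longrightarrow> simple_obj C (S v)"
    and eq: "val X = (\<Sum>v\<in>I. of_int (c v) * val (S v))"
    and T: "simple_obj C T" "is_epi C p" "p \<in> Hom C X T"
  shows "\<exists>v \<in> I. iso_objs C T (S v)"
proof -
  have "0 < int (count (jh X) (obj_class C T))" using simple_quotient_in_jh[OF T(2,3,1)] by simp
  then have nz: "(\<Sum>w\<in>I. if obj_class C (S w) = obj_class C T then c w else 0) \<noteq> 0"
    using jh_of_val[OF X I S eq] by simp
  have "\<exists>w \<in> I. obj_class C (S w) = obj_class C T"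
  proof (rule ccontr)
    assume "\<not> ?thesis"
    then have "(\<Sum>w\<in>I. if obj_class C (S w) = obj_class C T then c w else 0) = 0"
      by (intro sum.neutral) auto
    then show False using nz by simp
  qed
  then obtain w where w: "w \<in> I" "obj_class C (S w) = obj_class C T" by blast
  have "iso_objs C (S w) T" using obj_class_eq_iff[OF simple_in_Obj[OF T(1)]] w(2) by simp
  then show ?thesis using iso_objs_sym w(1) by blast
qed

end

section \<open>Monomials in a free generating set\<close>

text \<open>Vanishing from \<open>m\<close> on makes an exponent function determined by its monomial
  and gives it finite support.\<close>

definition exponents :: "nat \<Rightarrow> (nat \<Rightarrow> nat) set" where
  "exponents m = {e. \<forall>i\<ge>m. e i = 0}"

definition monomial :: "nat \<Rightarrow> 'f::field vec \<Rightarrow> (nat \<Rightarrow> nat) \<Rightarrow> 'f" where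
  "monomial m x e = (\<Prod>i<m. x $ i ^ e i)"

lemma monomial_add: "monomial m x (\<lambda>i. a i + b i) = monomial m x a * monomial m x b"
  by (simp add: monomial_def power_add prod.distrib)

lemma lookup_Abs_exponents:
  assumes "e \<in> exponents m" shows "Poly_Mapping.lookup (Abs_poly_mapping e) = e"
proof -
  have "{i. e i \<noteq> 0} \<subseteq> {..<m}" using assms by (auto simp: exponents_def not_less[symmetric])
  then have "finite {i. e i \<noteq> 0}" using finite_subset by blast
  then show ?thesis by (simp only: Abs_poly_mapping_inverse mem_Collect_eq)
qed

text \<open>Freeness is stated for polynomials encoded as \<open>poly_mapping\<close> over the
  rationals; the combination is rewritten as such a polynomial \<open>p\<close>, whose coefficients
  are the \<open>c e\<close> because the encoding of exponents is injective.\<close>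

lemma monomials_independent:
  assumes x: "free_generating m x" and E: "finite E" "E \<subseteq> exponents m"
    and 0: "(\<Sum>e\<in>E. of_int (c e) * monomial m x e) = 0" and e: "e \<in> E"
  shows "c e = 0"
proof -
  let ?a = "Abs_poly_mapping :: (nat \<Rightarrow> nat) \<Rightarrow> nat \<Rightarrow>\<^sub>0 nat"
  define p :: "(nat \<Rightarrow>\<^sub>0 nat) \<Rightarrow>\<^sub>0 rat" where
    "p = (\<Sum>e\<in>E. Poly_Mapping.single (?a e) (of_int (c e)))"
  have lk: "Poly_Mapping.lookup (?a e) = e" if "e \<in> E" for e
    using lookup_Abs_exponents E(2) that by blast
  have inj: "inj_on ?a E" by (rule inj_on_inverseI[of _ Poly_Mapping.lookup]) (rule lk)
  have lp: "Poly_Mapping.lookup p (?a e) = of_int (c e)" if e: "e \<in> E" for e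
  proof -
    have "Poly_Mapping.lookup p (?a e) = (\<Sum>e'\<in>E. if e' = e then of_int (c e') else 0)"
      unfolding p_def Poly_Mapping.lookup_sum lookup_single
      by (intro sum.cong refl) (simp add: when_def inj_on_eq_iff[OF inj _ e])
    then show ?thesis using E(1) e by simp
  qed
  have kp: "Poly_Mapping.keys p \<subseteq> ?a ` E"
  proof
    fix a assume a: "a \<in> Poly_Mapping.keys p"
    show "a \<in> ?a ` E"
    proof (rule ccontr)
      assume "a \<notin> ?a ` E"
      then have "Poly_Mapping.lookup p a = 0"
        unfolding p_def Poly_Mapping.lookup_sum lookup_single
          by (intro sum.neutral) (auto simp: when_def)
      then show False using a by (simp add: in_keys_iff)
    qed
  qed
  have ka: "Poly_Mapping.keys (?a e) \<subseteq> {..<m}" if "e \<in> E" for e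
  proof
    fix i assume "i \<in> Poly_Mapping.keys (?a e)"
    then have "e i \<noteq> 0" using lk[OF that] by (simp add: in_keys_iff)
    moreover have "e \<in> exponents m" using E(2) that by (rule subsetD)
    ultimately show "i \<in> {..<m}" unfolding exponents_def by (cases "i < m") simp_all
  qed
  have "mpoly_in m p" unfolding mpoly_in_def
  proof
    fix a assume "a \<in> Poly_Mapping.keys p"
    then have "a \<in> ?a ` E" using kp by (rule subsetD[rotated])
    then show "Poly_Mapping.keys a \<subseteq> {..<m}" using ka by (elim imageE) simp
  qed
  moreover have "mpoly_eval of_rat (($) x) p = 0"
  proof -
    have "mpoly_eval of_rat (($) x) p = (\<Sum>a\<in>?a ` E. of_rat (Poly_Mapping.lookup p a) *
        (\<Prod>i \<in> Poly_Mapping.keys a. x $ i ^ Poly_Mapping.lookup a i))"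
      unfolding mpoly_eval_def using kp E(1)
        by (intro sum.mono_neutral_left) (auto simp: in_keys_iff)
    also have "\<dots> = (\<Sum>e\<in>E. of_rat (Poly_Mapping.lookup p (?a e)) *
        (\<Prod>i \<in> Poly_Mapping.keys (?a e). x $ i ^ Poly_Mapping.lookup (?a e) i))"
      by (simp add: sum.reindex[OF inj])
    also have "\<dots> = (\<Sum>e\<in>E. of_int (c e) * monomial m x e)"
    proof (intro sum.cong refl)
      fix e assume e: "e \<in> E"
      have "(\<Prod>i \<in> Poly_Mapping.keys (?a e). x $ i ^ e i) = monomial m x e"
        unfolding monomial_def using ka[OF e] lk[OF e]
        by (intro prod.mono_neutral_left) (auto simp: in_keys_iff)
      then show "of_rat (Poly_Mapping.lookup p (?a e)) *
          (\<Prod>i \<in> Poly_Mapping.keys (?a e). x $ i ^ Poly_Mapping.lookup (?a e) i)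
          = of_int (c e) * monomial m x e"
        using lk[OF e] lp[OF e] by simp
    qed
    finally show ?thesis using 0 by simp
  qed
  ultimately have "p = 0" using x unfolding free_generating_def by blast
  then show ?thesis using lp[OF e] by simp
qed

lemma monomial_inj:
  assumes x: "free_generating m x" and "a \<in> exponents m" "b \<in> exponents m"
    and eq: "monomial m x a = monomial m x b"
  shows "a = b"
proof (rule ccontr)
  assume "a \<noteq> b"
  then have "(\<Sum>e\<in>{a, b}. of_int (if e = a then 1 else -1) * monomial m x e) = 0" using eq by simp
  from monomials_independent[OF x _ _ this, of a] assms(2,3) show False by simp
qed

lemma free_generating_nonzero:
  assumes x: "free_generating m x" and i: "i < m" shows "x $ i \<noteq> 0"
proof
  assume 0: "x $ i = 0"
  have "monomial m x (\<lambda>j. if j = i then 1 else 0) = 0"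
    unfolding monomial_def using i 0 by (intro prod_zero) auto
  then have "(\<Sum>e\<in>{\<lambda>j. if j = i then 1 else 0}. of_int ((\<lambda>_. 1) e) * monomial m x e) = 0" by simp
  from monomials_independent[OF x _ _ this, of "\<lambda>j. if j = i then 1 else 0"] i show False
    by (auto simp: exponents_def)
qed

section \<open>Tropical evaluation of subtraction-free elements\<close>

text \<open>
  Polynomials with coefficients in the natural numbers are multisets of exponents.
\<close>

definition pos_poly :: "nat \<Rightarrow> 'f::field vec \<Rightarrow> (nat \<Rightarrow> nat) multiset \<Rightarrow> 'f" where
  "pos_poly m x A = (\<Sum>a\<in>#A. monomial m x a)"

definition poly_times :: "(nat \<Rightarrow> nat) multiset \<Rightarrow> (nat \<Rightarrow> nat) multiset \<Rightarrow> (nat \<Rightarrow> nat) multiset" where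
  "poly_times A B = (\<Sum>a\<in>#A. image_mset (\<lambda>b i. a i + b i) B)"

definition weight :: "nat \<Rightarrow> (nat \<Rightarrow> int) \<Rightarrow> (nat \<Rightarrow> nat) \<Rightarrow> int" where
  "weight m w a = (\<Sum>i<m. w i * int (a i))"

text \<open>The support function of the Newton polytope in direction \<open>w\<close>. The maximum
  is meaningful for nonempty multisets only.\<close>

definition trop :: "nat \<Rightarrow> (nat \<Rightarrow> int) \<Rightarrow> (nat \<Rightarrow> nat) multiset \<Rightarrow> int" where
  "trop m w A = Max (weight m w ` set_mset A)"

lemma pos_poly_union: "pos_poly m x (A + B) = pos_poly m x A + pos_poly m x B"
  by (simp add: pos_poly_def)

lemma pos_poly_times: "pos_poly m x (poly_times A B) = pos_poly m x A * pos_poly m x B"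
proof -
  have "pos_poly m x (image_mset (\<lambda>b i. a i + b i) B) = monomial m x a * pos_poly m x B" for a
    by (simp add: pos_poly_def monomial_add sum_mset_distrib_left image_mset.compositionality
        comp_def)
  then show ?thesis
    unfolding poly_times_def by (induction A) (auto simp: pos_poly_def algebra_simps)
qed

lemma set_poly_times: "set_mset (poly_times A B) = (\<Union>a\<in>set_mset A. (\<lambda>b i. a i + b i) ` set_mset B)"
  unfolding poly_times_def by (induction A) auto

lemma trop_union:
  assumes "A \<noteq> {#}" "B \<noteq> {#}" shows "trop m w (A + B) = max (trop m w A) (trop m w B)"
  unfolding trop_def using assms by (simp add: image_Un Max_Un)

text \<open>All coefficients are positive, so the product of two terms of maximal weight survives in
  the product.\<close>

lemma trop_times:
  assumes "A \<noteq> {#}" "B \<noteq> {#}" shows "trop m w (poly_times A B) = trop m w A + trop m w B"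
proof -
  have add: "weight m w (\<lambda>i. a i + b i) = weight m w a + weight m w b" for a b
    by (simp add: weight_def algebra_simps sum.distrib)
  have fin: "finite (weight m w ` set_mset D)" for D by simp
  have ne: "weight m w ` set_mset A \<noteq> {}" "weight m w ` set_mset B \<noteq> {}" using assms by auto
  obtain a b where a: "a \<in># A" "trop m w A = weight m w a"
      and b: "b \<in># B" "trop m w B = weight m w b"
    using Max_in[OF fin ne(1)] Max_in[OF fin ne(2)] unfolding trop_def by auto
  show ?thesis unfolding trop_def[of m w "poly_times A B"]
  proof (rule Max_eqI)
    show "finite (weight m w ` set_mset (poly_times A B))" by simp
    show "trop m w A + trop m w B \<in> weight m w ` set_mset (poly_times A B)"
      
    proof (rule image_eqI)
      show "trop m w A + trop m w B = weight m w (\<lambda>i. a i + b i)" using a b add by simp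
      show "(\<lambda>i. a i + b i) \<in> set_mset (poly_times A B)" unfolding set_poly_times using a b by blast
    qed
    fix y assume "y \<in> weight m w ` set_mset (poly_times A B)"
    then obtain a' b' where "a' \<in># A" "b' \<in># B" "y = weight m w a' + weight m w b'"
      unfolding set_poly_times using add by auto
    then show "y \<le> trop m w A + trop m w B" unfolding trop_def by (simp add: add_mono)
  qed
qed

definition valid_poly :: "nat \<Rightarrow> (nat \<Rightarrow> nat) multiset \<Rightarrow> bool" where
  "valid_poly m A \<longleftrightarrow> A \<noteq> {#} \<and> set_mset A \<subseteq> exponents m"

lemma valid_poly_union: "valid_poly m A \<Longrightarrow> valid_poly m B \<Longrightarrow> valid_poly m (A + B)"
  by (auto simp: valid_poly_def)

lemma valid_poly_times:
  assumes "valid_poly m A" "valid_poly m B" shows "valid_poly m (poly_times A B)"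
proof -
  have "set_mset (poly_times A B) \<noteq> {}" "set_mset (poly_times A B) \<subseteq> exponents m"
    using assms unfolding set_poly_times valid_poly_def exponents_def by auto
  then show ?thesis by (auto simp: valid_poly_def)
qed

lemma pos_poly_count:
  assumes "finite E" "set_mset A \<subseteq> E"
  shows "pos_poly m x A = (\<Sum>e\<in>E. of_int (int (count A e)) * monomial m x e)"
proof -
  have "(\<Sum>e\<in>E. of_nat (count A e) * monomial m x e) = pos_poly m x A"
    using assms(2)
  proof (induction A)
    case (add a A)
    have "(\<Sum>e\<in>E. of_nat (count (add_mset a A) e) * monomial m x e)
        = (\<Sum>e\<in>E. of_nat (count A e) * monomial m x e) + (\<Sum>e\<in>E. if e = a then monomial m x e else 0)"
      unfolding sum.distrib[symmetric] by (intro sum.cong) (auto simp: algebra_simps)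
    then show ?case using add assms(1) by (simp add: pos_poly_def)
  qed (simp add: pos_poly_def)
  then show ?thesis by simp
qed

text \<open>Turns equality of field elements into equality of formal polynomials, so that functions
  of the formal polynomial, such as \<open>trop\<close>, become functions of the value.\<close>

lemma pos_poly_inj:
  assumes x: "free_generating m x" and "set_mset A \<subseteq> exponents m" "set_mset B \<subseteq> exponents m"
    and eq: "pos_poly m x A = pos_poly m x B"
  shows "A = B"
proof (rule multiset_eqI)
  fix e
  let ?E = "set_mset A \<union> set_mset B"
  have "(\<Sum>e\<in>?E. of_int (int (count A e) - int (count B e)) * monomial m x e) = 0"
    using eq pos_poly_count[of ?E A m x] pos_poly_count[of ?E B m x]
    by (simp add: left_diff_distrib sum_subtractf)
  from monomials_independent[OF x _ _ this, of e] assms(2,3)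
  have "e \<in> ?E \<Longrightarrow> count A e = count B e" by simp
  then show "count A e = count B e" by (cases "e \<in> ?E") (auto simp: not_in_iff)
qed

lemma pos_poly_nonzero:
  assumes "free_generating m x" "valid_poly m A" shows "pos_poly m x A \<noteq> 0"
  using pos_poly_inj[OF assms(1), of A "{#}"] assms(2) by (auto simp: valid_poly_def pos_poly_def)

lemma pos_poly_gen:
  assumes "i < m" shows "pos_poly m x {#\<lambda>j. if j = i then 1 else 0#} = x $ i"
proof -
  have "(\<Prod>j<m. x $ j ^ (if j = i then 1 else 0)) = (\<Prod>j<m. if j = i then x $ j else 1)"
    by (intro prod.cong) auto
  then show ?thesis using assms by (simp add: pos_poly_def monomial_def)
qed

lemma subtraction_free_quotient:
  assumes x: "free_generating m x" and z: "z \<in> subtraction_free {x $ i | i. i < m}"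
  shows "\<exists>A B. valid_poly m A \<and> valid_poly m B \<and> z = pos_poly m x A / pos_poly m x B"
  using z
proof induction
  case (gen z)
  then obtain i where i: "i < m" "z = x $ i" by blast
  show ?case
  proof (rule exI, rule exI, intro conjI)
    \<comment> \<open>The singleton of the zero exponent is the denominator 1.\<close>
    show "valid_poly m {#\<lambda>j. if j = i then 1 else 0#}" "valid_poly m {#\<lambda>j. 0#}"
      using i by (auto simp: valid_poly_def exponents_def)
    show "z = pos_poly m x {#\<lambda>j. if j = i then 1 else 0#} / pos_poly m x {#\<lambda>j. 0#}"
      using pos_poly_gen[OF i(1), of x] i(2) by (simp add: pos_poly_def monomial_def)
  qed
next
  case (add a b)
  obtain A B where g: "valid_poly m A" "valid_poly m B" and a: "a = pos_poly m x A / pos_poly m x B"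
    using add.IH(1) by (elim exE conjE)
  obtain A' B' where g': "valid_poly m A'" "valid_poly m B'"
      and b: "b = pos_poly m x A' / pos_poly m x B'"
    using add.IH(2) by (elim exE conjE)
  show ?case
  proof (rule exI, rule exI, intro conjI)
    show "a + b = pos_poly m x (poly_times A B' + poly_times A' B) / pos_poly m x (poly_times B B')"
      using pos_poly_nonzero[OF x g(2)] pos_poly_nonzero[OF x g'(2)] a b
        by (simp add: pos_poly_times pos_poly_union add_frac_eq)
    show "valid_poly m (poly_times A B' + poly_times A' B)"
      using valid_poly_union valid_poly_times g g' by simp
    show "valid_poly m (poly_times B B')" using valid_poly_times g g' by simp
  qed
next
  case (mult a b)
  obtain A B where g: "valid_poly m A" "valid_poly m B" and a: "a = pos_poly m x A / pos_poly m x B"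
    using mult.IH(1) by (elim exE conjE)
  obtain A' B' where g': "valid_poly m A'" "valid_poly m B'"
      and b: "b = pos_poly m x A' / pos_poly m x B'"
    using mult.IH(2) by (elim exE conjE)
  show ?case
  proof (rule exI, rule exI, intro conjI)
    show "a * b = pos_poly m x (poly_times A A') / pos_poly m x (poly_times B B')"
      using a b by (simp add: pos_poly_times pos_poly_union add_frac_eq)
    show "valid_poly m (poly_times A A')" using valid_poly_times g g' by simp
    show "valid_poly m (poly_times B B')" using valid_poly_times g g' by simp
  qed
next
  case (divide a b)
  obtain A B where g: "valid_poly m A" "valid_poly m B" and a: "a = pos_poly m x A / pos_poly m x B"
    using divide.IH(1) by (elim exE conjE)
  obtain A' B' where g': "valid_poly m A'" "valid_poly m B'"
      and b: "b = pos_poly m x A' / pos_poly m x B'"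
    using divide.IH(2) by (elim exE conjE)
  show ?case
  proof (rule exI, rule exI, intro conjI)
    show "a / b = pos_poly m x (poly_times A B') / pos_poly m x (poly_times B A')"
      using a b by (simp add: pos_poly_times pos_poly_union add_frac_eq)
    show "valid_poly m (poly_times A B')" using valid_poly_times g g' by simp
    show "valid_poly m (poly_times B A')" using valid_poly_times g g' by simp
  qed
qed

text \<open>The semifield homomorphism with prescribed values \<open>w\<close> on the generators:
  the tropical degree of a numerator minus that of a denominator.\<close>

definition trop_eval :: "nat \<Rightarrow> 'f::field_char_0 vec \<Rightarrow> (nat \<Rightarrow> int) \<Rightarrow> 'f \<Rightarrow> int" where
  "trop_eval m x w z = (THE k. \<exists>A B. valid_poly m A \<and> valid_poly m B \<and>
     z = pos_poly m x A / pos_poly m x B \<and> k = trop m w A - trop m w B)"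

text \<open>Cross-multiplying two representations of a fraction gives equal formal polynomials, and
  \<open>trop\<close> is additive on products; so the degree difference does not depend on the
  representation.\<close>

lemma trop_eval_quotient:
  assumes x: "free_generating m x" and A: "valid_poly m A" and B: "valid_poly m B"
  shows "trop_eval m x w (pos_poly m x A / pos_poly m x B) = trop m w A - trop m w B"
  unfolding trop_eval_def
proof (rule the_equality)
  show "\<exists>A' B'. valid_poly m A' \<and> valid_poly m B' \<and> pos_poly m x A / pos_poly m x B
      = pos_poly m x A' / pos_poly m x B' \<and> trop m w A - trop m w B = trop m w A' - trop m w B'"
    by (rule exI[of _ A], rule exI[of _ B]) (simp add: A B)
  fix k assume "\<exists>A' B'. valid_poly m A' \<and> valid_poly m B' \<and> pos_poly m x A / pos_poly m x B
      = pos_poly m x A' / pos_poly m x B' \<and> k = trop m w A' - trop m w B'"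
  then obtain A' B' where g: "valid_poly m A'" "valid_poly m B'"
    and eq: "pos_poly m x A / pos_poly m x B = pos_poly m x A' / pos_poly m x B'"
    and k: "k = trop m w A' - trop m w B'" by (elim exE conjE)
  have "pos_poly m x (poly_times A B') = pos_poly m x (poly_times A' B)"
    using eq pos_poly_nonzero[OF x] g A B by (simp add: pos_poly_times frac_eq_eq)
  moreover have "valid_poly m (poly_times A B')" "valid_poly m (poly_times A' B)"
    using valid_poly_times g A B by simp_all
  ultimately have "poly_times A B' = poly_times A' B"
    using pos_poly_inj[OF x] by (simp add: valid_poly_def)
  then have "trop m w (poly_times A B') = trop m w (poly_times A' B)" by simp
  then have "trop m w A + trop m w B' = trop m w A' + trop m w B"
    using trop_times g A B unfolding valid_poly_def by simp
  then show "k = trop m w A - trop m w B" using k by simp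
qed

lemma trop_eval_hom:
  assumes x: "free_generating m x"
  shows "semifield_hom (subtraction_free {x $ i | i. i < m}) (trop_eval m x w)"
  unfolding semifield_hom_def
proof (intro ballI)
  fix a b assume a: "a \<in> subtraction_free {x $ i | i. i < m}"
      and b: "b \<in> subtraction_free {x $ i | i. i < m}"
  obtain A B where g1: "valid_poly m A" "valid_poly m B"
      and a': "a = pos_poly m x A / pos_poly m x B"
    using subtraction_free_quotient[OF x a] by (elim exE conjE)
  obtain A' B' where g2: "valid_poly m A'" "valid_poly m B'"
      and b': "b = pos_poly m x A' / pos_poly m x B'"
    using subtraction_free_quotient[OF x b] by (elim exE conjE)
  note g = g1 g2 and ab = a' b'
  have ne: "A \<noteq> {#}" "B \<noteq> {#}" "A' \<noteq> {#}" "B' \<noteq> {#}"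
    "poly_times A B' \<noteq> {#}" "poly_times A' B \<noteq> {#}"
    using g valid_poly_times[OF g(1,4)] valid_poly_times[OF g(3,2)] by (auto simp: valid_poly_def)
  have v: "trop_eval m x w a = trop m w A - trop m w B"
      "trop_eval m x w b = trop m w A' - trop m w B'"
    using trop_eval_quotient[OF x] g ab by auto
  have "a * b = pos_poly m x (poly_times A A') / pos_poly m x (poly_times B B')"
    using ab by (simp add: pos_poly_times)
  then have m: "trop_eval m x w (a * b) = trop m w A + trop m w A' - (trop m w B + trop m w B')"
    using trop_eval_quotient[OF x valid_poly_times[OF g(1,3)] valid_poly_times[OF g(2,4)]]
        trop_times ne by simp
  have "a + b = pos_poly m x (poly_times A B' + poly_times A' B) / pos_poly m x (poly_times B B')"
    using ab g pos_poly_nonzero[OF x] by (simp add: pos_poly_times pos_poly_union add_frac_eq)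
  then have "trop_eval m x w (a + b)
      = max (trop m w A + trop m w B') (trop m w A' + trop m w B) - (trop m w B + trop m w B')"
    using trop_eval_quotient[OF x valid_poly_union[OF valid_poly_times[OF g(1,4)]
        valid_poly_times[OF g(3,2)]]
        valid_poly_times[OF g(2,4)]] trop_times ne trop_union by simp
  with m v show "trop_eval m x w (a * b) = trop_eval m x w a + trop_eval m x w b \<and>
      trop_eval m x w (a + b) = max (trop_eval m x w a) (trop_eval m x w b)"
    by (simp add: max_def)
qed

lemma trop_eval_gen:
  assumes x: "free_generating m x" and i: "i < m" shows "trop_eval m x w (x $ i) = w i"
proof -
  have g: "valid_poly m {#\<lambda>j. if j = i then 1 else 0#}" "valid_poly m {#\<lambda>j. 0#}"
    using i by (auto simp: valid_poly_def exponents_def)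
  have "pos_poly m x {#\<lambda>j. 0#} = 1" by (simp add: pos_poly_def monomial_def)
  moreover have "trop m w {#\<lambda>j. 0#} = 0" by (simp add: trop_def weight_def)
  moreover have "(\<Sum>j<m. w j * int (if j = i then 1 else 0)) = (\<Sum>j<m. if j = i then w j else 0)"
    by (intro sum.cong) auto
  then have "trop m w {#\<lambda>j. if j = i then 1 else 0#} = w i" using i
    by (simp add: trop_def weight_def)
  ultimately show ?thesis using trop_eval_quotient[OF x g, of w] pos_poly_gen[OF i, of x] by simp
qed

text \<open>A generator divided by itself puts 1 among the subtraction-free elements; this is where
  \<open>nonempty\<close> enters, and it opens the way to powers and empty products.\<close>

locale semifield_hom_on =
  fixes X :: "'f::field_char_0 set" and \<beta> :: "'f \<Rightarrow> int"
  assumes hom: "semifield_hom (subtraction_free X) \<beta>"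
      and nonzero: "\<And>z. z \<in> subtraction_free X \<Longrightarrow> z \<noteq> 0"
    and nonempty: "X \<noteq> {}"
begin

lemma hom_mult: "\<lbrakk>a \<in> subtraction_free X; b \<in> subtraction_free X\<rbrakk> \<Longrightarrow> \<beta> (a * b) = \<beta> a + \<beta> b"
  and hom_add: "\<lbrakk>a \<in> subtraction_free X; b \<in> subtraction_free X\<rbrakk> \<Longrightarrow> \<beta> (a + b) = max (\<beta> a) (\<beta> b)"
  using hom unfolding semifield_hom_def by auto

lemma one_in: "1 \<in> subtraction_free X"
proof -
  obtain z where z: "z \<in> X" using nonempty by blast
  then show ?thesis
    using subtraction_free.divide[OF subtraction_free.gen subtraction_free.gen, OF z z]
      nonzero[OF subtraction_free.gen[OF z]] by simp
qed

lemma hom_one: "\<beta> 1 = 0"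
  using hom_mult[OF one_in one_in] by simp

lemma hom_divide:
  assumes "a \<in> subtraction_free X" "b \<in> subtraction_free X" shows "\<beta> (a / b) = \<beta> a - \<beta> b"
  using hom_mult[OF subtraction_free.divide[OF assms] assms(2)] nonzero[OF assms(2)] by simp

lemma power_in: "a \<in> subtraction_free X \<Longrightarrow> a ^ k \<in> subtraction_free X"
  by (induction k) (auto intro: one_in subtraction_free.mult)

lemma hom_power: "a \<in> subtraction_free X \<Longrightarrow> \<beta> (a ^ k) = int k * \<beta> a"
  by (induction k) (auto simp: hom_one hom_mult power_in algebra_simps)

lemma hom_prod:
  assumes "finite I" "\<And>i. i \<in> I \<Longrightarrow> z i \<in> subtraction_free X"
  shows "(\<Prod>i\<in>I. z i) \<in> subtraction_free X \<and> \<beta> (\<Prod>i\<in>I. z i) = (\<Sum>i\<in>I. \<beta> (z i))"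
  using assms by (induction I) (auto simp: one_in hom_one hom_mult intro: subtraction_free.mult)

lemma hom_monomial:
  assumes "\<And>i. i < m \<Longrightarrow> x $ i \<in> subtraction_free X"
  shows "monomial m x e \<in> subtraction_free X \<and> \<beta> (monomial m x e) = (\<Sum>i<m. int (e i) * \<beta> (x $ i))"
  using hom_prod[of "{..<m}" "\<lambda>i. x $ i ^ e i"] assms by (simp add: monomial_def power_in hom_power)

text \<open>A positive multiple is a repeated sum, and \<open>max\<close> is idempotent.\<close>

lemma hom_pos_int:
  assumes a: "a \<in> subtraction_free X" and k: "0 < k"
  shows "of_int k * a \<in> subtraction_free X \<and> \<beta> (of_int k * a) = \<beta> a"
proof -
  have "of_nat (Suc j) * a \<in> subtraction_free X \<and> \<beta> (of_nat (Suc j) * a) = \<beta> a" for j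
  proof (induction j)
    case (Suc j)
    have "of_nat (Suc (Suc j)) * a = of_nat (Suc j) * a + a" by (simp add: algebra_simps)
    then show ?case using Suc a hom_add subtraction_free.add by auto
  qed (use a in simp)
  from this[of "nat k - 1"] k show ?thesis by simp
qed

lemma hom_sum:
  assumes "finite I" "I \<noteq> {}" "\<And>i. i \<in> I \<Longrightarrow> z i \<in> subtraction_free X" "\<And>i. i \<in> I \<Longrightarrow> 0 < c i"
  shows "(\<Sum>i\<in>I. of_int (c i) * z i) \<in> subtraction_free X \<and>
    \<beta> (\<Sum>i\<in>I. of_int (c i) * z i) = Max ((\<lambda>i. \<beta> (z i)) ` I)"
  using assms
proof (induction I rule: finite_ne_induct)
  case (singleton i)
  then show ?case using hom_pos_int by simp
next
  case (insert i I)
  then have "of_int (c i) * z i \<in> subtraction_free X \<and> \<beta> (of_int (c i) * z i) = \<beta> (z i)"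
    using hom_pos_int by simp
  with insert show ?case by (simp add: hom_add subtraction_free.add)
qed

end

section \<open>Mutation of compatible pairs\<close>

lemma mult_pos_part:
  fixes a x :: int
  shows "0 < a \<Longrightarrow> a * [x]\<^sub>+ = [a * x]\<^sub>+"
  using mult_le_cancel_left_pos[of a x 0] by (auto simp: max_def)

text \<open>Entrywise form of a compatible pair. The diagonal \<open>s\<close> is a parameter, so
  that mutation can be shown to preserve it.\<close>

locale compat =
  fixes m n :: nat and b l :: "nat \<Rightarrow> nat \<Rightarrow> int" and s :: "nat \<Rightarrow> int"
  assumes nm: "n \<le> m"
    and skew: "\<lbrakk>i < m; j < m\<rbrakk> \<Longrightarrow> l i j = - l j i"
    and comp: "\<lbrakk>j < n; i < m\<rbrakk> \<Longrightarrow> (\<Sum>p<m. b p j * l p i) = (if i = j then s j else 0)"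
    and pos: "j < n \<Longrightarrow> 0 < s j"
begin

lemma comp_right:
  assumes "j < n" "i < m" shows "(\<Sum>p<m. l i p * b p j) = (if i = j then - s j else 0)"
proof -
  have "(\<Sum>p<m. l i p * b p j) = - (\<Sum>p<m. b p j * l p i)"
    unfolding sum_negf[symmetric] using skew[OF assms(2)] by (intro sum.cong) auto
  then show ?thesis using comp[OF assms] by simp
qed

text \<open>Evaluate the triple product of \<open>b\<close> transposed, \<open>l\<close> and
  \<open>b\<close> with both bracketings: one gives \<open>s i * b i j\<close>, the other
  \<open>- (s j * b j i)\<close>.\<close>

lemma skew_symmetrizable:
  assumes i: "i < n" and j: "j < n" shows "s i * b i j = - (s j * b j i)"
proof -
  have im: "i < m" "j < m" using assms nm by auto
  have "(\<Sum>p<m. b p i * (\<Sum>q<m. l p q * b q j)) = (\<Sum>q<m. (\<Sum>p<m. b p i * l p q) * b q j)"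
    unfolding sum_distrib_left sum_distrib_right by (subst sum.swap) (simp add: algebra_simps)
  also have "\<dots> = (\<Sum>q<m. if q = i then s i * b q j else 0)"
    using comp[OF i] by (intro sum.cong) auto
  finally have "(\<Sum>p<m. b p i * (\<Sum>q<m. l p q * b q j)) = s i * b i j" using im by simp
  moreover have "(\<Sum>p<m. b p i * (\<Sum>q<m. l p q * b q j)) = (\<Sum>p<m. if p
      = j then - (s j * b p i) else 0)"
    using comp_right[OF j] by (intro sum.cong) auto
  ultimately show ?thesis using im by simp
qed

lemma diagonal_zero: "k < n \<Longrightarrow> b k k = 0"
  using skew_symmetrizable[of k k] pos[of k] by simp

lemma sum_columns:
  assumes i: "i < m"
  shows "(\<Sum>p<m. (\<Sum>j<n. b p j * z j) * l p i) = (if i < n then s i * z i else 0)"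
proof -
  have "(\<Sum>p<m. (\<Sum>j<n. b p j * z j) * l p i) = (\<Sum>j<n. (\<Sum>p<m. b p j * l p i) * z j)"
    unfolding sum_distrib_right by (subst sum.swap) (simp add: algebra_simps)
  also have "\<dots> = (\<Sum>j<n. if j = i then s j * z j else 0)"
    using comp[OF _ i] by (intro sum.cong) auto
  also have "\<dots> = (if i < n then s i * z i else 0)" by simp
  finally show ?thesis .
qed

text \<open>Pairing a combination of columns with \<open>l\<close> returns \<open>s i * y i\<close>,
  and \<open>s i\<close> is positive. So the exchange matrix has full column rank.\<close>

lemma columns_inj:
  assumes "\<And>p. p < m \<Longrightarrow> (\<Sum>j<n. b p j * y j) = (\<Sum>j<n. b p j * z j)" and i: "i < n"
  shows "y i = z i"
proof -
  have "(\<Sum>p<m. (\<Sum>j<n. b p j * y j) * l p i) = (\<Sum>p<m. (\<Sum>j<n. b p j * z j) * l p i)"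
    using assms(1) by simp
  then show ?thesis using sum_columns[of i] pos[OF i] i nm by simp
qed

end

text \<open>The assumptions on \<open>l'\<close> are the entries of \<open>E^T \<Lambda> E\<close>
  for the sign +1, where column \<open>k\<close> of \<open>E\<close> is
  \<open>[- b p k]\<^sub>+\<close> off \<open>k\<close> and -1 at \<open>k\<close>.\<close>

locale compat_mutation = compat +
  fixes k :: nat and l' :: "nat \<Rightarrow> nat \<Rightarrow> int"
  assumes k: "k < n"
    and skew': "\<lbrakk>i < m; j < m\<rbrakk> \<Longrightarrow> l' i j = - l' j i"
    and l'_other: "\<lbrakk>i < m; j < m; i \<noteq> k; j \<noteq> k\<rbrakk> \<Longrightarrow> l' i j = l i j"
    and l'_k: "\<lbrakk>i < m; i \<noteq> k\<rbrakk> \<Longrightarrow> l' k i = (\<Sum>p<m. [- b p k]\<^sub>+ * l p i) - l k i"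
begin

text \<open>Pairings of the exponent vectors of the two exchange monomials in direction
  \<open>k\<close> with the basis vectors.\<close>

definition minus_part :: "nat \<Rightarrow> int" where "minus_part i = (\<Sum>p<m. [- b p k]\<^sub>+ * l p i)"
definition plus_part :: "nat \<Rightarrow> int" where "plus_part i = (\<Sum>p<m. [b p k]\<^sub>+ * l p i)"

lemma km: "k < m" using k nm by simp

lemma bkk: "b k k = 0" using diagonal_zero k by simp

text \<open>The two exponent vectors differ by column \<open>k\<close> of \<open>b\<close>, so
  compatibility makes their pairings agree away from \<open>k\<close>.\<close>

lemma parts: "i < m \<Longrightarrow> plus_part i = minus_part i + (if i = k then s k else 0)"
proof -
  assume i: "i < m"
  have "plus_part i - minus_part i = (\<Sum>p<m. b p k * l p i)"
    unfolding plus_part_def minus_part_def sum_subtractf[symmetric]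
    by (intro sum.cong) (auto simp: max_def left_diff_distrib[symmetric])
  then show ?thesis using comp[OF k i] by simp
qed

lemma l'_k_eq: "\<lbrakk>i < m; i \<noteq> k\<rbrakk> \<Longrightarrow> l' k i = minus_part i - l k i"
  using l'_k by (simp add: minus_part_def)

lemma lkk: "l k k = 0" using skew[of k k] km by simp

lemma l'_kk: "l' k k = 0" using skew'[of k k] km by simp

lemma l'_k': "\<lbrakk>i < m; i \<noteq> k\<rbrakk> \<Longrightarrow> l' i k = - minus_part i - l i k"
  using skew'[of i k] skew[of i k] l'_k[of i] km by (simp add: minus_part_def)

text \<open>Mutation affects \<open>l\<close> in row and column \<open>k\<close> only; sums are
  computed with the old \<open>l\<close> and then corrected in their term \<open>k\<close>.\<close>

lemma sum_update:
  fixes f g :: "nat \<Rightarrow> int"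
  assumes "\<And>p. \<lbrakk>p < m; p \<noteq> k\<rbrakk> \<Longrightarrow> f p = g p"
  shows "(\<Sum>p<m. f p) = (\<Sum>p<m. g p) + f k - g k"
proof -
  have "(\<Sum>p<m. f p) = (\<Sum>p<m. g p + (if p = k then f k - g k else 0))"
    using assms by (intro sum.cong) auto
  then show ?thesis using km by (simp add: sum.distrib)
qed

text \<open>A skew form vanishes on a pair of equal vectors; here \<open>S = - S\<close> after
  renaming the summation indices.\<close>

lemma minus_part_isotropic: "(\<Sum>p<m. [- b p k]\<^sub>+ * minus_part p) = 0"
proof -
  let ?t = "\<lambda>p q. [- b p k]\<^sub>+ * ([- b q k]\<^sub>+ * l q p)"
  define S where "S = (\<Sum>p<m. \<Sum>q<m. ?t p q)"
  have "S = (\<Sum>q<m. \<Sum>p<m. ?t p q)" unfolding S_def by (rule sum.swap)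
  also have "\<dots> = (\<Sum>q<m. \<Sum>p<m. - ?t q p)"
  proof (intro sum.cong refl)
    fix q p assume "q \<in> {..<m}" "p \<in> {..<m}"
    then have "l q p = - l p q" by (intro skew) simp_all
    then show "?t p q = - ?t q p" by (simp only: mult_minus_right mult.left_commute)
  qed
  also have "\<dots> = - S" unfolding S_def by (simp only: sum_negf)
  finally have "S = 0" by simp
  moreover have "(\<Sum>p<m. [- b p k]\<^sub>+ * minus_part p) = S"
    unfolding S_def minus_part_def sum_distrib_left ..
  ultimately show ?thesis by simp
qed

definition b' :: "nat \<Rightarrow> nat \<Rightarrow> int" where
  "b' i j = (if i = k \<or> j = k then - b i j
     else b i j + [b i k]\<^sub>+ * [b k j]\<^sub>+ - [- b i k]\<^sub>+ * [- b k j]\<^sub>+)"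

lemma generic_sum:
  "(\<Sum>p<m. (b p j + [b p k]\<^sub>+ * [b k j]\<^sub>+ - [- b p k]\<^sub>+ * [- b k j]\<^sub>+) * l p i)
     = (\<Sum>p<m. b p j * l p i) + [b k j]\<^sub>+ * plus_part i - [- b k j]\<^sub>+ * minus_part i"
  unfolding plus_part_def minus_part_def
  by (simp add: sum.distrib sum_subtractf sum_distrib_left algebra_simps)

text \<open>Away from \<open>k\<close> the two parts agree, so the mutation terms contribute
  \<open>b k j * minus_part i\<close>; the changed term \<open>k\<close> removes exactly
  this.\<close>

lemma comp_mutate_other:
  assumes j: "j < n" and i: "i < m" "i \<noteq> k"
  shows "(\<Sum>p<m. b' p j * l' p i) = (if i = j then s j else 0)"
proof (cases "j = k")
  case True
  have "(\<Sum>p<m. b' p j * l' p i) = (\<Sum>p<m. - (b p k * l p i))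
      + b' k j * l' k i - (- (b k k * l k i))"
    using i l'_other by (intro sum_update) (auto simp: b'_def True)
  then show ?thesis using i bkk comp[OF k i(1)] True by (simp add: b'_def sum_negf)
next
  case False
  let ?g = "\<lambda>p. (b p j + [b p k]\<^sub>+ * [b k j]\<^sub>+ - [- b p k]\<^sub>+ * [- b k j]\<^sub>+) * l p i"
  have "(\<Sum>p<m. b' p j * l' p i) = (\<Sum>p<m. ?g p) + b' k j * l' k i - ?g k"
    using i l'_other by (intro sum_update) (auto simp: b'_def False)
  also have "\<dots> = (if i = j then s j else 0) + ([b k j]\<^sub>+ - [- b k j]\<^sub>+) * minus_part i - b k j * minus_part i"
    unfolding generic_sum using comp[OF j i(1)] parts[OF i(1)] i bkk False
    by (simp add: b'_def l'_k_eq[OF i] algebra_simps)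
  also have "[b k j]\<^sub>+ - [- b k j]\<^sub>+ = b k j" by (simp add: max_def)
  finally show ?thesis by simp
qed

lemma comp_mutate_k:
  assumes j: "j < n"
  shows "(\<Sum>p<m. b' p j * l' p k) = (if k = j then s j else 0)"
proof -
  \<comment> \<open>Column \<open>k\<close> of \<open>l'\<close> contains \<open>minus_part\<close>;
    skewness moves the form over to \<open>f\<close>, where compatibility can be applied to a
    column.\<close>
  have swap: "(\<Sum>p<m. f p * minus_part p) = - (\<Sum>q<m. [- b q k]\<^sub>+ * (\<Sum>p<m. f p * l p q))" for f
  proof -
    have "(\<Sum>p<m. f p * minus_part p) = (\<Sum>q<m. \<Sum>p<m. f p * ([- b q k]\<^sub>+ * l q p))"
      unfolding minus_part_def sum_distrib_left by (rule sum.swap)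
    also have "\<dots> = (\<Sum>q<m. - ([- b q k]\<^sub>+ * (\<Sum>p<m. f p * l p q)))"
      unfolding sum_distrib_left sum_negf[symmetric]
    proof (intro sum.cong refl)
      fix q p assume "q \<in> {..<m}" "p \<in> {..<m}"
      then have "l q p = - l p q" by (intro skew) simp_all
      then show "f p * ([- b q k]\<^sub>+ * l q p) = - ([- b q k]\<^sub>+ * (f p * l p q))"
        by (simp only: mult_minus_right mult.left_commute)
    qed
    finally show ?thesis by (simp add: sum_negf)
  qed
  show ?thesis
  proof (cases "j = k")
    case True
    have "(\<Sum>p<m. b' p j * l' p k) = (\<Sum>p<m. b p k * minus_part p + b p k * l p k)
        + b' k j * l' k k - (b k k * minus_part k + b k k * l k k)"
      by (intro sum_update) (auto simp: b'_def True l'_k' algebra_simps)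
    also have "\<dots> = - (\<Sum>q<m. [- b q k]\<^sub>+ * (\<Sum>p<m. b p k * l p q)) + s k"
      using bkk l'_kk comp[OF k km] swap[of "\<lambda>p. b p k"] by (simp add: sum.distrib)
    also have "(\<Sum>q<m. [- b q k]\<^sub>+ * (\<Sum>p<m. b p k * l p q)) = (\<Sum>q<m. 0)"
      using comp[OF k] bkk by (intro sum.cong) auto
    finally show ?thesis using True by simp
  next
    case False
    let ?c = "\<lambda>p. b p j + [b p k]\<^sub>+ * [b k j]\<^sub>+ - [- b p k]\<^sub>+ * [- b k j]\<^sub>+"
    have "(\<Sum>p<m. b' p j * l' p k) = (\<Sum>p<m. - (?c p * minus_part p) - ?c p * l p k)
        + b' k j * l' k k - (- (?c k * minus_part k) - ?c k * l k k)"
      by (intro sum_update) (auto simp: b'_def False l'_k' algebra_simps)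
    also have "\<dots> = (\<Sum>q<m. [- b q k]\<^sub>+ * (\<Sum>p<m. ?c p * l p q)) - (\<Sum>p<m. ?c p * l p k) + b k j * minus_part k"
      using bkk l'_kk lkk swap[of ?c] by (simp add: sum_subtractf sum_negf)
    also have "(\<Sum>q<m. [- b q k]\<^sub>+ * (\<Sum>p<m. ?c p * l p q))
        = (\<Sum>q<m. (if q = j then [- b q k]\<^sub>+ * s j else 0) + b k j * ([- b q k]\<^sub>+ * minus_part q))"
    proof (intro sum.cong refl)
      fix q assume q: "q \<in> {..<m}"
      have "[b k j]\<^sub>+ - [- b k j]\<^sub>+ = b k j" by (simp add: max_def)
      then have e: "[b k j]\<^sub>+ * x - [- b k j]\<^sub>+ * x = b k j * x" for x by (metis left_diff_distrib)
      show "[- b q k]\<^sub>+ * (\<Sum>p<m. ?c p * l p q)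
          = (if q = j then [- b q k]\<^sub>+ * s j else 0) + b k j * ([- b q k]\<^sub>+ * minus_part q)"
      proof (cases "q = k")
        case True
        then show ?thesis using bkk False by simp
      next
        case qk: False
        have "(\<Sum>p<m. ?c p * l p q) = (if q = j then s j else 0) + b k j * minus_part q"
          unfolding generic_sum using comp[OF j] parts q qk e[of "minus_part q"] by simp
        then show ?thesis by (simp add: algebra_simps)
      qed
    qed
    also have "\<dots> = [- b j k]\<^sub>+ * s j"
      unfolding sum.distrib sum_distrib_left[symmetric] using minus_part_isotropic j nm by simp
    also have "(\<Sum>p<m. ?c p * l p k) = [b k j]\<^sub>+ * (minus_part k + s k) - [- b k j]\<^sub>+ * minus_part k"
      unfolding generic_sum using comp[OF j km] parts[OF km] False by simp
    finally have "(\<Sum>p<m. b' p j * l' p k) = [- b j k]\<^sub>+ * s j - [b k j]\<^sub>+ * s k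
        + (b k j - ([b k j]\<^sub>+ - [- b k j]\<^sub>+)) * minus_part k"
      by (simp add: algebra_simps)
    also have "[b k j]\<^sub>+ - [- b k j]\<^sub>+ = b k j" by (simp add: max_def)
    also have "[- b j k]\<^sub>+ * s j = [b k j]\<^sub>+ * s k"
    proof -
      \<comment> \<open>The two leftover terms cancel by skew-symmetrizability, because positive
        parts commute with the positive factors \<open>s j\<close> and \<open>s k\<close>.\<close>
      have "s j * (- b j k) = s k * b k j" using skew_symmetrizable[OF j k] by simp
      then have "s j * [- b j k]\<^sub>+ = s k * [b k j]\<^sub>+"
        using mult_pos_part[OF pos[OF j]] mult_pos_part[OF pos[OF k]] by metis
      then show ?thesis by (simp add: mult.commute)
    qed
    finally show ?thesis using False by simp
  qed
qed

lemma compat_mutate: "compat m n b' l' s"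
proof
  fix j i assume j: "j < n" and i: "i < m"
  show "(\<Sum>p<m. b' p j * l' p i) = (if i = j then s j else 0)"
    using comp_mutate_other[OF j i] comp_mutate_k[OF j] by (cases "i = k") simp_all
qed (use nm pos skew' in blast)+

text \<open>The tropical exchange relation for \<open>\<beta> = \<Lambda> g\<close>. By
  compatibility the tropical values of the two exchange monomials differ by
  \<open>s k * g k\<close>, so the sign of \<open>g k\<close> decides the maximum; this is the case
  distinction hidden in \<open>[g k]\<^sub>+\<close> in the rule for tropical points.\<close>

lemma trop_vector_mutate:
  fixes g g' :: "nat \<Rightarrow> int"
  assumes g'_k: "g' k = - g k"
    and g': "\<And>i. \<lbrakk>i < m; i \<noteq> k\<rbrakk> \<Longrightarrow> g' i = g i + [- b i k]\<^sub>+ * g k + b i k * [g k]\<^sub>+"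
  defines "\<beta> \<equiv> \<lambda>i. \<Sum>j<m. l i j * g j"
  shows "\<lbrakk>i < m; i \<noteq> k\<rbrakk> \<Longrightarrow> (\<Sum>j<m. l' i j * g' j) = \<beta> i"
    and "(\<Sum>j<m. l' k j * g' j)
      = max (\<Sum>j<m. [b j k]\<^sub>+ * \<beta> j) (\<Sum>j<m. [- b j k]\<^sub>+ * \<beta> j) - \<beta> k"
proof -
  let ?h = "\<lambda>i. g i + [- b i k]\<^sub>+ * g k + b i k * [g k]\<^sub>+"
  have mp: "(\<Sum>p<m. [- b p k]\<^sub>+ * l i p) = - minus_part i" if "i < m" for i
    unfolding minus_part_def sum_negf[symmetric] using skew[OF that] by (intro sum.cong) auto
  have sum_h: "(\<Sum>j<m. f j * ?h j) = (\<Sum>j<m. f j * g j) + g k * (\<Sum>j<m. [- b j k]\<^sub>+ * f j)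
      + [g k]\<^sub>+ * (\<Sum>j<m. f j * b j k)" for f
    by (simp add: sum.distrib sum_distrib_left algebra_simps)
  show "(\<Sum>j<m. l' i j * g' j) = \<beta> i" if i: "i < m" "i \<noteq> k"
  proof -
    have "(\<Sum>j<m. l' i j * g' j) = (\<Sum>j<m. l i j * ?h j) + l' i k * g' k - l i k * ?h k"
      using i l'_other g' by (intro sum_update) auto
    also have "\<dots> = \<beta> i - g k * minus_part i + (minus_part i + l i k) * g k - l i k * g k"
      unfolding sum_h mp[OF i(1)] comp_right[OF k i(1)] \<beta>_def
      using i bkk g'_k by (simp add: l'_k'[OF i] algebra_simps)
    finally show ?thesis by (simp add: algebra_simps)
  qed
  have b\<beta>: "(\<Sum>j<m. b j k * \<beta> j) = s k * g k"
  proof -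
    have "(\<Sum>j<m. b j k * \<beta> j) = (\<Sum>i<m. (\<Sum>j<m. b j k * l j i) * g i)"
      unfolding \<beta>_def sum_distrib_left sum_distrib_right
        by (subst sum.swap) (simp add: algebra_simps)
    also have "\<dots> = (\<Sum>i<m. if i = k then s k * g i else 0)"
      using comp[OF k] by (intro sum.cong) auto
    finally show ?thesis using km by simp
  qed
  have "(\<Sum>j<m. [b j k]\<^sub>+ * \<beta> j) - (\<Sum>j<m. [- b j k]\<^sub>+ * \<beta> j) = s k * g k"
    unfolding b\<beta>[symmetric] sum_subtractf[symmetric] left_diff_distrib[symmetric]
    by (intro sum.cong) (auto simp: max_def)
  then have max: "max (\<Sum>j<m. [b j k]\<^sub>+ * \<beta> j) (\<Sum>j<m. [- b j k]\<^sub>+ * \<beta> j)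
      = (\<Sum>j<m. [- b j k]\<^sub>+ * \<beta> j) + s k * [g k]\<^sub>+"
    unfolding mult_pos_part[OF pos[OF k]] by linarith
  let ?f = "\<lambda>j. minus_part j - l k j"
  have "(\<Sum>j<m. l' k j * g' j) = (\<Sum>j<m. ?f j * ?h j) + l' k k * g' k - ?f k * ?h k"
    by (intro sum_update) (auto simp: l'_k_eq g')
  also have "\<dots> = (\<Sum>j<m. ?f j * g j) + g k * (\<Sum>j<m. [- b j k]\<^sub>+ * ?f j)
      + [g k]\<^sub>+ * (\<Sum>j<m. ?f j * b j k) - minus_part k * g k"
    unfolding sum_h using l'_kk lkk bkk by simp
  also have "(\<Sum>j<m. [- b j k]\<^sub>+ * ?f j) = minus_part k"
    using mp[OF km] minus_part_isotropic by (simp add: right_diff_distrib sum_subtractf)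
  also have "(\<Sum>j<m. ?f j * b j k) = s k"
  proof -
    have "(\<Sum>j<m. minus_part j * b j k) = (\<Sum>p<m. [- b p k]\<^sub>+ * (\<Sum>j<m. l p j * b j k))"
      unfolding minus_part_def sum_distrib_left sum_distrib_right
      by (subst sum.swap) (simp add: algebra_simps)
    also have "\<dots> = (\<Sum>p<m. 0)" using comp_right[OF k] bkk by (intro sum.cong) auto
    finally show ?thesis using comp_right[OF k km] by (simp add: left_diff_distrib sum_subtractf)
  qed
  also have "(\<Sum>j<m. ?f j * g j) = (\<Sum>p<m. [- b p k]\<^sub>+ * \<beta> p) - \<beta> k"
  proof -
    have "(\<Sum>j<m. minus_part j * g j) = (\<Sum>p<m. [- b p k]\<^sub>+ * \<beta> p)"
      unfolding minus_part_def \<beta>_def sum_distrib_left sum_distrib_right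
      by (subst sum.swap) (simp add: algebra_simps)
    then show ?thesis by (simp add: left_diff_distrib sum_subtractf \<beta>_def)
  qed
  finally show "(\<Sum>j<m. l' k j * g' j)
      = max (\<Sum>j<m. [b j k]\<^sub>+ * \<beta> j) (\<Sum>j<m. [- b j k]\<^sub>+ * \<beta> j) - \<beta> k"
    unfolding max by (simp add: algebra_simps)
qed

end

section \<open>Invariants of simple objects against a monoidal cluster\<close>

abbreviation unit_exp :: "nat \<Rightarrow> nat \<Rightarrow> nat" where
  "unit_exp i \<equiv> \<lambda>j. if j = i then 1 else 0"

lemma monomial_unit: "i < m \<Longrightarrow> monomial m x (unit_exp i) = x $ i"
  using pos_poly_gen[of i m x] by (simp add: pos_poly_def)

text \<open>Exponents of cluster monomials are arbitrary functions on the naturals;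
  \<open>cong\<close> cuts them off at \<open>m\<close>, after which additivity reduces to unit
  vectors.\<close>

lemma additive_on_exponents:
  fixes f :: "(nat \<Rightarrow> nat) \<Rightarrow> int"
  assumes add: "\<And>a b. f (\<lambda>i. a i + b i) = f a + f b"
    and cong: "\<And>a b. (\<And>i. i < m \<Longrightarrow> a i = b i) \<Longrightarrow> f a = f b"
  shows "f a = (\<Sum>i<m. int (a i) * f (unit_exp i))"
proof -
  have 0: "f (\<lambda>i. 0) = 0" using add[of "\<lambda>i. 0" "\<lambda>i. 0"] by simp
  have scale: "f (\<lambda>j. if j = i then k else 0) = int k * f (unit_exp i)" for i k
  proof (induction k)
    case 0
    have "(\<lambda>j. if j = i then 0 else 0) = (\<lambda>i. 0 :: nat)" by simp
    then show ?case using \<open>f (\<lambda>i. 0) = 0\<close> by simp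
  next
    case (Suc k)
    have "(\<lambda>j. if j = i then Suc k else 0) = (\<lambda>j. (if j = i then k else 0) + unit_exp i j)"
      by (rule ext) simp
    moreover have "f (\<lambda>j. (if j = i then k else 0) + unit_exp i j)
        = f (\<lambda>j. if j = i then k else 0) + f (unit_exp i)" by (rule add)
    ultimately show ?case using Suc by (simp only: of_nat_Suc distrib_right mult_1 add.commute)
  qed
  have "f (\<lambda>i. if i < r then a i else 0) = (\<Sum>i<r. int (a i) * f (unit_exp i))" for r
  proof (induction r)
    case 0
    then show ?case using \<open>f (\<lambda>i. 0) = 0\<close> by simp
  next
    case (Suc r)
    have "(\<lambda>i. if i < Suc r then a i else 0)
        = (\<lambda>i. (if i < r then a i else 0) + (if i = r then a r else 0))"
      by (rule ext) (simp add: less_Suc_eq)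
    moreover have "f (\<lambda>i. (if i < r then a i else 0) + (if i = r then a r else 0))
        = f (\<lambda>i. if i < r then a i else 0) + f (\<lambda>i. if i = r then a r else 0)"
      by (rule add)
    ultimately show ?case using Suc scale[of r "a r"] by simp
  qed
  moreover have "f a = f (\<lambda>i. if i < m then a i else 0)" by (rule cong) simp
  ultimately show ?thesis by simp
qed

locale Lambda_categorification = categorification K C \<phi>
  for K :: "('k, 'r) ring_scheme" and C :: "('o, 'a, 'k, 'z) mon_cat_scheme" (structure)
    and \<phi> :: "('o \<Rightarrow>\<^sub>0 int) set \<Rightarrow> 'f::field_char_0" +
  fixes m n :: nat and P :: "'f pattern" and \<Omega> :: "'o set" and \<Lambda> :: "'o \<Rightarrow> 'o \<Rightarrow> int"
  assumes n_pos: "0 < n" and nm: "n \<le> m" and pattern: "cluster_pattern m n P"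
    and monomials_simple: "cluster_monomial m n P z \<Longrightarrow> \<exists>M. simple_obj C M \<and> \<phi> (K0_class C M) = z"
    and Lambda: "Lambda_structure C \<Omega> \<Lambda>"
    and head_simple: "\<lbrakk>simple_obj C M; simple_obj C N; real_simple C M \<or> real_simple C N\<rbrakk>
      \<Longrightarrow> simple_obj C (M \<nabla> N)"
    and ex_compatible: "\<exists>w \<in> tree_verts n. compatible_pair m n (bm P w) (Lambda_mat m P C \<phi> \<Lambda> w)"
begin

lemmas Lambda_parts = Lambda[unfolded Lambda_structure_def]

lemma simple_in_\<Omega>: "simple_obj C M \<Longrightarrow> M \<in> \<Omega>"
  using Lambda_parts[THEN conjunct2, THEN conjunct1] by blast

lemma tensor_in_\<Omega>: "\<lbrakk>M \<in> \<Omega>; N \<in> \<Omega>\<rbrakk> \<Longrightarrow> M \<boxtimes> N \<in> \<Omega>"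
  using Lambda_parts[THEN conjunct2, THEN conjunct2, THEN conjunct2, THEN conjunct1] by blast

lemma \<Lambda>_iso:
  assumes "M \<in> \<Omega>" "N \<in> \<Omega>" "M' \<in> \<Omega>" "N' \<in> \<Omega>" "iso_objs C M M'" "iso_objs C N N'"
  shows "\<Lambda> M N = \<Lambda> M' N'"
  using Lambda_parts[THEN conjunct2, THEN conjunct2, THEN conjunct2, THEN conjunct2, THEN conjunct2,
      THEN conjunct1] assms by blast

lemma \<Lambda>_commuting:
  assumes "real_simple C M" "real_simple C N" "strongly_commute C M N"
  shows "\<Lambda> N M = - \<Lambda> M N"
proof -
  have "dinv \<Lambda> M N = 0"
    using Lambda_parts[THEN conjunct2, THEN conjunct2, THEN conjunct2, THEN conjunct2, THEN
        conjunct2,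
      THEN conjunct2, THEN conjunct1] assms by blast
  then have "of_int (\<Lambda> M N + \<Lambda> N M) = (0 :: rat)" by (simp add: dinv_def)
  then show ?thesis by linarith
qed

lemma \<Lambda>_tensor:
  assumes "M \<in> \<Omega>" "N \<in> \<Omega>" "simple_obj C L"
  shows "\<Lambda> (M \<boxtimes> N) L = \<Lambda> M L + \<Lambda> N L" "\<Lambda> L (M \<boxtimes> N) = \<Lambda> L M + \<Lambda> L N"
  using Lambda_parts[THEN conjunct2, THEN conjunct2, THEN conjunct2, THEN conjunct2, THEN conjunct2,
      THEN conjunct2, THEN conjunct2, THEN conjunct1] assms by blast+

lemma \<Lambda>_head:
  assumes "simple_obj C M" "simple_obj C N" "real_simple C L"
  shows "strongly_commute C L N \<Longrightarrow> \<Lambda> (M \<nabla> N) L = \<Lambda> M L + \<Lambda> N L"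
    "strongly_commute C L M \<Longrightarrow> \<Lambda> L (M \<nabla> N) = \<Lambda> L M + \<Lambda> L N"
  using Lambda_parts[THEN conjunct2, THEN conjunct2, THEN conjunct2, THEN conjunct2, THEN conjunct2,
      THEN conjunct2, THEN conjunct2, THEN conjunct2, THEN conjunct1] assms by blast+

lemma \<Lambda>_subquotient:
  assumes "M \<in> \<Omega>" "N \<in> \<Omega>" "subquotient C M' M" "\<not> is_zero_obj C M'" "subquotient C N' N"
      "\<not> is_zero_obj C N'"
  shows "\<Lambda> M' N' \<le> \<Lambda> M N"
  using Lambda_parts[THEN conjunct2, THEN conjunct2, THEN conjunct2, THEN conjunct2, THEN conjunct2,
      THEN conjunct2, THEN conjunct2, THEN conjunct2, THEN conjunct2] assms by blast

lemma \<Lambda>_simple_iso: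
  assumes "simple_obj C M" "simple_obj C N" "iso_objs C M M'" "iso_objs C N N'"
  shows "\<Lambda> M N = \<Lambda> M' N'"
  using \<Lambda>_iso simple_in_\<Omega> simple_iso assms by metis

lemma head_tensor_quotient:
  assumes "M \<in> Obj C" "N \<in> Obj C"
  shows "\<exists>q \<in> Hom C (M \<boxtimes> N) (M \<nabla> N). is_epi C q"
proof -
  have "is_head C (M \<boxtimes> N) (M \<nabla> N)"
    unfolding head_tensor_def using ex_head[OF tens_in[OF assms]] by (rule someI_ex)
  then show ?thesis unfolding is_head_def by blast
qed

section \<open>Simple objects attached to cluster monomials\<close>

definition mono_obj :: "nat list \<Rightarrow> (nat \<Rightarrow> nat) \<Rightarrow> 'o" where
  "mono_obj t a = (SOME M. simple_obj C M \<and> val M = monomial m (xv P t) a)"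

lemma mono_obj:
  assumes "t \<in> tree_verts n"
  shows mono_obj_simple: "simple_obj C (mono_obj t a)"
      and mono_obj_val: "val (mono_obj t a) = monomial m (xv P t) a"
proof -
  have "cluster_monomial m n P (monomial m (xv P t) a)"
    unfolding cluster_monomial_def monomial_def using assms by blast
  then have "\<exists>M. simple_obj C M \<and> val M = monomial m (xv P t) a"
    using monomials_simple unfolding val_def by blast
  then have "simple_obj C (mono_obj t a) \<and> val (mono_obj t a) = monomial m (xv P t) a"
    unfolding mono_obj_def by (rule someI_ex)
  then show "simple_obj C (mono_obj t a)" "val (mono_obj t a) = monomial m (xv P t) a" by blast+
qed

text \<open>The choice depends on the monomial alone, which gives equality of objects and not merely
  an isomorphism.\<close>

lemma mono_obj_cong:
  assumes "\<And>i. i < m \<Longrightarrow> a i = b i" shows "mono_obj t a = mono_obj t b"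
proof -
  have "monomial m (xv P t) a = monomial m (xv P t) b" unfolding monomial_def using assms by simp
  then show ?thesis by (simp add: mono_obj_def)
qed

text \<open>The class of the tensor product is again a cluster monomial, and an object with the
  class of a simple object is simple. Reality and strong commutation of cluster objects
  follow.\<close>

lemma mono_obj_tensor:
  assumes t: "t \<in> tree_verts n"
  shows "iso_objs C (mono_obj t a \<boxtimes> mono_obj t b) (mono_obj t (\<lambda>i. a i + b i))"
      "simple_obj C (mono_obj t a \<boxtimes> mono_obj t b)"
proof -
  have O: "mono_obj t a \<in> Obj C" "mono_obj t b \<in> Obj C" using mono_obj_simple[OF t] simple_in_Obj
    by blast+
  have "val (mono_obj t a \<boxtimes> mono_obj t b) = val (mono_obj t (\<lambda>i. a i + b i))"
    unfolding val_tensor[OF O] mono_obj_val[OF t] by (rule monomial_add[symmetric])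
  from val_simple_imp_iso[OF tens_in[OF O] mono_obj_simple[OF t] this]
  show "iso_objs C (mono_obj t a \<boxtimes> mono_obj t b) (mono_obj t (\<lambda>i. a i + b i))"
      "simple_obj C (mono_obj t a \<boxtimes> mono_obj t b)"
    by blast+
qed

lemma mono_obj_real: "t \<in> tree_verts n \<Longrightarrow> real_simple C (mono_obj t a)"
  using mono_obj_tensor(2) mono_obj_simple by (simp add: real_simple_def)

lemma mono_obj_commute:
  assumes t: "t \<in> tree_verts n" shows "strongly_commute C (mono_obj t a) (mono_obj t b)"
proof -
  have "(\<lambda>i. b i + a i) = (\<lambda>i. a i + b i)" by (simp add: add.commute)
  then have "iso_objs C (mono_obj t b \<boxtimes> mono_obj t a) (mono_obj t (\<lambda>i. a i + b i))"
    using mono_obj_tensor(1)[OF t, of b a] by simp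
  then have "iso_objs C (mono_obj t a \<boxtimes> mono_obj t b) (mono_obj t b \<boxtimes> mono_obj t a)"
    using mono_obj_tensor(1)[OF t, of a b] iso_objs_sym iso_objs_trans by blast
  then show ?thesis using mono_obj_tensor(2)[OF t] mono_obj_simple[OF t]
    by (simp add: strongly_commute_def)
qed

lemma \<Lambda>_mono_obj_add:
  assumes t: "t \<in> tree_verts n" and L: "simple_obj C L"
  shows "\<Lambda> (mono_obj t (\<lambda>i. a i + b i)) L = \<Lambda> (mono_obj t a) L + \<Lambda> (mono_obj t b) L"
    and "\<Lambda> L (mono_obj t (\<lambda>i. a i + b i)) = \<Lambda> L (mono_obj t a) + \<Lambda> L (mono_obj t b)"
proof -
  have iL: "iso_objs C L L" using iso_objs_refl simple_in_Obj L by blast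
  have s: "mono_obj t a \<in> \<Omega>" "mono_obj t b \<in> \<Omega>" using mono_obj_simple[OF t] simple_in_\<Omega> by blast+
  show "\<Lambda> (mono_obj t (\<lambda>i. a i + b i)) L = \<Lambda> (mono_obj t a) L + \<Lambda> (mono_obj t b) L"
    using \<Lambda>_simple_iso[OF mono_obj_tensor(2)[OF t] L mono_obj_tensor(1)[OF t] iL] \<Lambda>_tensor(1)[OF s
        L] by simp
  show "\<Lambda> L (mono_obj t (\<lambda>i. a i + b i)) = \<Lambda> L (mono_obj t a) + \<Lambda> L (mono_obj t b)"
    using \<Lambda>_simple_iso[OF L mono_obj_tensor(2)[OF t] iL mono_obj_tensor(1)[OF t]] \<Lambda>_tensor(2)[OF s
        L] by simp
qed

text \<open>The matrix \<open>\<Lambda>_t\<close>, computed on the objects \<open>mono_obj\<close>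
  so that cluster variables and general monomials share one construction.\<close>

definition lam :: "nat list \<Rightarrow> nat \<Rightarrow> nat \<Rightarrow> int" where
  "lam t i j = \<Lambda> (mono_obj t (unit_exp i)) (mono_obj t (unit_exp j))"

lemma \<Lambda>_mono_obj_sum:
  assumes t: "t \<in> tree_verts n" and L: "simple_obj C L"
  shows "\<Lambda> (mono_obj t a) L = (\<Sum>i<m. int (a i) * \<Lambda> (mono_obj t (unit_exp i)) L)"
    and "\<Lambda> L (mono_obj t a) = (\<Sum>i<m. int (a i) * \<Lambda> L (mono_obj t (unit_exp i)))"
proof -
  show "\<Lambda> (mono_obj t a) L = (\<Sum>i<m. int (a i) * \<Lambda> (mono_obj t (unit_exp i)) L)"
  proof (rule additive_on_exponents[of "\<lambda>a. \<Lambda> (mono_obj t a) L"])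
    show "\<Lambda> (mono_obj t (\<lambda>i. a i + b i)) L = \<Lambda> (mono_obj t a) L + \<Lambda> (mono_obj t b) L" for a b
      by (rule \<Lambda>_mono_obj_add(1)[OF t L])
    show "\<Lambda> (mono_obj t a) L = \<Lambda> (mono_obj t b) L" if "\<And>i. i < m \<Longrightarrow> a i = b i" for a b
      using mono_obj_cong[OF that] by simp
  qed
  show "\<Lambda> L (mono_obj t a) = (\<Sum>i<m. int (a i) * \<Lambda> L (mono_obj t (unit_exp i)))"
  proof (rule additive_on_exponents[of "\<lambda>a. \<Lambda> L (mono_obj t a)"])
    show "\<Lambda> L (mono_obj t (\<lambda>i. a i + b i)) = \<Lambda> L (mono_obj t a) + \<Lambda> L (mono_obj t b)" for a b
      by (rule \<Lambda>_mono_obj_add(2)[OF t L])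
    show "\<Lambda> L (mono_obj t a) = \<Lambda> L (mono_obj t b)" if "\<And>i. i < m \<Longrightarrow> a i = b i" for a b
      using mono_obj_cong[OF that] by simp
  qed
qed

lemma \<Lambda>_mono_obj_mono_obj:
  assumes t: "t \<in> tree_verts n"
  shows "\<Lambda> (mono_obj t a) (mono_obj t b) = (\<Sum>i<m. int (a i) * (\<Sum>j<m. lam t i j * int (b j)))"
proof -
  have "\<Lambda> (mono_obj t (unit_exp i)) (mono_obj t b) = (\<Sum>j<m. lam t i j * int (b j))" for i
    using \<Lambda>_mono_obj_sum(2)[OF t mono_obj_simple[OF t], of "unit_exp i" b] unfolding lam_def
    by (simp only: mult.commute)
  then show ?thesis using \<Lambda>_mono_obj_sum(1)[OF t mono_obj_simple[OF t], of a b] by simp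
qed

lemma lam_skew: "t \<in> tree_verts n \<Longrightarrow> lam t i j = - lam t j i"
  unfolding lam_def by (rule \<Lambda>_commuting[OF mono_obj_real mono_obj_real mono_obj_commute])

lemma Lambda_mat_eq_lam:
  assumes t: "t \<in> tree_verts n" and ij: "i < m" "j < m"
  shows "Lambda_mat m P C \<phi> \<Lambda> t $$ (i, j) = lam t i j"
proof -
  have iso: "iso_objs C (cluster_obj P C \<phi> t i) (mono_obj t (unit_exp i))
      \<and> simple_obj C (cluster_obj P C \<phi> t i)"
    if i: "i < m" for i
  proof -
    have v: "val (mono_obj t (unit_exp i)) = xv P t $ i"
      using mono_obj_val[OF t] monomial_unit[OF i] by simp
    then have "\<exists>M. simple_obj C M \<and> \<phi> (K0_class C M) = xv P t $ i"
      using mono_obj_simple[OF t] unfolding val_def by blast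
    then have "simple_obj C (cluster_obj P C \<phi> t i) \<and> \<phi> (K0_class C (cluster_obj P C \<phi> t i))
        = xv P t $ i"
      unfolding cluster_obj_def by (rule someI_ex)
    then have "simple_obj C (cluster_obj P C \<phi> t i)"
      "val (cluster_obj P C \<phi> t i) = val (mono_obj t (unit_exp i))" using v by (auto simp: val_def)
    then show ?thesis using val_simple_imp_iso(1)[OF simple_in_Obj mono_obj_simple[OF t]] by blast
  qed
  show ?thesis
    using \<Lambda>_simple_iso iso[OF ij(1)] iso[OF ij(2)] ij unfolding Lambda_mat_def lam_def by simp
qed

text \<open>
  The cluster object \<open>mono_obj t d\<close> clears the denominators of \<open>M\<close>: the composition factors of
  the product are cluster objects, subquotients bound \<open>\<Lambda>\<close> from below and the head attains the bound.
\<close>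

lemma \<Lambda>_max:
  assumes t: "t \<in> tree_verts n" and M: "simple_obj C M" and I: "finite I"
    and c: "\<And>v. v \<in> I \<Longrightarrow> (0::int) < c v"
    and exp: "monomial m (xv P t) d * val M = (\<Sum>v\<in>I. of_int (c v) * monomial m (xv P t) (e v))"
  shows "\<Lambda> M (mono_obj t a) + \<Lambda> (mono_obj t d) (mono_obj t a)
      = Max ((\<lambda>v. \<Lambda> (mono_obj t (e v)) (mono_obj t a)) ` I)"
    and "\<Lambda> (mono_obj t a) M + \<Lambda> (mono_obj t a) (mono_obj t d)
        = Max ((\<lambda>v. \<Lambda> (mono_obj t a) (mono_obj t (e v))) ` I)"
proof -
  let ?D = "mono_obj t d" and ?A = "mono_obj t a"
  note s = mono_obj_simple[OF t]
  have O: "M \<in> Obj C" "?D \<in> Obj C" "?A \<in> Obj C" using M s simple_in_Obj by blast+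
  have \<Omega>: "M \<in> \<Omega>" "?D \<in> \<Omega>" "?A \<in> \<Omega>" using M s simple_in_\<Omega> by blast+
  have nz: "\<not> is_zero_obj C T" if "simple_obj C T" for T using that by (simp add: simple_obj_def)
  \<comment> \<open>Both orders of the product have the same class because the field is commutative,
    hence the same composition factors.\<close>
  have eq: "val (?D \<boxtimes> M) = (\<Sum>v\<in>I. of_int (c v) * val (mono_obj t (e v)))"
    "val (M \<boxtimes> ?D) = (\<Sum>v\<in>I. of_int (c v) * val (mono_obj t (e v)))"
    using exp val_tensor[OF O(2,1)] val_tensor[OF O(1,2)] mono_obj_val[OF t]
      by (simp_all add: mult.commute)
  have factor: "\<exists>T. subquotient C T (?D \<boxtimes> M) \<and> simple_obj C T \<and> iso_objs C T (mono_obj t (e v))"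
    if "v \<in> I" for v
    using composition_factor_subquotient[OF tens_in[OF O(2,1)] I s eq(1) c that] .
  have head: "\<exists>v \<in> I. iso_objs C H (mono_obj t (e v))"
    if "H = ?D \<nabla> M \<or> H = M \<nabla> ?D" "simple_obj C H" for H
    using that head_tensor_quotient[OF O(2,1)] head_tensor_quotient[OF O(1,2)]
      simple_quotient_factor[OF tens_in[OF O(2,1)] I s eq(1) that(2)]
      simple_quotient_factor[OF tens_in[OF O(1,2)] I s eq(2) that(2)] by blast
  have hs: "simple_obj C (?D \<nabla> M)" "simple_obj C (M \<nabla> ?D)"
    using head_simple M s mono_obj_real[OF t] by blast+
  have AA: "iso_objs C ?A ?A" "subquotient C ?A ?A" using iso_objs_refl subquotient_refl O by blast+
  show "\<Lambda> M ?A + \<Lambda> ?D ?A = Max ((\<lambda>v. \<Lambda> (mono_obj t (e v)) ?A) ` I)"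
  proof (rule Max_eqI[symmetric])
    show "finite ((\<lambda>v. \<Lambda> (mono_obj t (e v)) ?A) ` I)" using I by simp
    \<comment> \<open>\<open>M \<nabla> ?D\<close> is the right order here: additivity of
      \<open>\<Lambda> _ ?A\<close> needs \<open>?A\<close> to commute strongly with the second
      factor, and \<open>?D\<close> is the one known to do so.\<close>
    obtain v where v: "v \<in> I" "iso_objs C (M \<nabla> ?D) (mono_obj t (e v))" using head hs by blast
    have "\<Lambda> (M \<nabla> ?D) ?A = \<Lambda> M ?A + \<Lambda> ?D ?A"
      using \<Lambda>_head(1)[OF M s mono_obj_real[OF t] mono_obj_commute[OF t]] .
    moreover have "\<Lambda> (M \<nabla> ?D) ?A = \<Lambda> (mono_obj t (e v)) ?A"
      using \<Lambda>_simple_iso[OF hs(2) s v(2) AA(1)] .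
    ultimately show "\<Lambda> M ?A + \<Lambda> ?D ?A \<in> (\<lambda>v. \<Lambda> (mono_obj t (e v)) ?A) ` I"
      by (intro image_eqI[OF _ v(1)]) simp
    fix y assume "y \<in> (\<lambda>v. \<Lambda> (mono_obj t (e v)) ?A) ` I"
    then obtain v where v: "v \<in> I" "y = \<Lambda> (mono_obj t (e v)) ?A" by blast
    obtain T where T: "subquotient C T (?D \<boxtimes> M)" "simple_obj C T" "iso_objs C T (mono_obj t (e v))"
      using factor[OF v(1)] by blast
    have "\<Lambda> T ?A \<le> \<Lambda> (?D \<boxtimes> M) ?A"
      using \<Lambda>_subquotient[OF tensor_in_\<Omega>[OF \<Omega>(2,1)] \<Omega>(3) T(1) nz[OF T(2)] AA(2) nz[OF s]] .
    then show "y \<le> \<Lambda> M ?A + \<Lambda> ?D ?A"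
      using \<Lambda>_tensor(1)[OF \<Omega>(2,1) s] \<Lambda>_simple_iso[OF T(2) s T(3) AA(1)] v(2) by simp
  qed
  show "\<Lambda> ?A M + \<Lambda> ?A ?D = Max ((\<lambda>v. \<Lambda> ?A (mono_obj t (e v))) ` I)"
  proof (rule Max_eqI[symmetric])
    show "finite ((\<lambda>v. \<Lambda> ?A (mono_obj t (e v))) ` I)" using I by simp
    \<comment> \<open>In the second argument of \<open>\<Lambda>\<close> it is the first factor of
      the head that has to commute with \<open>?A\<close>.\<close>
    obtain v where v: "v \<in> I" "iso_objs C (?D \<nabla> M) (mono_obj t (e v))" using head hs by blast
    have "\<Lambda> ?A (?D \<nabla> M) = \<Lambda> ?A ?D + \<Lambda> ?A M"
      using \<Lambda>_head(2)[OF s M mono_obj_real[OF t] mono_obj_commute[OF t]] .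
    moreover have "\<Lambda> ?A (?D \<nabla> M) = \<Lambda> ?A (mono_obj t (e v))"
      using \<Lambda>_simple_iso[OF s hs(1) AA(1) v(2)] .
    ultimately show "\<Lambda> ?A M + \<Lambda> ?A ?D \<in> (\<lambda>v. \<Lambda> ?A (mono_obj t (e v))) ` I"
      by (intro image_eqI[OF _ v(1)]) simp
    fix y assume "y \<in> (\<lambda>v. \<Lambda> ?A (mono_obj t (e v))) ` I"
    then obtain v where v: "v \<in> I" "y = \<Lambda> ?A (mono_obj t (e v))" by blast
    obtain T where T: "subquotient C T (?D \<boxtimes> M)" "simple_obj C T" "iso_objs C T (mono_obj t (e v))"
      using factor[OF v(1)] by blast
    have "\<Lambda> ?A T \<le> \<Lambda> ?A (?D \<boxtimes> M)"
      using \<Lambda>_subquotient[OF \<Omega>(3) tensor_in_\<Omega>[OF \<Omega>(2,1)] AA(2) nz[OF s] T(1) nz[OF T(2)]] .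
    then show "y \<le> \<Lambda> ?A M + \<Lambda> ?A ?D"
      using \<Lambda>_tensor(2)[OF \<Omega>(2,1) s] \<Lambda>_simple_iso[OF s T(2) AA(1) T(3)] v(2) by simp
  qed
qed

end

lemma prod_power_int:
  fixes x :: "'f::field"
  assumes "x \<noteq> 0" shows "(\<Prod>k\<in>I. x powi f k) = x powi (\<Sum>k\<in>I. f k)"
  by (induction I rule: infinite_finite_induct) (auto simp: power_int_add assms)

lemma power_int_power_nat:
  fixes x :: "'f::field"
  assumes "x \<noteq> 0" shows "(x powi a) ^ k = x powi (a * int k)"
  by (induction k) (auto simp: power_int_add assms algebra_simps)

text \<open>Substituting the definition of \<open>yhat\<close> turns the term \<open>v\<close> of
  the F-polynomial into the Laurent monomial with exponent \<open>g + B v\<close>; a common factor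
  \<open>x^d\<close> makes all of these ordinary monomials.\<close>

lemma pointed_expansion:
  assumes x: "free_generating m (xv P t)" and u: "pointed m n P t u g"
  obtains F :: "(nat \<Rightarrow>\<^sub>0 nat) \<Rightarrow>\<^sub>0 int" and d :: "nat \<Rightarrow> nat" and e :: "(nat \<Rightarrow>\<^sub>0 nat) \<Rightarrow> nat \<Rightarrow> nat"
  where "mpoly_in n F" "Poly_Mapping.lookup F 0 = 1"
    "\<And>v. v \<in> Poly_Mapping.keys F \<Longrightarrow> e v \<in> exponents m"
    "\<And>v j. v \<in> Poly_Mapping.keys F \<Longrightarrow> j < m \<Longrightarrow>
      int (e v j) = int (d j) + g $ j + (\<Sum>k<n. bm P t $$ (j, k) * int (Poly_Mapping.lookup v k))"
    "monomial m (xv P t) d * u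
      = (\<Sum>v\<in>Poly_Mapping.keys F. of_int (Poly_Mapping.lookup F v) * monomial m (xv P t) (e v))"
proof -
  let ?x = "xv P t"
  obtain F :: "(nat \<Rightarrow>\<^sub>0 nat) \<Rightarrow>\<^sub>0 int" where F: "mpoly_in n F" "Poly_Mapping.lookup F 0 = 1"
    and u: "u = (\<Prod>j<m. ?x $ j powi (g $ j)) * mpoly_eval of_int (yhat m P t) F"
    using u unfolding pointed_def by (elim exE conjE)
  let ?K = "Poly_Mapping.keys F"
  define Bv where "Bv v j = (\<Sum>k<n. bm P t $$ (j, k) * int (Poly_Mapping.lookup v k))" for v j
  \<comment> \<open>A sum over all terms bounds each negative exponent without a maximum over a
    possibly empty set.\<close>
  define d where "d j = (\<Sum>v\<in>?K. nat (- (g $ j + Bv v j)))" for j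
  \<comment> \<open>The truncation to \<open>nat\<close> loses nothing on \<open>?K\<close>, by the
    choice of \<open>d\<close>; the value 0 from \<open>m\<close> on places \<open>e v\<close> in
    \<open>exponents m\<close>.\<close>
  define e where "e v j = (if j < m then nat (int (d j) + g $ j + Bv v j) else 0)" for v j
  have nz: "j < m \<Longrightarrow> ?x $ j \<noteq> 0" for j using free_generating_nonzero[OF x] .
  have e_int: "int (e v j) = int (d j) + g $ j + Bv v j" if v: "v \<in> ?K" and j: "j < m" for v j
  proof -
    have "nat (- (g $ j + Bv v j)) \<le> d j"
      unfolding d_def using v by (intro member_le_sum) auto
    then show ?thesis using j unfolding e_def by simp
  qed
  have yhat: "(\<Prod>k\<in>Poly_Mapping.keys v. yhat m P t k ^ Poly_Mapping.lookup v k)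
      = (\<Prod>j<m. ?x $ j powi Bv v j)"
    if v: "v \<in> ?K" for v
  proof -
    have "(\<Prod>k\<in>Poly_Mapping.keys v. yhat m P t k ^ Poly_Mapping.lookup v k)
        = (\<Prod>k<n. yhat m P t k ^ Poly_Mapping.lookup v k)"
      using F(1) v by (intro prod.mono_neutral_left) (auto simp: mpoly_in_def in_keys_iff)
    also have "\<dots> = (\<Prod>k<n. \<Prod>j<m. ?x $ j powi (bm P t $$ (j, k) * int (Poly_Mapping.lookup v k)))"
      unfolding yhat_def prod_power_distrib
      using power_int_power_nat[OF nz] by (intro prod.cong refl) simp
    also have "\<dots> = (\<Prod>j<m. \<Prod>k<n. ?x $ j powi (bm P t $$ (j, k) * int (Poly_Mapping.lookup v k)))"
      by (rule prod.swap)
    also have "\<dots> = (\<Prod>j<m. ?x $ j powi Bv v j)"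
      unfolding Bv_def using prod_power_int[OF nz] by (intro prod.cong refl) simp
    finally show ?thesis .
  qed
  have summand: "monomial m ?x d * ((\<Prod>j<m. ?x $ j powi (g $ j)) * (\<Prod>j<m. ?x $ j powi Bv v j))
      = monomial m ?x (e v)" if v: "v \<in> ?K" for v
    unfolding monomial_def prod.distrib[symmetric]
  proof (intro prod.cong refl)
    fix j assume "j \<in> {..<m}"
    then have j: "j < m" by simp
    have "?x $ j ^ d j * (?x $ j powi (g $ j) * ?x $ j powi Bv v j)
        = ?x $ j powi (int (d j) + g $ j + Bv v j)"
      using nz[OF j] by (simp add: power_int_add)
    then show "?x $ j ^ d j * (?x $ j powi (g $ j) * ?x $ j powi Bv v j) = ?x $ j ^ e v j"
      unfolding e_int[OF v j, symmetric] by simp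
  qed
  have "monomial m ?x d * u = (\<Sum>v\<in>?K. of_int (Poly_Mapping.lookup F v) *
      (monomial m ?x d * ((\<Prod>j<m. ?x $ j powi (g $ j)) * (\<Prod>j<m. ?x $ j powi Bv v j))))"
    unfolding u mpoly_eval_def sum_distrib_left
    by (intro sum.cong refl) (simp add: yhat)
  also have "\<dots> = (\<Sum>v\<in>?K. of_int (Poly_Mapping.lookup F v) * monomial m ?x (e v))"
    by (intro sum.cong refl) (simp add: summand)
  finally have "monomial m ?x d * u
      = (\<Sum>v\<in>?K. of_int (Poly_Mapping.lookup F v) * monomial m ?x (e v))" .
  moreover have "e v \<in> exponents m" for v by (simp add: e_def exponents_def)
  ultimately show ?thesis using that[OF F, of e d] e_int unfolding Bv_def by blast
qed

lemma compat_cong: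
  assumes c: "compat m n b l s" and b: "\<And>i j. i < m \<Longrightarrow> j < n \<Longrightarrow> b' i j = b i j"
  shows "compat m n b' l s"
proof -
  interpret compat m n b l s by (rule c)
  show ?thesis
  proof
    fix j i assume "j < n" "i < m"
    then show "(\<Sum>p<m. b' p j * l p i) = (if i = j then s j else 0)" using comp b by simp
  qed (use nm pos skew in blast)+
qed

section \<open>Propagation of properties over the regular tree\<close>

lemma tree_edge_sym: "tree_edge n k t t' \<Longrightarrow> tree_edge n k t' t"
  by (auto simp: tree_edge_def)

lemma tree_edge_less: "tree_edge n k t t' \<Longrightarrow> k < n"
  by (auto simp: tree_edge_def tree_verts_def)

lemma tree_induct:
  assumes t: "t \<in> tree_verts n" and root: "R []"
    and step: "\<And>k t t'. \<lbrakk>tree_edge n k t t'; R t\<rbrakk> \<Longrightarrow> R t'"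
  shows "R t"
  using t
proof (induction t)
  case (Cons k t)
  then have t: "t \<in> tree_verts n" by (auto simp: tree_verts_def distinct_adj_Cons)
  then have "tree_edge n k t (k # t)" using Cons.prems by (simp add: tree_edge_def)
  then show ?case using step Cons.IH[OF t] by blast
qed (rule root)

text \<open>Edges can be traversed in both directions: first from \<open>w\<close> back to the root,
  then out to \<open>t\<close>. The compatible vertex need not be the root.\<close>

lemma tree_connected:
  assumes w: "w \<in> tree_verts n" "R w" and t: "t \<in> tree_verts n"
    and step: "\<And>k t t'. \<lbrakk>tree_edge n k t t'; R t\<rbrakk> \<Longrightarrow> R t'"
  shows "R t"
proof -
  have "R w \<longrightarrow> R []"
    by (rule tree_induct[OF w(1)]) (use step tree_edge_sym in blast)+
  then show ?thesis using tree_induct[OF t, of R] w step by blast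
qed

text \<open>Brings expansions indexed by different sets to a common set of exponents, where their
  coefficients can be subtracted.\<close>

lemma sum_monomials_reindex:
  assumes K: "finite K" and inj: "inj_on e K"
  obtains a :: "(nat \<Rightarrow> nat) \<Rightarrow> int" where "\<And>v. v \<in> K \<Longrightarrow> a (e v) = c v" "\<And>E. E \<notin> e ` K \<Longrightarrow> a E = 0"
    "\<And>U. finite U \<Longrightarrow> e ` K \<subseteq> U \<Longrightarrow>
      (\<Sum>v\<in>K. of_int (c v) * monomial m x (e v)) = (\<Sum>E\<in>U. of_int (a E) * monomial m x E)"
proof -
  define a where "a E = (if E \<in> e ` K then c (inv_into K e E) else 0)" for E
  have 1: "a (e v) = c v" if "v \<in> K" for v
    unfolding a_def inv_into_f_f[OF inj that] using that by simp
  have 2: "a E = 0" if "E \<notin> e ` K" for E using that by (simp only: a_def if_False)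
  have "(\<Sum>v\<in>K. of_int (c v) * monomial m x (e v)) = (\<Sum>E\<in>U. of_int (a E) * monomial m x E)"
    if U: "finite U" "e ` K \<subseteq> U" for U
  proof -
    have "(\<Sum>E\<in>U. of_int (a E) * monomial m x E) = (\<Sum>E\<in>e ` K. of_int (a E) * monomial m x E)"
      using U 2 by (intro sum.mono_neutral_right ballI) simp_all
    also have "\<dots> = (\<Sum>v\<in>K. of_int (a (e v)) * monomial m x (e v))"
      by (simp only: sum.reindex[OF inj] comp_def)
    also have "\<dots> = (\<Sum>v\<in>K. of_int (c v) * monomial m x (e v))"
      by (intro sum.cong refl) (simp only: 1)
    finally show ?thesis by (rule sym)
  qed
  then show ?thesis using that[OF 1 2] by simp
qed

text \<open>Otherwise the difference of the two expansions would be a vanishing combination with the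
  nonzero coefficient \<open>c v\<close> at \<open>e v\<close>, against independence of
  monomials.\<close>

lemma leading_exponent_mem:
  assumes x: "free_generating m x" and K: "finite K" "finite K'"
    and e: "e ` K \<subseteq> exponents m" "e' ` K' \<subseteq> exponents m" and inj: "inj_on e K" "inj_on e' K'"
    and eq: "(\<Sum>v\<in>K. of_int (c v) * monomial m x (e v))
        = (\<Sum>v\<in>K'. of_int (c' v) * monomial m x (e' v))"
    and v: "v \<in> K" "c v \<noteq> 0"
  shows "e v \<in> e' ` K'"
proof (rule ccontr)
  assume nm: "e v \<notin> e' ` K'"
  let ?U = "e ` K \<union> e' ` K'"
  have U: "finite ?U" "e ` K \<subseteq> ?U" "e' ` K' \<subseteq> ?U" "?U \<subseteq> exponents m" using K e by simp_all
  obtain a where a: "a (e v) = c v"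
    "(\<Sum>v\<in>K. of_int (c v) * monomial m x (e v)) = (\<Sum>E\<in>?U. of_int (a E) * monomial m x E)"
    using sum_monomials_reindex[OF K(1) inj(1), of c m x] v(1) U by metis
  obtain a' where a': "a' (e v) = 0"
    "(\<Sum>v\<in>K'. of_int (c' v) * monomial m x (e' v)) = (\<Sum>E\<in>?U. of_int (a' E) * monomial m x E)"
    using sum_monomials_reindex[OF K(2) inj(2), of c' m x] nm U by metis
  have "(\<Sum>E\<in>?U. of_int (a E - a' E) * monomial m x E) = 0"
    using eq a(2) a'(2) by (simp only: of_int_diff left_diff_distrib sum_subtractf diff_self)
  then have "a (e v) - a' (e v) = 0"
    by (rule monomials_independent[OF x U(1,4)]) (use v in simp)
  then show False using a(1) a'(1) v(2) by simp
qed

section \<open>Compatible pairs at all vertices\<close>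

context Lambda_categorification begin

abbreviation B :: "nat list \<Rightarrow> nat \<Rightarrow> nat \<Rightarrow> int" where
  "B t \<equiv> \<lambda>i j. bm P t $$ (i, j)"

lemma seed:
  assumes "t \<in> tree_verts n"
  shows "free_generating m (xv P t)" "dim_vec (xv P t) = m" "bm P t \<in> carrier_mat m n"
  using pattern assms unfolding cluster_pattern_def is_seed_def free_generating_def
      mutation_matrix_def
  by auto

lemma edge:
  assumes "tree_edge n k t t'"
  shows "\<And>i. \<lbrakk>i < m; i \<noteq> k\<rbrakk> \<Longrightarrow> xv P t' $ i = xv P t $ i"
    and "xv P t' $ k = (monomial m (xv P t) (\<lambda>j. nat [B t j k]\<^sub>+)
      + monomial m (xv P t) (\<lambda>j. nat [- B t j k]\<^sub>+)) / xv P t $ k"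
    and "\<And>i j. \<lbrakk>i < m; j < n\<rbrakk> \<Longrightarrow> B t' i j = (if i = k \<or> j = k then - B t i j
     else B t i j + [B t i k]\<^sub>+ * [B t k j]\<^sub>+ - [- B t i k]\<^sub>+ * [- B t k j]\<^sub>+)"
proof -
  have t: "t \<in> tree_verts n" using assms by (simp add: tree_edge_def)
  have km: "k < m" using tree_edge_less[OF assms] nm by simp
  have "P t' = mutate_seed k (P t)" using pattern assms unfolding cluster_pattern_def by blast
  then have x: "xv P t' = vec m (\<lambda>i. if i = k then
        ((\<Prod>j<m. xv P t $ j ^ nat [B t j k]\<^sub>+) + (\<Prod>j<m. xv P t $ j ^ nat [- B t j k]\<^sub>+)) / xv P t $ k
      else xv P t $ i)" and b: "bm P t' = mutate_mat k (bm P t)"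
    by (simp_all only: mutate_seed_def split_def fst_conv snd_conv seed(2)[OF t])
  show "xv P t' $ i = xv P t $ i" if "i < m" "i \<noteq> k" for i using that by (simp add: x)
  show "xv P t' $ k = (monomial m (xv P t) (\<lambda>j. nat [B t j k]\<^sub>+)
      + monomial m (xv P t) (\<lambda>j. nat [- B t j k]\<^sub>+)) / xv P t $ k"
    using km by (simp add: x monomial_def)
  show "B t' i j = (if i = k \<or> j = k then - B t i j
     else B t i j + [B t i k]\<^sub>+ * [B t k j]\<^sub>+ - [- B t i k]\<^sub>+ * [- B t k j]\<^sub>+)" if "i < m" "j <
         n" for i j
    using that seed(3)[OF t] by (simp add: b mutate_mat_def)
qed

lemma mono_obj_edge:
  assumes e: "tree_edge n k t t'" and i: "i < m" "i \<noteq> k"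
  shows "iso_objs C (mono_obj t' (unit_exp i)) (mono_obj t (unit_exp i))"
proof -
  have t: "t \<in> tree_verts n" "t' \<in> tree_verts n" using e by (auto simp: tree_edge_def)
  have "val (mono_obj t' (unit_exp i)) = val (mono_obj t (unit_exp i))"
    by (simp only: mono_obj_val[OF t(1)] mono_obj_val[OF t(2)] monomial_unit[OF i(1)] edge(1)[OF e
        i])
  then show ?thesis using val_simple_imp_iso(1)[OF simple_in_Obj[OF mono_obj_simple[OF t(2)]]
      mono_obj_simple[OF t(1)]] by blast
qed

text \<open>Mutation of \<open>\<Lambda>_t\<close> is derived from the axioms: the exchange relation
  expands the new cluster object with \<open>d\<close> the unit exponent at \<open>k\<close> and two
  terms, so \<open>\<Lambda>_max\<close> computes its pairing with the other cluster
  variables.\<close>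

lemma compat_edge:
  assumes e: "tree_edge n k t t'" and c: "compat m n (B t) (lam t) s"
  shows "compat_mutation m n (B t) (lam t) s k (lam t')"
proof -
  interpret compat m n "B t" "lam t" s by (rule c)
  have t: "t \<in> tree_verts n" "t' \<in> tree_verts n" using e by (auto simp: tree_edge_def)
  have kn: "k < n" using tree_edge_less[OF e] .
  have km: "k < m" using kn nm by simp
  show ?thesis
  proof
    show "k < n" by (rule kn)
    show "lam t' i j = - lam t' j i" for i j by (rule lam_skew[OF t(2)])
    show "lam t' i j = lam t i j" if "i < m" "j < m" "i \<noteq> k" "j \<noteq> k" for i j
      unfolding lam_def
      using \<Lambda>_simple_iso[OF mono_obj_simple[OF t(2)] mono_obj_simple[OF t(2)] mono_obj_edge[OF e]
          mono_obj_edge[OF e]] that by blast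
    fix i assume i: "i < m" "i \<noteq> k"
    let ?M = "mono_obj t' (unit_exp k)"
    let ?e = "\<lambda>v j. if v then nat [B t j k]\<^sub>+ else nat [- B t j k]\<^sub>+"
    have nz: "xv P t $ k \<noteq> 0" using free_generating_nonzero[OF seed(1)[OF t(1)] km] .
    have valM: "val ?M = xv P t' $ k" by (simp only: mono_obj_val[OF t(2)] monomial_unit[OF km])
    have exp: "monomial m (xv P t) (unit_exp k) * val ?M
        = (\<Sum>v\<in>UNIV. of_int 1 * monomial m (xv P t) (?e v))"
      unfolding valM edge(2)[OF e] monomial_unit[OF km] UNIV_bool using nz
        by (simp add: add.commute)
    \<comment> \<open>The exponents of the two exchange monomials differ by column \<open>k\<close>,
      which pairs to zero with every \<open>i\<close> other than \<open>k\<close>; the maximum is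
      thus over equal numbers.\<close>
    have w: "\<Lambda> (mono_obj t (?e v)) (mono_obj t (unit_exp i)) = (\<Sum>p<m. [- B t p k]\<^sub>+ * lam t p i)"
        for v
    proof -
      have "(\<Sum>j<m. lam t p j * int (unit_exp i j)) = lam t p i" for p
      proof -
        have "(\<Sum>j<m. lam t p j * int (unit_exp i j)) = (\<Sum>j<m. if j = i then lam t p j else 0)"
          by (intro sum.cong) auto
        then show ?thesis using i by simp
      qed
      then have "\<Lambda> (mono_obj t (?e v)) (mono_obj t (unit_exp i)) = (\<Sum>p<m. int (?e v p) * lam t p i)"
        using \<Lambda>_mono_obj_mono_obj[OF t(1), of "?e v" "unit_exp i"] by simp
      also have "\<dots> = (\<Sum>p<m. [- B t p k]\<^sub>+ * lam t p i) + (if v then \<Sum>p<m. B t p k * lam t p i else 0)"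
      proof (cases v)
        case True
        have "int (?e True p) = [- B t p k]\<^sub>+ + B t p k" for p by simp
        then show ?thesis using True by (simp only: distrib_right sum.distrib if_True)
      next
        case False
        then show ?thesis by simp
      qed
      finally show ?thesis using comp[OF kn i(1)] i(2) by simp
    qed
    have "\<Lambda> ?M (mono_obj t (unit_exp i)) + lam t k i
        = Max ((\<lambda>v. \<Lambda> (mono_obj t (?e v)) (mono_obj t (unit_exp i))) ` UNIV)"
      unfolding lam_def
      by (rule \<Lambda>_max(1)[OF t(1) mono_obj_simple[OF t(2)] finite_UNIV _ exp]) simp
    also have "\<dots> = (\<Sum>p<m. [- B t p k]\<^sub>+ * lam t p i)" unfolding w by simp
    finally have "\<Lambda> ?M (mono_obj t (unit_exp i)) = (\<Sum>p<m. [- B t p k]\<^sub>+ * lam t p i) - lam t k i"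
      by simp
    moreover have "lam t' k i = \<Lambda> ?M (mono_obj t (unit_exp i))"
      unfolding lam_def
      using \<Lambda>_simple_iso[OF mono_obj_simple[OF t(2)] mono_obj_simple[OF t(2)] iso_objs_refl
          mono_obj_edge[OF e i]]
        simple_in_Obj[OF mono_obj_simple[OF t(2)]] by blast
    ultimately show "lam t' k i = (\<Sum>p<m. [- B t p k]\<^sub>+ * lam t p i) - lam t k i" by simp
  qed
qed

text \<open>Mutation preserves compatibility together with its diagonal, so the diagonal at the
  given vertex \<open>w\<close> serves everywhere.\<close>

lemma ex_compat: "\<exists>s. \<forall>t \<in> tree_verts n. compat m n (B t) (lam t) s"
proof -
  obtain w where w: "w \<in> tree_verts n"
      and cp: "compatible_pair m n (bm P w) (Lambda_mat m P C \<phi> \<Lambda> w)"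
    using ex_compatible by blast
  let ?L = "Lambda_mat m P C \<phi> \<Lambda> w"
  obtain s where s: "\<forall>i<n. s i > 0"
    and eq: "transpose_mat (bm P w) * ?L = mat n m (\<lambda>(i, j). if i = j then s i else 0)"
    and Bc: "bm P w \<in> carrier_mat m n" and Lc: "?L \<in> carrier_mat m m"
    using cp unfolding compatible_pair_def by blast
  have cw: "compat m n (B w) (lam w) s"
  proof
    show "n \<le> m" by (rule nm)
    show "0 < s j" if "j < n" for j using s that by blast
    show "lam w i j = - lam w j i" for i j by (rule lam_skew[OF w])
    fix j i assume j: "j < n" and i: "i < m"
    have "(\<Sum>p<m. B w p j * lam w p i) = (transpose_mat (bm P w) * ?L) $$ (j, i)"
      using Bc Lc j i Lambda_mat_eq_lam[OF w _ i]
      by (simp add: scalar_prod_def atLeast0LessThan)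
    also have "\<dots> = (if i = j then s j else 0)" unfolding eq using i j by auto
    finally show "(\<Sum>p<m. B w p j * lam w p i) = (if i = j then s j else 0)" .
  qed
  have "compat m n (B t) (lam t) s" if t: "t \<in> tree_verts n" for t
  proof (rule tree_connected[where R = "\<lambda>t. compat m n (B t) (lam t) s", OF w cw t])
    fix k t t' assume e: "tree_edge n k t t'" and c: "compat m n (B t) (lam t) s"
    interpret compat_mutation m n "B t" "lam t" s k "lam t'" by (rule compat_edge[OF e c])
    show "compat m n (B t') (lam t') s"
      by (rule compat_cong[OF compat_mutate]) (simp add: b'_def edge(3)[OF e])
  qed
  then show ?thesis by blast
qed

definition comp_diag :: "nat \<Rightarrow> int" where
  "comp_diag = (SOME s. \<forall>t \<in> tree_verts n. compat m n (B t) (lam t) s)"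

lemma compat: "t \<in> tree_verts n \<Longrightarrow> compat m n (B t) (lam t) comp_diag"
  using someI_ex[OF ex_compat] unfolding comp_diag_def by blast

subsection \<open>Uniqueness of g-vectors\<close>

text \<open>Full column rank of the exchange matrix recovers \<open>v\<close> from
  \<open>B v\<close>.\<close>

lemma exponents_of_pointed_inj:
  assumes t: "t \<in> tree_verts n" and F: "mpoly_in n (F :: (nat \<Rightarrow>\<^sub>0 nat) \<Rightarrow>\<^sub>0 int)"
    and e: "\<And>v j. v \<in> Poly_Mapping.keys F \<Longrightarrow> j < m \<Longrightarrow>
      int (e v j) = int (d j) + g $ j + (\<Sum>k<n. B t j k * int (Poly_Mapping.lookup v k))"
  shows "inj_on e (Poly_Mapping.keys F)"
proof (rule inj_onI)
  interpret compat m n "B t" "lam t" comp_diag by (rule compat[OF t])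
  fix v w assume v: "v \<in> Poly_Mapping.keys F" and w: "w \<in> Poly_Mapping.keys F" and eq: "e v = e w"
  have "(\<Sum>k<n. B t j k * int (Poly_Mapping.lookup v k))
      = (\<Sum>k<n. B t j k * int (Poly_Mapping.lookup w k))"
    if "j < m" for j
    using e[OF v that] e[OF w that] eq by simp
  then have "Poly_Mapping.lookup v k = Poly_Mapping.lookup w k" if "k < n" for k
    using columns_inj[of "\<lambda>k. int (Poly_Mapping.lookup v k)"
        "\<lambda>k. int (Poly_Mapping.lookup w k)" k] that by simp
  moreover have "Poly_Mapping.lookup v k = 0" "Poly_Mapping.lookup w k = 0" if "\<not> k < n" for k
    using F v w that unfolding mpoly_in_def by (meson in_keys_iff lessThan_iff subsetD)+
  ultimately show "v = w" by (intro poly_mapping_eqI) metis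
qed

text \<open>The leading exponent of each expansion occurs in the other, giving
  \<open>g = g' + B v\<close> and \<open>g' = g + B w\<close> with \<open>v\<close> and
  \<open>w\<close> nonnegative. Then \<open>B (v + w) = 0\<close>, so \<open>v + w = 0\<close> by
  full rank, and \<open>v = 0\<close> by nonnegativity.\<close>

lemma pointed_unique:
  assumes t: "t \<in> tree_verts n" and p: "pointed m n P t u g" "pointed m n P t u g'"
  shows "g = g'"
proof -
  interpret compat m n "B t" "lam t" comp_diag by (rule compat[OF t])
  note x = seed(1)[OF t]
  let ?lk = "Poly_Mapping.lookup" and ?ks = "Poly_Mapping.keys"
  obtain F d e where F: "mpoly_in n F" "?lk F 0 = 1"
    and e: "\<And>v. v \<in> ?ks F \<Longrightarrow> e v \<in> exponents m" "\<And>v j. v \<in> ?ks F \<Longrightarrow> j < m \<Longrightarrow>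
      int (e v j) = int (d j) + g $ j + (\<Sum>k<n. B t j k * int (?lk v k))"
    and eq: "monomial m (xv P t) d * u = (\<Sum>v\<in>?ks F. of_int (?lk F v) * monomial m (xv P t) (e v))"
    by (rule pointed_expansion[OF x p(1)]) (rule that)
  obtain F' d' e' where F': "mpoly_in n F'" "?lk F' 0 = 1"
    and e': "\<And>v. v \<in> ?ks F' \<Longrightarrow> e' v \<in> exponents m" "\<And>v j. v \<in> ?ks F' \<Longrightarrow> j < m \<Longrightarrow>
      int (e' v j) = int (d' j) + g' $ j + (\<Sum>k<n. B t j k * int (?lk v k))"
    and eq': "monomial m (xv P t) d' * u
        = (\<Sum>v\<in>?ks F'. of_int (?lk F' v) * monomial m (xv P t) (e' v))"
    by (rule pointed_expansion[OF x p(2)]) (rule that)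
  \<comment> \<open>Each expansion is multiplied by the denominator of the other, so that both
    represent the same element.\<close>
  let ?E = "\<lambda>v j. d' j + e v j" and ?E' = "\<lambda>v j. d j + e' v j"
  have mono: "monomial m (xv P t) (\<lambda>j. a j + b j) = monomial m (xv P t) a * monomial m (xv P t) b"
      for a b
    by (rule monomial_add)
  have eqs: "(\<Sum>v\<in>?ks F. of_int (?lk F v) * monomial m (xv P t) (?E v))
      = (\<Sum>v\<in>?ks F'. of_int (?lk F' v) * monomial m (xv P t) (?E' v))"
  proof -
    have "(\<Sum>v\<in>?ks F. of_int (?lk F v) * monomial m (xv P t) (?E v))
        = (\<Sum>v\<in>?ks F. monomial m (xv P t) d' * (of_int (?lk F v) * monomial m (xv P t) (e v)))"
      by (intro sum.cong refl) (simp only: mono mult.left_commute)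
    also have "\<dots> = monomial m (xv P t) d' * (monomial m (xv P t) d * u)"
      by (simp only: eq sum_distrib_left)
    also have "\<dots> = monomial m (xv P t) d * (monomial m (xv P t) d' * u)" by (rule mult.left_commute)
    also have "\<dots> = (\<Sum>v\<in>?ks F'. monomial m (xv P t) d * (of_int (?lk F' v) * monomial m (xv P t) (e' v)))"
      by (simp only: eq' sum_distrib_left)
    also have "\<dots> = (\<Sum>v\<in>?ks F'. of_int (?lk F' v) * monomial m (xv P t) (?E' v))"
      by (intro sum.cong refl) (simp only: mono mult.left_commute)
    finally show ?thesis .
  qed
  have truncate: "monomial m (xv P t) (\<lambda>j. if j < m then a j else 0) = monomial m (xv P t) a" for a
    unfolding monomial_def by simp
  let ?G = "\<lambda>v j. if j < m then ?E v j else 0" and ?G' = "\<lambda>v j. if j < m then ?E' v j else 0"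
  have Gx: "?G ` ?ks F \<subseteq> exponents m" "?G' ` ?ks F' \<subseteq> exponents m" by (auto simp: exponents_def)
  have G: "int (?G v j) = int (d j + d' j) + g $ j + (\<Sum>k<n. B t j k * int (?lk v k))"
    if "v \<in> ?ks F" "j < m" for v j using e(2)[OF that] that(2) by simp
  have G': "int (?G' v j) = int (d j + d' j) + g' $ j + (\<Sum>k<n. B t j k * int (?lk v k))"
    if "v \<in> ?ks F'" "j < m" for v j using e'(2)[OF that] that(2) by simp
  have inj: "inj_on ?G (?ks F)" "inj_on ?G' (?ks F')"
    by (rule exponents_of_pointed_inj[OF t F(1), of ?G "\<lambda>j. d j + d' j" g], rule G, assumption+)
      (rule exponents_of_pointed_inj[OF t F'(1), of ?G' "\<lambda>j. d j + d' j" g'], rule G', assumption+)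
  have eqG: "(\<Sum>v\<in>?ks F. of_int (?lk F v) * monomial m (xv P t) (?G v))
      = (\<Sum>v\<in>?ks F'. of_int (?lk F' v) * monomial m (xv P t) (?G' v))"
    unfolding truncate by (rule eqs)
  have k0: "0 \<in> ?ks F" "0 \<in> ?ks F'" using F F' by (auto simp: in_keys_iff)
  have "?G 0 \<in> ?G' ` ?ks F'"
    by (rule leading_exponent_mem[OF x finite_keys finite_keys Gx inj eqG k0(1)]) (simp add: F)
  then obtain v where v: "v \<in> ?ks F'" "?G 0 = ?G' v" by blast
  have "?G' 0 \<in> ?G ` ?ks F"
    by (rule leading_exponent_mem[OF x finite_keys finite_keys Gx(2,1) inj(2,1) eqG[symmetric]
        k0(2)]) (simp add: F')
  then obtain w where w: "w \<in> ?ks F" "?G' 0 = ?G w" by blast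
  have 1: "g $ j = g' $ j + (\<Sum>k<n. B t j k * int (?lk v k))" if j: "j < m" for j
    using G[OF k0(1) j] G'[OF v(1) j] fun_cong[OF v(2), of j] by simp
  have 2: "g' $ j = g $ j + (\<Sum>k<n. B t j k * int (?lk w k))" if j: "j < m" for j
    using G'[OF k0(2) j] G[OF w(1) j] fun_cong[OF w(2), of j] by simp
  have "int (?lk v k) + int (?lk w k) = 0" if k: "k < n" for k
  proof -
    have "(\<Sum>k<n. B t j k * (int (?lk v k) + int (?lk w k))) = (\<Sum>k<n. B t j k * 0)" if j: "j < m"
        for j
      using 1[OF j] 2[OF j] by (simp add: distrib_left sum.distrib)
    from columns_inj[of "\<lambda>k. int (?lk v k) + int (?lk w k)" "\<lambda>_. 0", OF this k] show ?thesis by simp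
  qed
  then have "?lk v k = 0" if "k < n" for k using that by fastforce
  then have "g $ j = g' $ j" if "j < m" for j using 1[OF that] by simp
  moreover have "g \<in> carrier_vec m" "g' \<in> carrier_vec m" using p unfolding pointed_def by blast+
  ultimately show ?thesis by (intro eq_vecI) auto
qed

lemma gvec_eq: "\<lbrakk>t \<in> tree_verts n; pointed m n P t u g\<rbrakk> \<Longrightarrow> gvec m n P u t = g"
  unfolding gvec_def using pointed_unique by blast

lemma gvec_monomial:
  assumes t: "t \<in> tree_verts n"
  shows "gvec m n P (monomial m (xv P t) a) t = vec m (\<lambda>i. int (a i))"
proof (rule gvec_eq[OF t])
  let ?F = "Poly_Mapping.single 0 1 :: (nat \<Rightarrow>\<^sub>0 nat) \<Rightarrow>\<^sub>0 int"
  have "mpoly_in n ?F" "Poly_Mapping.lookup ?F 0 = 1" "mpoly_eval of_int (yhat m P t) ?F = 1"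
    by (simp_all add: mpoly_in_def mpoly_eval_def)
  moreover have "(\<Prod>j<m. xv P t $ j powi (vec m (\<lambda>i. int (a i)) $ j)) = monomial m (xv P t) a"
    by (simp add: monomial_def)
  ultimately show "pointed m n P t (monomial m (xv P t) a) (vec m (\<lambda>i. int (a i)))"
    unfolding pointed_def by (intro conjI exI[of _ ?F]) simp_all
qed

subsection \<open>Tropical invariants\<close>

abbreviation init :: "'f set" where
  "init \<equiv> {xv P [] $ i | i. i < m}"

lemma root_in: "[] \<in> tree_verts n"
  by (simp add: tree_verts_def)

lemma init_nonzero:
  assumes "z \<in> subtraction_free init" shows "z \<noteq> 0"
proof -
  note x = seed(1)[OF root_in]
  obtain A A' where g: "valid_poly m A" "valid_poly m A'"
      and z: "z = pos_poly m (xv P []) A / pos_poly m (xv P []) A'"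
    using subtraction_free_quotient[OF x assms] by (elim exE conjE)
  then show ?thesis using pos_poly_nonzero[OF x] by simp
qed

lemma init_hom:
  assumes "semifield_hom (subtraction_free init) \<beta>" shows "semifield_hom_on init \<beta>"
proof
  show "semifield_hom (subtraction_free init) \<beta>" by (rule assms)
  show "z \<noteq> 0" if "z \<in> subtraction_free init" for z using init_nonzero that .
  have "xv P [] $ 0 \<in> init" using n_pos nm by force
  then show "init \<noteq> {}" by blast
qed

text \<open>Exchange relations involve products, one sum and one division only, so induction along
  the tree applies.\<close>

lemma cluster_subtraction_free:
  assumes "t \<in> tree_verts n"
  shows "\<forall>i<m. xv P t $ i \<in> subtraction_free init"
proof (rule tree_induct[where R = "\<lambda>t. \<forall>i<m. xv P t $ i \<in> subtraction_free init", OF assms])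
  show "\<forall>i<m. xv P [] $ i \<in> subtraction_free init"
  proof (intro allI impI subtraction_free.gen)
    fix i assume "i < m"
    then show "xv P [] $ i \<in> init" by blast
  qed
  fix k t t' assume e: "tree_edge n k t t'" and IH: "\<forall>i<m. xv P t $ i \<in> subtraction_free init"
  have km: "k < m" using tree_edge_less[OF e] nm by simp
  have x: "free_generating m (xv P [])" by (rule seed(1)[OF root_in])
  \<comment> \<open>The weight 0 is an arbitrary choice: any homomorphism gives access to the
    closure of subtraction-free elements under monomials.\<close>
  interpret semifield_hom_on init "trop_eval m (xv P []) (\<lambda>_. 0)"
    by (rule init_hom[OF trop_eval_hom[OF x]])
  have mono: "monomial m (xv P t) a \<in> subtraction_free init" for a
    using hom_monomial[of m "xv P t" a] IH by simp
  have "xv P t $ k \<in> subtraction_free init" using IH km by simp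
  then have k: "xv P t' $ k \<in> subtraction_free init"
    unfolding edge(2)[OF e] by (rule subtraction_free.divide[OF subtraction_free.add[OF mono mono]])
  show "\<forall>i<m. xv P t' $ i \<in> subtraction_free init"
  proof (intro allI impI)
    fix i assume i: "i < m"
    show "xv P t' $ i \<in> subtraction_free init"
      using k IH i edge(1)[OF e i] by (cases "i = k") simp_all
  qed
qed

lemma gvec_tropical:
  assumes u: "good m n P u" and e: "tree_edge n k t t'"
  shows "gvec m n P u t' $ k = - (gvec m n P u t $ k)"
    and "\<lbrakk>i < m; i \<noteq> k\<rbrakk> \<Longrightarrow> gvec m n P u t' $ i = gvec m n P u t $ i
      + [- B t i k]\<^sub>+ * gvec m n P u t $ k + B t i k * [gvec m n P u t $ k]\<^sub>+"
proof -
  have "tropical_point m n P (gvec m n P u)" using u by (simp add: good_def)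
  then have "gvec m n P u t' $ k = - (gvec m n P u t $ k) \<and>
      (\<forall>i<m. i \<noteq> k \<longrightarrow> gvec m n P u t' $ i = gvec m n P u t $ i
        + [- B t i k]\<^sub>+ * gvec m n P u t $ k + B t i k * [gvec m n P u t $ k]\<^sub>+)"
    using e unfolding tropical_point_def by blast
  then show "gvec m n P u t' $ k = - (gvec m n P u t $ k)"
    "\<lbrakk>i < m; i \<noteq> k\<rbrakk> \<Longrightarrow> gvec m n P u t' $ i = gvec m n P u t $ i
      + [- B t i k]\<^sub>+ * gvec m n P u t $ k + B t i k * [gvec m n P u t $ k]\<^sub>+" by blast+
qed

lemma good_pointed:
  assumes u: "good m n P u" and t: "t \<in> tree_verts n" shows "pointed m n P t u (gvec m n P u t)"
proof -
  obtain g where "pointed m n P t u g" using u t unfolding good_def by blast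
  then show ?thesis using gvec_eq[OF t] by simp
qed

lemma Lambda_mat_gvec:
  assumes u: "good m n P u" and t: "t \<in> tree_verts n" and i: "i < m"
  shows "(Lambda_mat m P C \<phi> \<Lambda> t *\<^sub>v gvec m n P u t) $ i = (\<Sum>j<m. lam t i j * gvec m n P u t $ j)"
proof -
  have g: "gvec m n P u t \<in> carrier_vec m" using good_pointed[OF u t] by (simp add: pointed_def)
  have L: "Lambda_mat m P C \<phi> \<Lambda> t \<in> carrier_mat m m" by (simp add: Lambda_mat_def)
  have "(Lambda_mat m P C \<phi> \<Lambda> t *\<^sub>v gvec m n P u t) $ i
      = (\<Sum>j<m. Lambda_mat m P C \<phi> \<Lambda> t $$ (i, j) * gvec m n P u t $ j)"
    using g L i by (auto simp: scalar_prod_def atLeast0LessThan intro!: sum.cong)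
  also have "\<dots> = (\<Sum>j<m. lam t i j * gvec m n P u t $ j)"
    by (intro sum.cong refl) (simp add: Lambda_mat_eq_lam[OF t i])
  finally show ?thesis .
qed

definition tau :: "'f \<Rightarrow> 'f \<Rightarrow> int" where
  "tau u = trop_hom m n P (Lambda_mat m P C \<phi> \<Lambda>) u"

text \<open>\<open>trop_hom\<close> is a choice, so a witness is required. The values at the root
  determine \<open>\<beta>\<close>; they agree with \<open>\<Lambda>_t g_t\<close> at every vertex
  because \<open>trop_vector_mutate\<close> is the tropical image of the exchange relation.\<close>

lemma tau:
  assumes u: "good m n P u"
  shows "semifield_hom (subtraction_free init) (tau u)"
    and "\<And>t i. \<lbrakk>t \<in> tree_verts n; i < m\<rbrakk> \<Longrightarrow> tau u (xv P t $ i)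
        = (\<Sum>j<m. lam t i j * gvec m n P u t $ j)"
proof -
  let ?g = "gvec m n P u"
  define w where "w i = (\<Sum>j<m. lam [] i j * ?g [] $ j)" for i
  define \<beta> where "\<beta> = trop_eval m (xv P []) w"
  note x = seed(1)[OF root_in]
  have hom: "semifield_hom (subtraction_free init) \<beta>" unfolding \<beta>_def by (rule trop_eval_hom[OF x])
  interpret semifield_hom_on init \<beta> by (rule init_hom[OF hom])
  have \<beta>: "\<forall>i<m. \<beta> (xv P t $ i) = (\<Sum>j<m. lam t i j * ?g t $ j)" if t: "t \<in> tree_verts n" for t
  proof (rule tree_induct[where R =
      "\<lambda>t. \<forall>i<m. \<beta> (xv P t $ i) = (\<Sum>j<m. lam t i j * ?g t $ j)", OF t])
    show "\<forall>i<m. \<beta> (xv P [] $ i) = (\<Sum>j<m. lam [] i j * ?g [] $ j)"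
      using trop_eval_gen[OF x] unfolding \<beta>_def w_def by simp
    fix k t t' assume e: "tree_edge n k t t'"
        and IH: "\<forall>i<m. \<beta> (xv P t $ i) = (\<Sum>j<m. lam t i j * ?g t $ j)"
    have t: "t \<in> tree_verts n" using e by (simp add: tree_edge_def)
    have km: "k < m" using tree_edge_less[OF e] nm by simp
    interpret cm: compat_mutation m n "B t" "lam t" comp_diag k "lam t'"
      by (rule compat_edge[OF e compat[OF t]])
    note sf = cluster_subtraction_free[OF t, rule_format]
    have mono: "monomial m (xv P t) a \<in> subtraction_free init"
      "\<beta> (monomial m (xv P t) a) = (\<Sum>i<m. int (a i) * (\<Sum>j<m. lam t i j * ?g t $ j))" for a
      using hom_monomial[of m "xv P t" a] sf IH by simp_all
    note tv = cm.trop_vector_mutate[of "\<lambda>j. ?g t' $ j" "\<lambda>j. ?g t $ j", OF gvec_tropical[OF u e]]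
    have k: "\<beta> (xv P t' $ k) = (\<Sum>j<m. lam t' k j * ?g t' $ j)"
      unfolding edge(2)[OF e] using sf[OF km] mono tv(2) IH km
      by (simp add: hom_divide hom_add subtraction_free.add)
    show "\<forall>i<m. \<beta> (xv P t' $ i) = (\<Sum>j<m. lam t' i j * ?g t' $ j)"
    proof (intro allI impI)
      fix i assume i: "i < m"
      show "\<beta> (xv P t' $ i) = (\<Sum>j<m. lam t' i j * ?g t' $ j)"
      proof (cases "i = k")
        case True
        then show ?thesis using k by simp
      next
        case False
        then show ?thesis using edge(1)[OF e i False] IH i tv(1)[OF _ _ i False] by simp
      qed
    qed
  qed
  let ?Q = "\<lambda>\<beta>. semifield_hom (subtraction_free init) \<beta> \<and>
     (\<forall>t \<in> tree_verts n. \<forall>i<m. \<beta> (xv P t $ i) = (Lambda_mat m P C \<phi> \<Lambda> t *\<^sub>v gvec m n P u t) $ i)"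
  have "?Q \<beta>" using hom \<beta> Lambda_mat_gvec[OF u] by simp
  then have Q: "?Q (tau u)" unfolding tau_def trop_hom_def by (rule someI[where P = ?Q])
  then show "semifield_hom (subtraction_free init) (tau u)" by blast
  show "tau u (xv P t $ i) = (\<Sum>j<m. lam t i j * gvec m n P u t $ j)" if "t \<in> tree_verts n" "i < m"
      for t i
    using Q Lambda_mat_gvec[OF u that] that by simp
qed

text \<open>Both orders of the arguments are settled for reachable \<open>N\<close> and good
  \<open>M\<close>; exchanging the two objects then covers the case of reachable
  \<open>M\<close>.\<close>

lemma \<Lambda>_reachable:
  assumes M: "simple_obj C M" "good m n P (val M)"
    and N: "simple_obj C N" "good m n P (val N)" "val N = monomial m (xv P t) a"
    and t: "t \<in> tree_verts n"
  shows "\<Lambda> M N = tau (val N) (val M)" and "\<Lambda> N M = tau (val M) (val N)"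
proof -
  let ?x = "xv P t" and ?lk = "Poly_Mapping.lookup" and ?ks = "Poly_Mapping.keys"
  interpret c: compat m n "B t" "lam t" comp_diag by (rule compat[OF t])
  note x = seed(1)[OF t]
  define g where "g = gvec m n P (val M) t"
  obtain F d e where F: "mpoly_in n F" "?lk F 0 = 1"
    and e: "\<And>v. v \<in> ?ks F \<Longrightarrow> e v \<in> exponents m" "\<And>v j. v \<in> ?ks F \<Longrightarrow> j < m \<Longrightarrow>
      int (e v j) = int (d j) + g $ j + (\<Sum>k<n. B t j k * int (?lk v k))"
    and eq: "monomial m ?x d * val M = (\<Sum>v\<in>?ks F. of_int (?lk F v) * monomial m ?x (e v))"
    by (rule pointed_expansion[OF x good_pointed[OF M(2) t, folded g_def]]) (rule that)
  have k0: "0 \<in> ?ks F" using F by (simp add: in_keys_iff)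
  then have ne: "?ks F \<noteq> {}" by blast
  have inj: "inj_on e (?ks F)" by (rule exponents_of_pointed_inj[OF t F(1) e(2)])
  have pos: "0 < ?lk F v" if v: "v \<in> ?ks F" for v
  proof -
    have O: "mono_obj t d \<in> Obj C" "M \<in> Obj C" using mono_obj_simple[OF t] M(1) simple_in_Obj
      by blast+
    have "val (mono_obj t d \<boxtimes> M) = (\<Sum>v\<in>?ks F. of_int (?lk F v) * val (mono_obj t (e v)))"
      by (simp only: val_tensor[OF O] mono_obj_val[OF t] eq)
    moreover have "inj_on (\<lambda>v. val (mono_obj t (e v))) (?ks F)"
    proof (rule inj_onI)
      fix v w assume vw: "v \<in> ?ks F" "w \<in> ?ks F"
          and "val (mono_obj t (e v)) = val (mono_obj t (e w))"
      then have "e v = e w" using monomial_inj[OF x e(1) e(1)] by (simp only: mono_obj_val[OF t])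
      then show "v = w" using inj_onD[OF inj] vw by blast
    qed
    ultimately have "0 \<le> ?lk F v"
      by (intro coeff_nonneg[OF tens_in[OF O] finite_keys mono_obj_simple[OF t] _ _ v])
    then show ?thesis using v by (simp add: in_keys_iff)
  qed
  have isoN: "iso_objs C N (mono_obj t a)"
    using val_simple_imp_iso(1)[OF simple_in_Obj[OF N(1)] mono_obj_simple[OF t]] N(3)
        mono_obj_val[OF t] by simp
  have isoM: "iso_objs C M M" using iso_objs_refl simple_in_Obj M(1) by blast
  have gN: "gvec m n P (val N) t = vec m (\<lambda>i. int (a i))" unfolding N(3)
    by (rule gvec_monomial[OF t])
  note sf = cluster_subtraction_free[OF t, rule_format]
  show "\<Lambda> M N = tau (val N) (val M)"
  proof -
    interpret h: semifield_hom_on init "tau (val N)" by (rule init_hom[OF tau(1)[OF N(2)]])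
    have x_val: "tau (val N) (?x $ i) = (\<Sum>j<m. lam t i j * int (a j))" if "i < m" for i
      using tau(2)[OF N(2) t that] gN by simp
    have mono: "monomial m ?x b \<in> subtraction_free init"
      "tau (val N) (monomial m ?x b) = \<Lambda> (mono_obj t b) (mono_obj t a)" for b
      using h.hom_monomial[of m ?x b] sf x_val \<Lambda>_mono_obj_mono_obj[OF t, of b a] by simp_all
    have sum: "monomial m ?x d * val M \<in> subtraction_free init"
      "tau (val N) (monomial m ?x d * val M)
          = Max ((\<lambda>v. \<Lambda> (mono_obj t (e v)) (mono_obj t a)) ` ?ks F)"
      unfolding eq using h.hom_sum[OF finite_keys ne, of "\<lambda>v. monomial m ?x (e v)"
          "?lk F"] mono pos by simp_all
    have nz: "monomial m ?x d \<noteq> 0" using init_nonzero mono(1) by blast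
    \<comment> \<open>This writes \<open>val M\<close> as a quotient of subtraction-free elements,
      on which the chosen homomorphism is controlled. The positive coefficients disappear under
      \<open>max\<close>.\<close>
    have "tau (val N) (val M) = tau (val N) (monomial m ?x d * val M / monomial m ?x d)" using nz
      by simp
    also have "\<dots> = Max ((\<lambda>v. \<Lambda> (mono_obj t (e v)) (mono_obj t a)) ` ?ks F) - \<Lambda> (mono_obj t d) (mono_obj t a)"
      unfolding h.hom_divide[OF sum(1) mono(1)] sum(2) mono(2) ..
    also have "\<dots> = \<Lambda> M (mono_obj t a)"
      using \<Lambda>_max(1)[OF t M(1) finite_keys pos eq, of a] by simp
    also have "\<dots> = \<Lambda> M N" using \<Lambda>_simple_iso[OF M(1) N(1) isoM isoN] by simp
    finally show ?thesis by simp
  qed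
  show "\<Lambda> N M = tau (val M) (val N)"
  proof -
    interpret h: semifield_hom_on init "tau (val M)" by (rule init_hom[OF tau(1)[OF M(2)]])
    have tau_N: "tau (val M) (val N) = (\<Sum>i<m. int (a i) * (\<Sum>j<m. lam t i j * g $ j))"
      unfolding N(3) using h.hom_monomial[of m ?x a] sf tau(2)[OF M(2) t] by (simp add: g_def)
    \<comment> \<open>Compatibility read on the other side gives \<open>\<Lambda> B\<close> the
      entries \<open>- s\<close>, so the term \<open>v\<close> falls below the leading one by
      \<open>\<Sum> a_i s_i v_i\<close> over the mutable indices.\<close>
    have w: "\<Lambda> (mono_obj t a) (mono_obj t (e v))
        = \<Lambda> (mono_obj t a) (mono_obj t d) + tau (val M) (val N)
        - (\<Sum>i<n. int (a i) * comp_diag i * int (?lk v i))" if v: "v \<in> ?ks F" for v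
    proof -
      have row: "(\<Sum>j<m. lam t i j * int (e v j))
          = (\<Sum>j<m. lam t i j * int (d j)) + (\<Sum>j<m. lam t i j * g $ j)
          - (if i < n then comp_diag i * int (?lk v i) else 0)" if i: "i < m" for i
      proof -
        have "(\<Sum>j<m. lam t i j * (\<Sum>k<n. B t j k * int (?lk v k)))
            = - (\<Sum>j<m. (\<Sum>k<n. B t j k * int (?lk v k)) * lam t j i)"
          unfolding sum_negf[symmetric] using lam_skew[OF t, of i] by (intro sum.cong refl) simp
        then show ?thesis using c.sum_columns[OF i, of "\<lambda>k. int (?lk v k)"] e(2)[OF v]
          by (simp add: distrib_left sum.distrib)
      qed
      have "\<Lambda> (mono_obj t a) (mono_obj t (e v)) = (\<Sum>i<m. int (a i) * ((\<Sum>j<m. lam t i j * int (d j))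
          + (\<Sum>j<m. lam t i j * g $ j) - (if i < n then comp_diag i * int (?lk v i) else 0)))"
        unfolding \<Lambda>_mono_obj_mono_obj[OF t, of a "e v"]
          by (intro sum.cong refl) (simp only: row lessThan_iff)
      also have "\<dots> = \<Lambda> (mono_obj t a) (mono_obj t d) + tau (val M) (val N)
          - (\<Sum>i<m. int (a i) * (if i < n then comp_diag i * int (?lk v i) else 0))"
        unfolding tau_N \<Lambda>_mono_obj_mono_obj[OF t, of a d]
        by (simp only: right_diff_distrib distrib_left sum.distrib sum_subtractf)
      also have "(\<Sum>i<m. int (a i) * (if i < n then comp_diag i * int (?lk v i) else 0))
          = (\<Sum>i<n. int (a i) * comp_diag i * int (?lk v i))"
        using nm by (intro sum.mono_neutral_cong_right) auto
      finally show ?thesis .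
    qed
    have "Max ((\<lambda>v. \<Lambda> (mono_obj t a) (mono_obj t (e v))) ` ?ks F)
        = \<Lambda> (mono_obj t a) (mono_obj t d) + tau (val M) (val N)"
    proof (rule Max_eqI)
      show "\<Lambda> (mono_obj t a) (mono_obj t d) + tau (val M) (val N)
          \<in> (\<lambda>v. \<Lambda> (mono_obj t a) (mono_obj t (e v))) ` ?ks F"
        \<comment> \<open>The exponent 0 occurs because the F-polynomial has constant term 1, and
          there the deficit vanishes.\<close>
        by (rule image_eqI[OF _ k0]) (simp add: w[OF k0])
      fix y assume "y \<in> (\<lambda>v. \<Lambda> (mono_obj t a) (mono_obj t (e v))) ` ?ks F"
      then obtain v where v: "v \<in> ?ks F" "y = \<Lambda> (mono_obj t a) (mono_obj t (e v))" by blast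
      have "0 \<le> (\<Sum>i<n. int (a i) * comp_diag i * int (?lk v i))"
        using c.pos by (intro sum_nonneg mult_nonneg_nonneg) (auto intro: less_imp_le)
      then show "y \<le> \<Lambda> (mono_obj t a) (mono_obj t d) + tau (val M) (val N)" using w[OF v(1)] v(2)
        by simp
    qed simp
    then have "\<Lambda> (mono_obj t a) M = tau (val M) (val N)"
      using \<Lambda>_max(2)[OF t M(1) finite_keys pos eq, of a] by simp
    then show ?thesis using \<Lambda>_simple_iso[OF N(1) M(1) isoN isoM] by simp
  qed
qed

end

lemma Lambda_categorificationI:
  assumes "0 < n" "n \<le> m" "cluster_pattern m n P"
    and L: "Lambda_monoidal_categorification m n P K C \<phi> \<Omega> \<Lambda>"
  shows "Lambda_categorification K C \<phi> m n P \<Omega> \<Lambda>"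
proof -
  have mc: "monoidal_categorification m n P K C \<phi>"
    using L by (simp add: Lambda_monoidal_categorification_def)
  have iso: "\<phi> \<in> ring_iso (K0 C) (cluster_ring m n P)" and K0: "ring (K0 C)"
    and mon: "monoidal_abelian_mcat K C" and fl: "\<forall>X \<in> Obj C. finite_length C X"
    and cm: "\<forall>z. cluster_monomial m n P z \<longrightarrow> (\<exists>M. simple_obj C M \<and> \<phi> (K0_class C M) = z)"
    using mc by (simp_all add: monoidal_categorification_def)
  have hom: "\<phi> \<in> Ring.ring_hom (K0 C) (cluster_ring m n P)"
      and bij: "bij_betw \<phi> (carrier (K0 C)) (carrier (cluster_ring m n P))"
    using iso by (simp_all add: ring_iso_def)
  interpret monoidal_abelian_mcat K C by (rule mon)
  show ?thesis
  proof (intro Lambda_categorification.intro categorification.intro finite_length_mcat.intro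
      Lambda_categorification_axioms.intro
      categorification_axioms.intro finite_length_mcat_axioms.intro)
    show "monoidal_abelian_mcat K C" "abelian_mcat K C" by unfold_locales
    show "finite_length C X" if "X \<in> Obj C" for X using fl that by blast
    show "ring (K0 C)" by (rule K0)
    show "inj_on \<phi> (carrier (K0 C))" using bij by (rule bij_betw_imp_inj_on)
    show "\<phi> (x \<oplus>\<^bsub>K0 C\<^esub> y) = \<phi> x + \<phi> y" if "x \<in> carrier (K0 C)" "y \<in> carrier (K0 C)" for x y
      using Ring.ring_hom_add[OF hom that] by (simp add: cluster_ring_def)
    show "\<phi> (x \<otimes>\<^bsub>K0 C\<^esub> y) = \<phi> x * \<phi> y" if "x \<in> carrier (K0 C)" "y \<in> carrier (K0 C)" for x y
      using Ring.ring_hom_mult[OF hom that] by (simp add: cluster_ring_def)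
    show "\<exists>M. simple_obj C M \<and> \<phi> (K0_class C M) = z" if "cluster_monomial m n P z" for z
      using cm that by blast
    show "Lambda_structure C \<Omega> \<Lambda>"
      using L unfolding Lambda_monoidal_categorification_def by (elim conjE)
    show "simple_obj C (M \<nabla>\<^bsub>C\<^esub> N)"
      if "simple_obj C M" "simple_obj C N" "real_simple C M \<or> real_simple C N" for M N
      using L that unfolding Lambda_monoidal_categorification_def by blast
    show "\<exists>w \<in> tree_verts n. compatible_pair m n (bm P w) (Lambda_mat m P C \<phi> \<Lambda> w)"
      using L unfolding Lambda_monoidal_categorification_def by (elim conjE)
  qed (use assms in simp_all)
qed

theorem theorem1p9:
  fixes m n :: nat
    and P :: "'f::field_char_0 pattern"
    and K :: "('k, 'r) ring_scheme"
    and C :: "('o, 'a, 'k, 'z) mon_cat_scheme"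
    and \<phi> :: "('o \<Rightarrow>\<^sub>0 int) set \<Rightarrow> 'f"
    and \<Omega> :: "'o set"
    and \<Lambda> :: "'o \<Rightarrow> 'o \<Rightarrow> int"
    and M N :: 'o
  assumes "0 < n" and "n \<le> m"
    and "cluster_pattern m n P"
    and "Lambda_monoidal_categorification m n P K C \<phi> \<Omega> \<Lambda>"
    and "simple_obj C M" and "simple_obj C N"
    and "good m n P (\<phi> (K0_class C M))"
    and "good m n P (\<phi> (K0_class C N))"
    and "reachable m n P C \<phi> M \<or> reachable m n P C \<phi> N"
  shows "\<Lambda> M N =
           trop_pairing m n P (Lambda_mat m P C \<phi> \<Lambda>) (\<phi> (K0_class C M)) (\<phi> (K0_class C N)) \<and>
         2 * dinv \<Lambda> M N =
           of_int (F_pairing m n P (Lambda_mat m P C \<phi> \<Lambda>) (\<phi> (K0_class C M)) (\<phi> (K0_class C N)))"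
proof -
  interpret Lambda_categorification K C \<phi> m n P \<Omega> \<Lambda>
    by (rule Lambda_categorificationI[OF assms(1-4)])
  have g: "good m n P (val M)" "good m n P (val N)" using assms(7,8) by (simp_all add: val_def)
  have reach: "\<exists>t \<in> tree_verts n. \<exists>a. val X = monomial m (xv P t) a" if "reachable m n P C \<phi> X" for X
    using that unfolding reachable_def cluster_monomial_def monomial_def val_def by blast
  have "\<Lambda> M N = tau (val N) (val M) \<and> \<Lambda> N M = tau (val M) (val N)"
    using assms(9)
  proof
    assume "reachable m n P C \<phi> M"
    then obtain t a where "t \<in> tree_verts n" "val M = monomial m (xv P t) a" using reach by blast
    \<comment> \<open>The roles of \<open>M\<close> and \<open>N\<close> are exchanged, so the two
      conclusions appear in the opposite order.\<close>
    then show ?thesis using \<Lambda>_reachable[OF assms(6) g(2) assms(5) g(1)] by blast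
  next
    assume "reachable m n P C \<phi> N"
    then obtain t a where "t \<in> tree_verts n" "val N = monomial m (xv P t) a" using reach by blast
    then show ?thesis using \<Lambda>_reachable[OF assms(5) g(1) assms(6) g(2)] by blast
  qed
  then show ?thesis
    by (simp add: trop_pairing_def F_pairing_def dinv_def tau_def val_def)
qed

end
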